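(* Let $(E_7)^{\lambda\gamma}=\{\alpha\in E_7\mid(\lambda\gamma)\alpha(\lambda\gamma)^{-1}=\alpha\}$ and $(E_7)^{\iota\lambda\gamma}=\{\alpha\in E_7\mid(\iota\lambda\gamma)\alpha(\iota\lambda\gamma)^{-1}=\alpha\}$. Then $$(E_7)^{\lambda\gamma}\cap (E_7)^{\iota\lambda\gamma}\;\cong\;(Sp(4)/\mathbf{Z}_2)\times\mathcal{Z}_2,\qquad \mathbf{Z}_2=\{E,-E\},\quad\mathcal{Z}_2=\{1,-1\}.$$
   Context: Let $\mathbf{H}$ be the quaternions and $\mathfrak{C}=\mathbf{H}\oplus\mathbf{H}e_4$ the division Cayley algebra with product $(m+ae_4)(n+be_4)=(mn-\overline{b}a)+(a\overline{n}+bm)e_4$. Let $\mathfrak{J}=\{X\in M(3,\mathfrak{C})\mid X^*=X\}$, $\mathfrak{J}^C=\mathfrak{J}\oplus i\mathfrak{J}$ its complexification ($C=\mathbf{R}\oplus\mathbf{R}i$), $\tau$ the complex conjugation, $X\circ Y=\frac12(XY+YX)$, $(X,Y)=\mathrm{tr}(X\circ Y)$, $X\times Y=\frac12\big(2X\circ Y-\mathrm{tr}(X)Y-\mathrm{tr}(Y)X+(\mathrm{tr}(X)\mathrm{tr}(Y)-(X,Y))E\big)$, $\langle X,Y\rangle=(\tau X,Y)$. Let ${\mathfrak{e}_6}^C=\{\phi\in\mathrm{Hom}_C(\mathfrak{J}^C,\mathfrak{J}^C)\mid(\phi X,X\times X)=0\}$, and ${}^t\phi$ the transpose with respect to $(X,Y)$.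 For $X,W\in\mathfrak{J}^C$ define $X\vee W\in{\mathfrak{e}_6}^C$ by $(X\vee W)U=\frac12(W,U)X+\frac16(X,W)U-2W\times(X\times U)$. Let $\mathfrak{P}^C=\mathfrak{J}^C\oplus\mathfrak{J}^C\oplus C\oplus C$ with $\langle P,Q\rangle=\langle X,Z\rangle+\langle Y,W\rangle+(\tau\xi)\zeta+(\tau\eta)\omega$ for $P=(X,Y,\xi,\eta)$, $Q=(Z,W,\zeta,\omega)$. For $\phi\in{\mathfrak{e}_6}^C$, $A,B\in\mathfrak{J}^C$, $\nu\in C$ define $\varPhi(\phi,A,B,\nu):\mathfrak{P}^C\to\mathfrak{P}^C$ by $(X,Y,\xi,\eta)\mapsto(\phi X-\frac13\nu X+2B\times Y+\eta A,\ 2A\times X-{}^t\phi Y+\frac13\nu Y+\xi B,\ (A,Y)+\nu\xi,\ (B,X)-\nu\eta)$. Define $P\times Q=\varPhi(\phi,A,B,\nu)$ with $\phi=-\frac12(X\vee W+Z\vee Y)$, $A=-\frac14(2Y\times W-\xi Z-\zeta X)$, $B=\frac14(2X\times Z-\eta W-\omega Y)$, $\nu=\frac18((X,W)+(Z,Y)-3(\xi\omega+\zeta\eta))$. Then $E_7=\{\alpha\in\mathrm{Iso}_C(\mathfrak{P}^C)\mid\alpha(P\times Q)\alpha^{-1}=\alpha P\times\alpha Q,\ \langle\alpha P,\alpha Q\rangle=\langle P,Q\rangle\}$. Elements of $E_7$: $\gamma(X,Y,\xi,\eta)=(\gamma X,\gamma Y,\xi,\eta)$ with $\gamma$ acting on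 $\mathfrak{J}^C$ entrywise ($C$-linearly) by $\gamma(x+ye_4)=x-ye_4$ ($x,y\in\mathbf{H}$); $\lambda(X,Y,\xi,\eta)=(Y,-X,\eta,-\xi)$; $\iota(X,Y,\xi,\eta)=(-iX,iY,-i\xi,i\eta)$. $-1$ denotes the central element $-\mathrm{id}$ of $E_7$. $Sp(4)=\{A\in M(4,\mathbf{H})\mid AA^*=E\}$. *)

theory Defs
  imports "HOL-Analysis.Analysis" "HOL-Algebra.Coset"
begin

section \<open>Quaternions and Cayley algebra over a coefficient ring\<close>

text \<open>
  All algebras are defined over an arbitrary coefficient ring. Coefficients in \<^typ>\<open>real\<close> give
  the algebras H, the division Cayley algebra and J; coefficients in \<^typ>\<open>complex\<close> give their
  complexifications, \<open>x + iy\<close> being formed coefficientwise. In particular the conjugation of the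
  complexified algebras is C-linear.
\<close>

datatype 'a quat = Quat (q0: 'a) (q1: 'a) (q2: 'a) (q3: 'a)

instantiation quat :: (comm_ring_1) ring_1
begin

definition "0 = Quat 0 0 0 0"
definition "1 = Quat 1 0 0 0"
definition "x + y = Quat (q0 x + q0 y) (q1 x + q1 y) (q2 x + q2 y) (q3 x + q3 y)"
definition "x - y = Quat (q0 x - q0 y) (q1 x - q1 y) (q2 x - q2 y) (q3 x - q3 y)"
definition "- x = Quat (- q0 x) (- q1 x) (- q2 x) (- q3 x)"
definition "x * y = Quat
  (q0 x * q0 y - q1 x * q1 y - q2 x * q2 y - q3 x * q3 y)
  (q0 x * q1 y + q1 x * q0 y + q2 x * q3 y - q3 x * q2 y)
  (q0 x * q2 y - q1 x * q3 y + q2 x * q0 y + q3 x * q1 y)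
  (q0 x * q3 y + q1 x * q2 y - q2 x * q1 y + q3 x * q0 y)"

instance
  by standard
    (auto simp: zero_quat_def one_quat_def plus_quat_def minus_quat_def uminus_quat_def
      times_quat_def algebra_simps)

end

definition qcnj :: "'a::comm_ring_1 quat \<Rightarrow> 'a quat"
  where "qcnj x = Quat (q0 x) (- q1 x) (- q2 x) (- q3 x)"

definition qscale :: "'a::comm_ring_1 \<Rightarrow> 'a quat \<Rightarrow> 'a quat"
  where "qscale c x = Quat (c * q0 x) (c * q1 x) (c * q2 x) (c * q3 x)"

text \<open>\<open>Cay m a\<close> stands for \<open>m + a e\<^sub>4\<close>.\<close>

datatype 'a cay = Cay (cfst: "'a quat") (csnd: "'a quat")

instantiation cay :: (comm_ring_1) "{ab_group_add, times}"
begin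

definition "0 = Cay 0 0"
definition "x + y = Cay (cfst x + cfst y) (csnd x + csnd y)"
definition "x - y = Cay (cfst x - cfst y) (csnd x - csnd y)"
definition "- x = Cay (- cfst x) (- csnd x)"
definition "x * y = Cay
  (cfst x * cfst y - qcnj (csnd y) * csnd x)
  (csnd x * qcnj (cfst y) + csnd y * cfst x)"

instance
  by standard
    (auto simp: zero_cay_def plus_cay_def minus_cay_def uminus_cay_def algebra_simps)

end

definition ccnj :: "'a::comm_ring_1 cay \<Rightarrow> 'a cay"
  where "ccnj x = Cay (qcnj (cfst x)) (- csnd x)"

definition cscale :: "'a::comm_ring_1 \<Rightarrow> 'a cay \<Rightarrow> 'a cay"
  where "cscale c x = Cay (qscale c (cfst x)) (qscale c (csnd x))"

definition cgamma :: "'a::comm_ring_1 cay \<Rightarrow> 'a cay"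
  where "cgamma x = Cay (cfst x) (- csnd x)"

lemmas cay_quat_defs =
  zero_quat_def one_quat_def plus_quat_def minus_quat_def uminus_quat_def times_quat_def
  qcnj_def qscale_def zero_cay_def plus_cay_def minus_cay_def uminus_cay_def times_cay_def
  ccnj_def cscale_def cgamma_def

lemma ccnj_add: "ccnj (x + y) = ccnj x + ccnj y"
  by (simp add: cay_quat_defs)

lemma ccnj_diff: "ccnj (x - y) = ccnj x - ccnj y"
  by (simp add: cay_quat_defs)

lemma ccnj_minus: "ccnj (- x) = - ccnj x"
  by (simp add: cay_quat_defs)

lemma ccnj_zero: "ccnj 0 = 0"
  by (simp add: cay_quat_defs)

lemma ccnj_scale: "ccnj (cscale c x) = cscale c (ccnj x)"
  by (simp add: cay_quat_defs)

lemma ccnj_gamma: "ccnj (cgamma x) = cgamma (ccnj x)"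
  by (simp add: cay_quat_defs)

lemma ccnj_mult: "ccnj (x * y) = ccnj y * ccnj x"
  by (simp add: cay_quat_defs algebra_simps)

lemma ccnj_sum: "ccnj (sum f S) = (\<Sum>k\<in>S. ccnj (f k))"
  by (induction S rule: infinite_finite_induct) (auto simp: ccnj_zero ccnj_add)


section \<open>The Jordan algebra of Hermitian 3x3 matrices\<close>

text \<open>
  The library product \<open>**\<close> requires an associative ring of entries, so it is not available for
  matrices of Cayley numbers.
\<close>

definition cmat_mult :: "'a::comm_ring_1 cay^3^3 \<Rightarrow> 'a cay^3^3 \<Rightarrow> 'a cay^3^3"
  where "cmat_mult X Y = (\<chi> i j. \<Sum>k\<in>UNIV. X $ i $ k * Y $ k $ j)"

definition cmat_adj :: "'a::comm_ring_1 cay^3^3 \<Rightarrow> 'a cay^3^3"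
  where "cmat_adj X = (\<chi> i j. ccnj (X $ j $ i))"

definition cmat_map :: "('a cay \<Rightarrow> 'b cay) \<Rightarrow> 'a cay^3^3 \<Rightarrow> 'b cay^3^3"
  where "cmat_map f X = (\<chi> i j. f (X $ i $ j))"

typedef (overloaded) ('a::field) jordan = "{X :: 'a cay^3^3. cmat_adj X = X}"
  morphisms jmat Abs_jordan
  by (rule exI[of _ "\<chi> i j. 0"]) (simp add: cmat_adj_def vec_eq_iff ccnj_zero)

setup_lifting type_definition_jordan

instantiation jordan :: (field) ab_group_add
begin

lift_definition zero_jordan :: "'a jordan" is 0
  by (simp add: cmat_adj_def vec_eq_iff ccnj_zero)
lift_definition plus_jordan :: "'a jordan \<Rightarrow> 'a jordan \<Rightarrow> 'a jordan" is "(+)"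
  by (simp add: cmat_adj_def vec_eq_iff ccnj_add)
lift_definition minus_jordan :: "'a jordan \<Rightarrow> 'a jordan \<Rightarrow> 'a jordan" is "(-)"
  by (simp add: cmat_adj_def vec_eq_iff ccnj_diff)
lift_definition uminus_jordan :: "'a jordan \<Rightarrow> 'a jordan" is uminus
  by (simp add: cmat_adj_def vec_eq_iff ccnj_minus)

instance
  by standard (transfer; simp add: algebra_simps)+

end

lift_definition jscale :: "'a::field \<Rightarrow> 'a jordan \<Rightarrow> 'a jordan" (infixr \<open>*\<^sub>J\<close> 75)
  is "\<lambda>c. cmat_map (cscale c)"
  by (simp add: cmat_adj_def cmat_map_def vec_eq_iff ccnj_scale)

lift_definition jE :: "'a::field jordan" is "\<chi> i j. if i = j then Cay 1 0 else 0"
  by (simp add: cmat_adj_def vec_eq_iff) (auto simp: cay_quat_defs)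

lift_definition jprod :: "'a::field jordan \<Rightarrow> 'a jordan \<Rightarrow> 'a jordan"
  is "\<lambda>X Y. cmat_map (cscale (1/2)) (cmat_mult X Y + cmat_mult Y X)"
proof -
  fix X Y :: "'a cay^3^3"
  assume *: "cmat_adj X = X" "cmat_adj Y = Y"
  then have "ccnj (X $ j $ i) = X $ i $ j" "ccnj (Y $ j $ i) = Y $ i $ j" for i j
    by (auto simp: cmat_adj_def vec_eq_iff)
  then show "cmat_adj (cmat_map (cscale (1/2)) (cmat_mult X Y + cmat_mult Y X)) =
      cmat_map (cscale (1/2)) (cmat_mult X Y + cmat_mult Y X)"
    by (simp add: cmat_adj_def cmat_map_def cmat_mult_def vec_eq_iff ccnj_scale ccnj_add
        ccnj_sum ccnj_mult add.commute)
qed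

text \<open>
  The diagonal entries of a Hermitian matrix are scalars, so only their real coefficients
  contribute to the trace.
\<close>

definition jtr :: "'a::field jordan \<Rightarrow> 'a"
  where "jtr X = (\<Sum>i\<in>UNIV. q0 (cfst (jmat X $ i $ i)))"

definition jinner :: "'a::field jordan \<Rightarrow> 'a jordan \<Rightarrow> 'a"
  where "jinner X Y = jtr (jprod X Y)"

definition jcross :: "'a::field jordan \<Rightarrow> 'a jordan \<Rightarrow> 'a jordan"
  where "jcross X Y = (1/2) *\<^sub>J
    (2 *\<^sub>J jprod X Y - jtr X *\<^sub>J Y - jtr Y *\<^sub>J X + (jtr X * jtr Y - jinner X Y) *\<^sub>J jE)"

lift_definition jgamma :: "'a::field jordan \<Rightarrow> 'a jordan" is "cmat_map cgamma"
  by (simp add: cmat_adj_def cmat_map_def vec_eq_iff ccnj_gamma)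

type_synonym jC = "complex jordan"

lift_definition jtau :: "jC \<Rightarrow> jC" is "cmat_map (map_cay cnj)"
proof -
  fix X :: "complex cay^3^3"
  assume *: "cmat_adj X = X"
  have "ccnj (map_cay cnj x) = map_cay cnj (ccnj x)" for x :: "complex cay"
    by (cases x; cases "cfst x"; cases "csnd x") (auto simp: cay_quat_defs)
  with * show "cmat_adj (cmat_map (map_cay cnj) X) = cmat_map (map_cay cnj) X"
    by (simp add: cmat_adj_def cmat_map_def vec_eq_iff)
qed

definition jherm :: "jC \<Rightarrow> jC \<Rightarrow> complex"
  where "jherm X Y = jinner (jtau X) Y"

text \<open>The transpose with respect to the nondegenerate bilinear form \<^const>\<open>jinner\<close>.\<close>

definition jtransp :: "(jC \<Rightarrow> jC) \<Rightarrow> jC \<Rightarrow> jC"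
  where "jtransp \<phi> = (THE \<psi>. \<forall>X Y. jinner (\<phi> X) Y = jinner X (\<psi> Y))"

definition jvee :: "jC \<Rightarrow> jC \<Rightarrow> jC \<Rightarrow> jC"
  where "jvee X W U =
    (1/2 * jinner W U) *\<^sub>J X + (1/6 * jinner X W) *\<^sub>J U - 2 *\<^sub>J jcross W (jcross X U)"


section \<open>The Freudenthal vector space and the compact group of type \<open>E\<^sub>7\<close>\<close>

type_synonym pC = "jC \<times> jC \<times> complex \<times> complex"

definition pscale :: "complex \<Rightarrow> pC \<Rightarrow> pC"
  where "pscale c = (\<lambda>(X, Y, \<xi>, \<eta>). (c *\<^sub>J X, c *\<^sub>J Y, c * \<xi>, c * \<eta>))"

lemma vector_space_pscale: "vector_space pscale"
proof -
  have q: "qscale a (x + y) = qscale a x + qscale a y"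
    "qscale (a + b) x = qscale a x + qscale b x"
    "qscale a (qscale b x) = qscale (a * b) x" "qscale 1 x = x" for a b :: complex and x y
    by (auto simp: qscale_def plus_quat_def algebra_simps)
  have c: "cscale a (x + y) = cscale a x + cscale a y"
    "cscale (a + b) x = cscale a x + cscale b x"
    "cscale a (cscale b x) = cscale (a * b) x" "cscale 1 x = x" for a b :: complex and x y
    by (auto simp: cscale_def plus_cay_def qscale_def plus_quat_def algebra_simps)
  have "a *\<^sub>J (X + Y) = a *\<^sub>J X + a *\<^sub>J Y" "(a + b) *\<^sub>J X = a *\<^sub>J X + b *\<^sub>J X"
    "a *\<^sub>J b *\<^sub>J X = (a * b) *\<^sub>J X" "1 *\<^sub>J X = X" for a b and X Y :: jC
    by (transfer; simp add: cmat_map_def vec_eq_iff c)+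
  then show ?thesis
    by unfold_locales (auto simp: pscale_def algebra_simps)
qed

definition pherm :: "pC \<Rightarrow> pC \<Rightarrow> complex"
  where "pherm = (\<lambda>(X, Y, \<xi>, \<eta>) (Z, W, \<zeta>, \<omega>).
    jherm X Z + jherm Y W + cnj \<xi> * \<zeta> + cnj \<eta> * \<omega>)"

text \<open>
  \<open>pPhi\<close> is a total function of \<open>\<phi>\<close>; it is only applied to linear combinations of maps \<^const>\<open>jvee\<close>,
  which lie in the Lie algebra of the cubic form.
\<close>

definition pPhi :: "(jC \<Rightarrow> jC) \<Rightarrow> jC \<Rightarrow> jC \<Rightarrow> complex \<Rightarrow> pC \<Rightarrow> pC"
  where "pPhi \<phi> A B \<nu> = (\<lambda>(X, Y, \<xi>, \<eta>).
    (\<phi> X - (1/3 * \<nu>) *\<^sub>J X + 2 *\<^sub>J jcross B Y + \<eta> *\<^sub>J A,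
     2 *\<^sub>J jcross A X - jtransp \<phi> Y + (1/3 * \<nu>) *\<^sub>J Y + \<xi> *\<^sub>J B,
     jinner A Y + \<nu> * \<xi>,
     jinner B X - \<nu> * \<eta>))"

definition pcross :: "pC \<Rightarrow> pC \<Rightarrow> pC \<Rightarrow> pC"
  where "pcross = (\<lambda>(X, Y, \<xi>, \<eta>) (Z, W, \<zeta>, \<omega>). pPhi
    (\<lambda>U. (- 1/2) *\<^sub>J (jvee X W U + jvee Z Y U))
    ((- 1/4) *\<^sub>J (2 *\<^sub>J jcross Y W - \<xi> *\<^sub>J Z - \<zeta> *\<^sub>J X))
    ((1/4) *\<^sub>J (2 *\<^sub>J jcross X Z - \<eta> *\<^sub>J W - \<omega> *\<^sub>J Y))
    (1/8 * (jinner X W + jinner Z Y - 3 * (\<xi> * \<omega> + \<zeta> * \<eta>))))"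

definition E7 :: "(pC \<Rightarrow> pC) set"
  where "E7 = {\<alpha>. Vector_Spaces.linear pscale pscale \<alpha> \<and> bij \<alpha> \<and>
    (\<forall>P Q. \<alpha> \<circ> pcross P Q \<circ> inv_into UNIV \<alpha> = pcross (\<alpha> P) (\<alpha> Q)) \<and>
    (\<forall>P Q. pherm (\<alpha> P) (\<alpha> Q) = pherm P Q)}"

definition pgamma :: "pC \<Rightarrow> pC"
  where "pgamma = (\<lambda>(X, Y, \<xi>, \<eta>). (jgamma X, jgamma Y, \<xi>, \<eta>))"

definition plambda :: "pC \<Rightarrow> pC"
  where "plambda = (\<lambda>(X, Y, \<xi>, \<eta>). (Y, - X, \<eta>, - \<xi>))"

definition piota :: "pC \<Rightarrow> pC"
  where "piota = (\<lambda>(X, Y, \<xi>, \<eta>). ((- \<i>) *\<^sub>J X, \<i> *\<^sub>J Y, - \<i> * \<xi>, \<i> * \<eta>))"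

definition E7_fix :: "(pC \<Rightarrow> pC) \<Rightarrow> (pC \<Rightarrow> pC) set"
  where "E7_fix \<sigma> = {\<alpha> \<in> E7. \<sigma> \<circ> \<alpha> \<circ> inv_into UNIV \<sigma> = \<alpha>}"

definition comp_group :: "(pC \<Rightarrow> pC) set \<Rightarrow> (pC \<Rightarrow> pC) monoid"
  where "comp_group S = \<lparr>carrier = S, mult = (\<circ>), one = id\<rparr>"


section \<open>The symplectic group\<close>

definition qmat_adj :: "real quat^4^4 \<Rightarrow> real quat^4^4"
  where "qmat_adj A = (\<chi> i j. qcnj (A $ j $ i))"

definition Sp4 :: "(real quat^4^4) monoid"
  where "Sp4 = \<lparr>carrier = {A. A ** qmat_adj A = mat 1}, mult = (**), one = mat 1\<rparr>"


section \<open>Topologies\<close>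

text \<open>
  The coordinates identify each of the following types with a power of the coefficient ring (for
  \<^typ>\<open>'a jordan\<close>: with a subspace of such a power) and the topology is the one so induced. For
  real and complex coefficients it is the usual topology of a finite-dimensional vector space.
\<close>

instantiation quat :: (topological_space) topological_space
begin

definition open_quat :: "'a quat set \<Rightarrow> bool"
  where "open_quat U \<longleftrightarrow> open ((\<lambda>(a, b, c, d). Quat a b c d) -` U)"

instance
  by standard (auto simp: open_quat_def vimage_Union)

end

instantiation cay :: (topological_space) topological_space
begin

definition open_cay :: "'a cay set \<Rightarrow> bool"
  where "open_cay U \<longleftrightarrow> open ((\<lambda>(m, a). Cay m a) -` U)"

instance
  by standard (auto simp: open_cay_def vimage_Union)

end

instantiation jordan :: ("{field, topological_space}") topological_space
begin

definition open_jordan :: "'a jordan set \<Rightarrow> bool"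
  where "open_jordan U \<longleftrightarrow> (\<exists>V. open V \<and> U = jmat -` V)"

instance
proof
  show "open (UNIV :: 'a jordan set)"
    unfolding open_jordan_def by (rule exI[of _ UNIV]) simp
next
  fix S T :: "'a jordan set"
  assume "open S" "open T"
  then show "open (S \<inter> T)"
    unfolding open_jordan_def by (metis open_Int vimage_Int)
next
  fix K :: "'a jordan set set"
  assume "\<forall>S\<in>K. open S"
  then obtain V where V: "\<forall>S\<in>K. open (V S) \<and> S = jmat -` V S"
    unfolding open_jordan_def by metis
  then have "open (\<Union>S\<in>K. V S)"
    by auto
  moreover have "\<Union>K = (\<Union>S\<in>K. jmat -` V S)"
    using V by auto
  then have "\<Union>K = jmat -` (\<Union>S\<in>K. V S)"
    by auto
  ultimately show "open (\<Union>K)"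
    unfolding open_jordan_def by blast
qed

end

definition quotient_topology :: "'a topology \<Rightarrow> ('a \<Rightarrow> 'b) \<Rightarrow> 'b topology"
  where "quotient_topology T f =
    topology (\<lambda>U. U \<subseteq> f ` topspace T \<and> openin T {x \<in> topspace T. f x \<in> U})"

lemma openin_quotient_topology:
  "openin (quotient_topology T f) U \<longleftrightarrow>
    U \<subseteq> f ` topspace T \<and> openin T {x \<in> topspace T. f x \<in> U}"
proof -
  have "istopology (\<lambda>U. U \<subseteq> f ` topspace T \<and> openin T {x \<in> topspace T. f x \<in> U})"
    unfolding istopology_def
  proof (intro conjI allI impI)
    fix A B
    assume "A \<subseteq> f ` topspace T \<and> openin T {x \<in> topspace T. f x \<in> A}"
      and "B \<subseteq> f ` topspace T \<and> openin T {x \<in> topspace T. f x \<in> B}"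
    moreover have "{x \<in> topspace T. f x \<in> A \<inter> B} =
        {x \<in> topspace T. f x \<in> A} \<inter> {x \<in> topspace T. f x \<in> B}"
      by auto
    ultimately show "A \<inter> B \<subseteq> f ` topspace T" "openin T {x \<in> topspace T. f x \<in> A \<inter> B}"
      by auto
  next
    fix K
    assume *: "\<forall>A\<in>K. A \<subseteq> f ` topspace T \<and> openin T {x \<in> topspace T. f x \<in> A}"
    then show "\<Union>K \<subseteq> f ` topspace T"
      by auto
    have "{x \<in> topspace T. f x \<in> \<Union>K} = (\<Union>A\<in>K. {x \<in> topspace T. f x \<in> A})"
      by auto
    with * show "openin T {x \<in> topspace T. f x \<in> \<Union>K}"
      by auto
  qed
  then show ?thesis
    by (simp add: quotient_topology_def)
qed

text \<open>
  Isomorphism of topological groups. Groups of maps carry the topology of pointwise convergence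
  (the library topology of function spaces), which on linear maps of a finite-dimensional space is
  the usual one.
\<close>

definition top_group_iso ::
    "('a, 'c) monoid_scheme \<Rightarrow> 'a topology \<Rightarrow> ('b, 'd) monoid_scheme \<Rightarrow> 'b topology \<Rightarrow> bool"
  where "top_group_iso G S H T \<longleftrightarrow> (\<exists>f. f \<in> iso G H \<and> homeomorphic_map S T f)"

end

(*
  An element commuting with lambda gamma and iota * lambda gamma commutes with iota, so it preserves
  the eigenspaces V- = {(X,0,xi,0)} and V+ = {(0,Y,0,eta)} of iota, and its restriction to V+ is
  determined by the one to V-. For P in V- and Q in V+ the vector (P x Q)P - (P x P)Q is a multiple of
  P by -3/8 ((X,W) + xi omega), so the pairing of V- and V+ is preserved. A rank argument then shows that
  (0,0,1,0) is mapped to +-(0,0,1,0), and up to this sign the element is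
  (X,Y,xi,eta) |-> (b X, gamma b gamma Y, xi, eta), where b satisfies gamma b gamma (X x Y) = b X x b Y,
  (gamma b gamma X, b Y) = (X,Y) and commutes with the conjugation tau gamma.

  Under Yokota's map g from J^C to the trace-free complex-quaternionic Hermitian 4x4 matrices,
  tau gamma becomes entrywise complex conjugation and the Jordan product satisfies
  gX o gY = g(gamma(X x Y)) + 1/4 (gamma X, Y) E. Hence the maps b correspond to the automorphisms of the
  Jordan algebra of Hermitian matrices in M(4,H). These are the conjugations by elements of Sp(4): the
  diagonal idempotents go to rank one projections, which one moves back to the diagonal; the
  off-diagonal Peirce spaces are then multiplied by one automorphism of H, which is inner.
  Two elements of Sp(4) give the same b only if they differ by a sign, and since Sp(4) is compact the
  continuous bijection so obtained is a homeomorphism.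
*)
theory Submission
  imports Defs
begin

subsection \<open>Coordinates\<close>

text \<open>The conditions on \<open>E7\<close> contain no invariant bilinear pairing, and commuting
  with \<iota> only splits the space into V- and V+, so the vector P = (0,0,1,0) has to be
  recognised from the product alone. Its image is some (X0,0,k,0), and P x P = 0 gives k X0 = 0. On
  V- each P x Q with Q in V+ is a scalar plus a map into the line of P; if k were 0, this would make
  Z |-> W x (X0 x Z) - 1/4 (X0,W) Z take values in C X0 for every W, which is possible only for X0 =
  0. The pairing then gives k^2 = 1, and this sign is the second factor of the result.

  Trace-free matrices are not closed under the Jordan product, so b is extended by the identity on
  the multiples of E. The extension respects products because the product of two trace-free matrices
  depends only on \<gamma>(X x Y) and (\<gamma>X,Y). Commuting with \<tau>\<gamma> permits the
  restriction to real coefficients, where the norm form of H is positive definite, as the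
  projections and normalisations require.\<close>

definition qin :: "'a::comm_ring_1 quat \<Rightarrow> 'a quat \<Rightarrow> 'a"
  where "qin x y = q0 x * q0 y + q1 x * q1 y + q2 x * q2 y + q3 x * q3 y"

definition qre :: "'a::comm_ring_1 \<Rightarrow> 'a quat"
  where "qre a = Quat a 0 0 0"

lemma cay_sel [simp]:
  "cfst (x + y) = cfst x + cfst y" "csnd (x + y) = csnd x + csnd y"
  "cfst (x - y) = cfst x - cfst y" "csnd (x - y) = csnd x - csnd y"
  "cfst (- x) = - cfst x" "csnd (- x) = - csnd x"
  "cfst 0 = 0" "csnd 0 = 0"
  "cfst (x * y) = cfst x * cfst y - qcnj (csnd y) * csnd x"
  "csnd (x * y) = csnd x * qcnj (cfst y) + csnd y * cfst x"
  "cfst (ccnj x) = qcnj (cfst x)" "csnd (ccnj x) = - csnd x"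
  "cfst (cscale k x) = qscale k (cfst x)" "csnd (cscale k x) = qscale k (csnd x)"
  "cfst (cgamma x) = cfst x" "csnd (cgamma x) = - csnd x"
  for x y :: "'a::comm_ring_1 cay"
  by (simp_all add: plus_cay_def minus_cay_def uminus_cay_def zero_cay_def times_cay_def
      ccnj_def cscale_def cgamma_def)

lemma quat_sel [simp]:
  "q0 (x + y) = q0 x + q0 y" "q1 (x + y) = q1 x + q1 y"
  "q2 (x + y) = q2 x + q2 y" "q3 (x + y) = q3 x + q3 y"
  "q0 (x - y) = q0 x - q0 y" "q1 (x - y) = q1 x - q1 y"
  "q2 (x - y) = q2 x - q2 y" "q3 (x - y) = q3 x - q3 y"
  "q0 (- x) = - q0 x" "q1 (- x) = - q1 x" "q2 (- x) = - q2 x" "q3 (- x) = - q3 x"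
  "q0 0 = 0" "q1 0 = 0" "q2 0 = 0" "q3 0 = 0"
  "q0 1 = 1" "q1 1 = 0" "q2 1 = 0" "q3 1 = 0"
  "q0 (qcnj x) = q0 x" "q1 (qcnj x) = - q1 x" "q2 (qcnj x) = - q2 x" "q3 (qcnj x) = - q3 x"
  "q0 (qscale k x) = k * q0 x" "q1 (qscale k x) = k * q1 x"
  "q2 (qscale k x) = k * q2 x" "q3 (qscale k x) = k * q3 x"
  "q0 (qre k) = k" "q1 (qre k) = 0" "q2 (qre k) = 0" "q3 (qre k) = 0"
  for x y :: "'a::comm_ring_1 quat"
  by (simp_all add: cay_quat_defs qre_def)

text \<open>Kept out of the simp set, so that quaternion products stay closed until an identity is
  meant to be checked coefficientwise.\<close>

lemma quat_sel_mult:
  "q0 (x * y) = q0 x * q0 y - q1 x * q1 y - q2 x * q2 y - q3 x * q3 y"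
  "q1 (x * y) = q0 x * q1 y + q1 x * q0 y + q2 x * q3 y - q3 x * q2 y"
  "q2 (x * y) = q0 x * q2 y - q1 x * q3 y + q2 x * q0 y + q3 x * q1 y"
  "q3 (x * y) = q0 x * q3 y + q1 x * q2 y - q2 x * q1 y + q3 x * q0 y"
  for x y :: "'a::comm_ring_1 quat"
  by (simp_all add: times_quat_def)

lemma quat_eq_iff: "x = y \<longleftrightarrow> q0 x = q0 y \<and> q1 x = q1 y \<and> q2 x = q2 y \<and> q3 x = q3 y"
  by (cases x; cases y) auto

lemma cay_eq_iff: "x = y \<longleftrightarrow> cfst x = cfst y \<and> csnd x = csnd y"
  by (cases x; cases y) auto

lemma jordan_eq_iff: "X = Y \<longleftrightarrow> jmat X = jmat Y"
  by (simp add: jmat_inject)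

text \<open>\<open>jmk a b c m1 m2 m3 n1 n2 n3\<close> has diagonal \<open>a, b, c\<close> and the Cayley numbers \<open>m\<^sub>i + n\<^sub>i e\<^sub>4\<close>,
  \<open>i = 1, 2, 3\<close>, at the positions \<open>(2,3)\<close>, \<open>(3,1)\<close>, \<open>(1,2)\<close>.\<close>

lift_definition jmk :: "complex \<Rightarrow> complex \<Rightarrow> complex \<Rightarrow> complex quat \<Rightarrow> complex quat \<Rightarrow> complex quat
    \<Rightarrow> complex quat \<Rightarrow> complex quat \<Rightarrow> complex quat \<Rightarrow> jC"
  is "\<lambda>a b c m1 m2 m3 n1 n2 n3. vector [
    vector [Cay (qre a) 0, Cay m3 n3, ccnj (Cay m2 n2)],
    vector [ccnj (Cay m3 n3), Cay (qre b) 0, Cay m1 n1],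
    vector [Cay m2 n2, ccnj (Cay m1 n1), Cay (qre c) 0]]"
  by (simp add: cmat_adj_def vec_eq_iff forall_3 cay_eq_iff quat_eq_iff)

lemma jmat_jmk:
  "jmat (jmk a b c m1 m2 m3 n1 n2 n3) $ 1 $ 1 = Cay (qre a) 0"
  "jmat (jmk a b c m1 m2 m3 n1 n2 n3) $ 2 $ 2 = Cay (qre b) 0"
  "jmat (jmk a b c m1 m2 m3 n1 n2 n3) $ 3 $ 3 = Cay (qre c) 0"
  "jmat (jmk a b c m1 m2 m3 n1 n2 n3) $ 1 $ 2 = Cay m3 n3"
  "jmat (jmk a b c m1 m2 m3 n1 n2 n3) $ 2 $ 3 = Cay m1 n1"
  "jmat (jmk a b c m1 m2 m3 n1 n2 n3) $ 3 $ 1 = Cay m2 n2"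
  "jmat (jmk a b c m1 m2 m3 n1 n2 n3) $ 2 $ 1 = Cay (qcnj m3) (- n3)"
  "jmat (jmk a b c m1 m2 m3 n1 n2 n3) $ 3 $ 2 = Cay (qcnj m1) (- n1)"
  "jmat (jmk a b c m1 m2 m3 n1 n2 n3) $ 1 $ 3 = Cay (qcnj m2) (- n2)"
  by (simp_all add: jmk.rep_eq ccnj_def)

lemma jmat_herm: "jmat X $ j $ i = ccnj (jmat X $ i $ j)"
  using jmat[of X] by (simp add: cmat_adj_def vec_eq_iff)

text \<open>A diagonal entry is fixed by conjugation and thus a scalar, and three of the other six
  entries are conjugates of the chosen ones. As a case rule this turns identities in J^C into
  polynomial identities in three scalars and six quaternions.\<close>

lemma jordan_coords_cases:
  obtains a b c m1 m2 m3 n1 n2 n3 where "X = jmk a b c m1 m2 m3 n1 n2 n3"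
proof
  have d: "jmat X $ i $ i = Cay (qre (q0 (cfst (jmat X $ i $ i)))) 0" for i
    using jmat_herm[of X i i] by (auto simp: cay_eq_iff quat_eq_iff)
  show "X = jmk (q0 (cfst (jmat X $ 1 $ 1))) (q0 (cfst (jmat X $ 2 $ 2))) (q0 (cfst (jmat X $ 3 $ 3)))
     (cfst (jmat X $ 2 $ 3)) (cfst (jmat X $ 3 $ 1)) (cfst (jmat X $ 1 $ 2))
     (csnd (jmat X $ 2 $ 3)) (csnd (jmat X $ 3 $ 1)) (csnd (jmat X $ 1 $ 2))"
    using d[of 1] d[of 2] d[of 3] jmat_herm[of X 2 1] jmat_herm[of X 3 2] jmat_herm[of X 1 3]
    by (simp add: jordan_eq_iff vec_eq_iff forall_3 jmat_jmk cay_eq_iff)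
qed

lemma jmk_eq_iff: "jmk a b c m1 m2 m3 n1 n2 n3 = jmk a' b' c' p1 p2 p3 r1 r2 r3 \<longleftrightarrow>
    a = a' \<and> b = b' \<and> c = c' \<and> m1 = p1 \<and> m2 = p2 \<and> m3 = p3 \<and> n1 = r1 \<and> n2 = r2 \<and> n3 = r3"
  by (auto simp: jordan_eq_iff vec_eq_iff forall_3 jmat_jmk qre_def)

lemma jmk_add: "jmk a b c m1 m2 m3 n1 n2 n3 + jmk a' b' c' p1 p2 p3 r1 r2 r3 =
    jmk (a + a') (b + b') (c + c') (m1 + p1) (m2 + p2) (m3 + p3) (n1 + r1) (n2 + r2) (n3 + r3)"
  by (simp add: jordan_eq_iff plus_jordan.rep_eq vec_eq_iff forall_3 jmat_jmk cay_eq_iff quat_eq_iff)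

lemma jmk_diff: "jmk a b c m1 m2 m3 n1 n2 n3 - jmk a' b' c' p1 p2 p3 r1 r2 r3 =
    jmk (a - a') (b - b') (c - c') (m1 - p1) (m2 - p2) (m3 - p3) (n1 - r1) (n2 - r2) (n3 - r3)"
  by (simp add: jordan_eq_iff minus_jordan.rep_eq vec_eq_iff forall_3 jmat_jmk cay_eq_iff quat_eq_iff)

lemma jmk_minus: "- jmk a b c m1 m2 m3 n1 n2 n3 =
    jmk (- a) (- b) (- c) (- m1) (- m2) (- m3) (- n1) (- n2) (- n3)"
  by (simp add: jordan_eq_iff uminus_jordan.rep_eq vec_eq_iff forall_3 jmat_jmk cay_eq_iff quat_eq_iff)

lemma jmk_zero: "0 = jmk 0 0 0 0 0 0 0 0 0"
  by (simp add: jordan_eq_iff zero_jordan.rep_eq vec_eq_iff forall_3 jmat_jmk cay_eq_iff quat_eq_iff)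

lemma jmk_E: "jE = jmk 1 1 1 0 0 0 0 0 0"
  by (simp add: jordan_eq_iff jE.rep_eq vec_eq_iff forall_3 jmat_jmk cay_eq_iff quat_eq_iff)

lemma jmk_scale: "k *\<^sub>J jmk a b c m1 m2 m3 n1 n2 n3 =
    jmk (k * a) (k * b) (k * c) (qscale k m1) (qscale k m2) (qscale k m3)
      (qscale k n1) (qscale k n2) (qscale k n3)"
  by (simp add: jordan_eq_iff jscale.rep_eq cmat_map_def vec_eq_iff forall_3 jmat_jmk cay_eq_iff quat_eq_iff)

lemma jmk_gamma: "jgamma (jmk a b c m1 m2 m3 n1 n2 n3) = jmk a b c m1 m2 m3 (- n1) (- n2) (- n3)"
  by (simp add: jordan_eq_iff jgamma.rep_eq cmat_map_def vec_eq_iff forall_3 jmat_jmk cay_eq_iff quat_eq_iff)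

abbreviation qbar :: "complex quat \<Rightarrow> complex quat"
  where "qbar \<equiv> map_quat cnj"

lemma map_quat_sel [simp]:
  "q0 (map_quat f x) = f (q0 x)" "q1 (map_quat f x) = f (q1 x)"
  "q2 (map_quat f x) = f (q2 x)" "q3 (map_quat f x) = f (q3 x)"
  by (cases x; simp)+

lemma map_cay_sel [simp]: "cfst (map_cay f x) = map_quat f (cfst x)" "csnd (map_cay f x) = map_quat f (csnd x)"
  by (cases x; simp)+

lemma jmk_tau: "jtau (jmk a b c m1 m2 m3 n1 n2 n3) =
    jmk (cnj a) (cnj b) (cnj c) (qbar m1) (qbar m2) (qbar m3) (qbar n1) (qbar n2) (qbar n3)"
  by (simp add: jordan_eq_iff jtau.rep_eq cmat_map_def vec_eq_iff forall_3 jmat_jmk cay_eq_iff quat_eq_iff)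

lemma jtr_jmk: "jtr (jmk a b c m1 m2 m3 n1 n2 n3) = a + b + c"
  by (simp add: jtr_def sum_3 jmat_jmk)

text \<open>Cyclic in the indices: apart from the scalar terms, the entry at (2,3) is the conjugate
  of the symmetrised product of the entries at (3,1) and (1,2), and the other two follow by
  rotation. Conjugation changes the sign of the e4-part, hence the minus signs in the last three
  arguments.\<close>

lemma jprod_jmk: "jprod (jmk a b c m1 m2 m3 n1 n2 n3) (jmk a' b' c' p1 p2 p3 r1 r2 r3) =
   jmk (a * a' + (qin m2 p2 + qin n2 r2) + (qin m3 p3 + qin n3 r3))
       (b * b' + (qin m1 p1 + qin n1 r1) + (qin m3 p3 + qin n3 r3))
       (c * c' + (qin m1 p1 + qin n1 r1) + (qin m2 p2 + qin n2 r2))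
       (qscale (1/2) (qscale (b + c) p1 + qscale (b' + c') m1 + qcnj (m2 * p3 - qcnj r3 * n2 + p2 * m3 - qcnj n3 * r2)))
       (qscale (1/2) (qscale (c + a) p2 + qscale (c' + a') m2 + qcnj (m3 * p1 - qcnj r1 * n3 + p3 * m1 - qcnj n1 * r3)))
       (qscale (1/2) (qscale (a + b) p3 + qscale (a' + b') m3 + qcnj (m1 * p2 - qcnj r2 * n1 + p1 * m2 - qcnj n2 * r1)))
       (qscale (1/2) (qscale (b + c) r1 + qscale (b' + c') n1 - (n2 * qcnj p3 + r3 * m2 + r2 * qcnj m3 + n3 * p2)))
       (qscale (1/2) (qscale (c + a) r2 + qscale (c' + a') n2 - (n3 * qcnj p1 + r1 * m3 + r3 * qcnj m1 + n1 * p3)))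
       (qscale (1/2) (qscale (a + b) r3 + qscale (a' + b') n3 - (n1 * qcnj p2 + r2 * m1 + r1 * qcnj m2 + n2 * p1)))"
  by (simp add: jordan_eq_iff jprod.rep_eq cmat_map_def cmat_mult_def vec_eq_iff forall_3 sum_3 jmat_jmk
      cay_eq_iff quat_eq_iff quat_sel_mult qin_def; simp add: field_simps)

lemma jinner_jmk: "jinner (jmk a b c m1 m2 m3 n1 n2 n3) (jmk a' b' c' p1 p2 p3 r1 r2 r3) =
   a * a' + b * b' + c * c' + 2 * (qin m1 p1 + qin m2 p2 + qin m3 p3 + qin n1 r1 + qin n2 r2 + qin n3 r3)"
  by (simp add: jinner_def jprod_jmk jtr_jmk)

lemma jcross_jmk: "jcross (jmk a b c m1 m2 m3 n1 n2 n3) (jmk a' b' c' p1 p2 p3 r1 r2 r3) =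
   jmk ((b * c' + c * b') / 2 - (qin m1 p1 + qin n1 r1))
       ((c * a' + a * c') / 2 - (qin m2 p2 + qin n2 r2))
       ((a * b' + b * a') / 2 - (qin m3 p3 + qin n3 r3))
       (qscale (1/2) (qcnj (m2 * p3 - qcnj r3 * n2 + p2 * m3 - qcnj n3 * r2) - qscale a p1 - qscale a' m1))
       (qscale (1/2) (qcnj (m3 * p1 - qcnj r1 * n3 + p3 * m1 - qcnj n1 * r3) - qscale b p2 - qscale b' m2))
       (qscale (1/2) (qcnj (m1 * p2 - qcnj r2 * n1 + p1 * m2 - qcnj n2 * r1) - qscale c p3 - qscale c' m3))
       (qscale (1/2) (- (n2 * qcnj p3 + r3 * m2 + r2 * qcnj m3 + n3 * p2) - qscale a r1 - qscale a' n1))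
       (qscale (1/2) (- (n3 * qcnj p1 + r1 * m3 + r3 * qcnj m1 + n1 * p3) - qscale b r2 - qscale b' n2))
       (qscale (1/2) (- (n1 * qcnj p2 + r2 * m1 + r1 * qcnj m2 + n2 * p1) - qscale c r3 - qscale c' n3))"
  unfolding jcross_def jinner_jmk jprod_jmk jtr_jmk jmk_E jmk_scale jmk_diff jmk_add jmk_eq_iff
  by (intro conjI; simp add: quat_eq_iff; simp add: field_simps)

subsection \<open>Hermitian quaternionic matrices\<close>

definition mscale :: "'a::comm_ring_1 \<Rightarrow> 'a quat^'n^'m \<Rightarrow> 'a quat^'n^'m"
  where "mscale k N = (\<chi> i j. qscale k (N $ i $ j))"

definition madj :: "'a::comm_ring_1 quat^'n^'m \<Rightarrow> 'a quat^'m^'n"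
  where "madj N = (\<chi> i j. qcnj (N $ j $ i))"

text \<open>Only the real part of the trace is kept, as only this part is invariant under \<open>M N \<mapsto> N M\<close>.\<close>

definition mtr :: "'a::comm_ring_1 quat^'n^'n \<Rightarrow> 'a"
  where "mtr N = (\<Sum>i\<in>UNIV. q0 (N $ i $ i))"

definition mjprod :: "'a::field quat^'n^'n \<Rightarrow> 'a quat^'n^'n \<Rightarrow> 'a quat^'n^'n"
  where "mjprod M N = mscale (1/2) (M ** N + N ** M)"

lemma mscale_nth [simp]: "mscale k N $ i $ j = qscale k (N $ i $ j)"
  by (simp add: mscale_def)

lemma madj_nth [simp]: "madj N $ i $ j = qcnj (N $ j $ i)"
  by (simp add: madj_def)

lemma qcnj_mult: "qcnj (x * y) = qcnj y * qcnj x"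
  by (simp add: quat_eq_iff quat_sel_mult algebra_simps)

lemma qcnj_add: "qcnj (x + y) = qcnj x + qcnj y"
  by (simp add: quat_eq_iff)

lemma qcnj_diff: "qcnj (x - y) = qcnj x - qcnj y"
  by (simp add: quat_eq_iff)

lemma qcnj_minus: "qcnj (- x) = - qcnj x"
  by (simp add: quat_eq_iff)

lemma qcnj_qcnj [simp]: "qcnj (qcnj x) = x"
  by (simp add: quat_eq_iff)

lemma qcnj_0 [simp]: "qcnj 0 = 0" and qcnj_1 [simp]: "qcnj 1 = 1"
  by (simp_all add: quat_eq_iff)

lemma qcnj_sum: "qcnj (sum f S) = (\<Sum>k\<in>S. qcnj (f k))"
  by (induction S rule: infinite_finite_induct) (auto simp: qcnj_add)

lemma q0_sum: "q0 (sum f S) = (\<Sum>k\<in>S. q0 (f k))"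
  by (induction S rule: infinite_finite_induct) auto

lemma q0_mult_commute: "q0 (x * y) = q0 (y * x)"
  by (simp add: quat_sel_mult algebra_simps)

lemma qscale_mult_left: "qscale k x * y = qscale k (x * y)"
  and qscale_mult_right: "x * qscale k y = qscale k (x * y)"
  by (simp_all add: quat_eq_iff quat_sel_mult algebra_simps)

lemma qscale_add: "qscale k (x + y) = qscale k x + qscale k y"
  and qscale_add_left: "qscale (k + l) x = qscale k x + qscale l x"
  and qscale_qscale [simp]: "qscale k (qscale l x) = qscale (k * l) x"
  and qscale_1 [simp]: "qscale 1 x = x"
  and qscale_0 [simp]: "qscale 0 x = 0"
  and qscale_zero [simp]: "qscale k 0 = 0"
  and qcnj_scale: "qcnj (qscale k x) = qscale k (qcnj x)"
  by (simp_all add: quat_eq_iff algebra_simps)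

lemma qscale_sum: "qscale k (sum f S) = (\<Sum>i\<in>S. qscale k (f i))"
  by (induction S rule: infinite_finite_induct) (auto simp: qscale_add)

lemma madj_mult: "madj (M ** N) = madj N ** madj M"
  by (simp add: vec_eq_iff matrix_matrix_mult_def qcnj_sum qcnj_mult)

lemma madj_madj [simp]: "madj (madj N) = N"
  by (simp add: vec_eq_iff)

lemma madj_add: "madj (M + N) = madj M + madj N"
  by (simp add: vec_eq_iff qcnj_add)

lemma madj_diff: "madj (M - N) = madj M - madj N"
  by (simp add: vec_eq_iff qcnj_diff)

lemma madj_mscale: "madj (mscale k N) = mscale k (madj N)"
  by (simp add: vec_eq_iff qcnj_scale)

lemma madj_mat1 [simp]: "madj (mat 1) = mat 1"
  by (auto simp: vec_eq_iff mat_def)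

lemma mscale_mult_left: "mscale k M ** N = mscale k (M ** N)"
  and mscale_mult_right: "M ** mscale k N = mscale k (M ** N)"
  by (simp_all add: vec_eq_iff matrix_matrix_mult_def qscale_sum qscale_mult_left qscale_mult_right)

lemma mscale_add: "mscale k (M + N) = mscale k M + mscale k N"
  and mscale_add_left: "mscale (k + l) M = mscale k M + mscale l M"
  and mscale_mscale [simp]: "mscale k (mscale l M) = mscale (k * l) M"
  and mscale_1 [simp]: "mscale 1 M = M"
  and mscale_0 [simp]: "mscale 0 M = 0"
  and mscale_zero [simp]: "mscale k 0 = 0"
  by (simp_all add: vec_eq_iff qscale_add qscale_add_left)

lemma mtr_add: "mtr (M + N) = mtr M + mtr N"
  and mtr_diff: "mtr (M - N) = mtr M - mtr N"
  and mtr_mscale: "mtr (mscale k M) = k * mtr M"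
  by (simp_all add: mtr_def sum.distrib sum_subtractf sum_distrib_left)

lemma mtr_mult_commute: "mtr (M ** N) = mtr (N ** M)"
  unfolding mtr_def matrix_matrix_mult_def
  by (simp add: q0_sum) (subst sum.swap, simp add: q0_mult_commute)

lemma mtr_mat1: "mtr (mat 1 :: 'a::comm_ring_1 quat^4^4) = 4"
  by (simp add: mtr_def mat_def)

text \<open>Write \<open>X\<close> as \<open>M + a\<close> with a quaternionic Hermitian matrix \<open>M\<close> and the row \<open>a = (n\<^sub>1, n\<^sub>2, n\<^sub>3)\<close> of
  \<open>e\<^sub>4\<close>-components. Then \<open>gmat X\<close> is the trace-free Hermitian matrix with blocks \<open>t\<close>, \<open>i a\<close>, \<open>i a\<^sup>*\<close>, \<open>M - t E\<close>,
  where \<open>t = tr M / 2\<close>; \<open>hmat\<close> is the linear left inverse of \<open>gmat\<close> that annihilates \<open>E\<close>.\<close>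

definition gmat :: "jC \<Rightarrow> complex quat^4^4"
  where "gmat X = (let x = jmat X; a = q0 (cfst (x $ 1 $ 1)); b = q0 (cfst (x $ 2 $ 2));
      c = q0 (cfst (x $ 3 $ 3)); t = (a + b + c) / 2;
      m1 = cfst (x $ 2 $ 3); m2 = cfst (x $ 3 $ 1); m3 = cfst (x $ 1 $ 2);
      n1 = csnd (x $ 2 $ 3); n2 = csnd (x $ 3 $ 1); n3 = csnd (x $ 1 $ 2)
    in vector [
      vector [qre t, qscale \<i> n1, qscale \<i> n2, qscale \<i> n3],
      vector [qscale \<i> (qcnj n1), qre (a - t), m3, qcnj m2],
      vector [qscale \<i> (qcnj n2), qcnj m3, qre (b - t), m1],
      vector [qscale \<i> (qcnj n3), m2, qcnj m1, qre (c - t)]])"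

definition hmat :: "complex quat^4^4 \<Rightarrow> jC"
  where "hmat N = jmk (q0 (N $ 1 $ 1) + q0 (N $ 2 $ 2) - mtr N / 2)
    (q0 (N $ 1 $ 1) + q0 (N $ 3 $ 3) - mtr N / 2) (q0 (N $ 1 $ 1) + q0 (N $ 4 $ 4) - mtr N / 2)
    (N $ 3 $ 4) (N $ 4 $ 2) (N $ 2 $ 3)
    (qscale (- \<i>) (N $ 1 $ 2)) (qscale (- \<i>) (N $ 1 $ 3)) (qscale (- \<i>) (N $ 1 $ 4))"

lemma vector_4_nth [simp]:
  "(vector [w, x, y, z] :: 'a::zero^4) $ 1 = w" "(vector [w, x, y, z] :: 'a^4) $ 2 = x"
  "(vector [w, x, y, z] :: 'a^4) $ 3 = y" "(vector [w, x, y, z] :: 'a^4) $ 4 = z"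
  by (simp_all add: vector_def)

lemma gmat_jmk:
  "gmat (jmk a b c m1 m2 m3 n1 n2 n3) = vector [
      vector [qre ((a + b + c) / 2), qscale \<i> n1, qscale \<i> n2, qscale \<i> n3],
      vector [qscale \<i> (qcnj n1), qre (a - (a + b + c) / 2), m3, qcnj m2],
      vector [qscale \<i> (qcnj n2), qcnj m3, qre (b - (a + b + c) / 2), m1],
      vector [qscale \<i> (qcnj n3), m2, qcnj m1, qre (c - (a + b + c) / 2)]]"
  by (simp add: gmat_def jmat_jmk Let_def)

lemma gmat_add: "gmat (X + Y) = gmat X + gmat Y"
  by (cases X rule: jordan_coords_cases; cases Y rule: jordan_coords_cases)
    (simp add: jmk_add gmat_jmk vec_eq_iff forall_4 quat_eq_iff; simp add: field_simps)

lemma gmat_scale: "gmat (k *\<^sub>J X) = mscale k (gmat X)"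
  by (cases X rule: jordan_coords_cases)
    (simp add: jmk_scale gmat_jmk vec_eq_iff forall_4 quat_eq_iff; simp add: field_simps)

lemma madj_gmat: "madj (gmat X) = gmat X"
  by (cases X rule: jordan_coords_cases)
    (simp add: gmat_jmk vec_eq_iff forall_4 quat_eq_iff)

lemma mtr_gmat: "mtr (gmat X) = 0"
  by (cases X rule: jordan_coords_cases) (simp add: gmat_jmk mtr_def sum_4 field_simps)

lemma hmat_gmat: "hmat (gmat X) = X"
  unfolding hmat_def mtr_gmat
  by (cases X rule: jordan_coords_cases) (simp add: gmat_jmk jmk_eq_iff quat_eq_iff field_simps)

lemma hmat_add: "hmat (M + N) = hmat M + hmat N"
  by (simp add: hmat_def jmk_add jmk_eq_iff quat_eq_iff mtr_add field_simps)

lemma hmat_mscale: "hmat (mscale k N) = k *\<^sub>J hmat N"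
  by (simp add: hmat_def jmk_scale jmk_eq_iff quat_eq_iff mtr_mscale field_simps)

text \<open>Adding c E to N changes each diagonal parameter of \<open>hmat N\<close> by 2c - 4c/2 =
  0, so the composite is the projection onto the trace-free part.\<close>

lemma gmat_hmat:
  assumes "madj N = N"
  shows "gmat (hmat N) = N - mscale (mtr N / 4) (mat 1)"
proof -
  have "qcnj (N $ j $ i) = N $ i $ j" for i j
    using assms by (metis madj_nth)
  then have *: "q0 (N $ j $ i) = q0 (N $ i $ j) \<and> q1 (N $ j $ i) = - q1 (N $ i $ j) \<and>
    q2 (N $ j $ i) = - q2 (N $ i $ j) \<and> q3 (N $ j $ i) = - q3 (N $ i $ j)" for i j
    by (simp add: quat_eq_iff)
  have d: "q1 (N $ i $ i) = 0" "q2 (N $ i $ i) = 0" "q3 (N $ i $ i) = 0" for i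
    using *[of i i] by simp_all
  note s = *[of 2 1] *[of 3 1] *[of 4 1] *[of 3 2] *[of 4 2] *[of 4 3]
  show ?thesis
    by (simp add: vec_eq_iff forall_4 hmat_def gmat_jmk mat_def quat_eq_iff d s)
      (simp add: mtr_def sum_4 field_simps)
qed

text \<open>The factor \<open>\<i>\<close> on the e4-components makes their contribution negative,
  which accounts for \<gamma>. The choice t = tr M / 2 makes the terms in t t' cancel: 1 - 2 - 2 + 3
  = 0.\<close>

lemma mtr_gmat_mult: "mtr (gmat X ** gmat Y) = jinner (jgamma X) Y"
  by (cases X rule: jordan_coords_cases; cases Y rule: jordan_coords_cases)
   (simp add: jmk_gamma jinner_jmk gmat_jmk mtr_def matrix_matrix_mult_def sum_4 qin_def quat_sel_mult;
    simp add: field_simps)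

text \<open>The scalar term is forced by traces: the first summand is trace-free,
  \<open>mat 1\<close> has trace 4, and \<open>mtr_gmat_mult\<close> gives the trace of the left
  side.\<close>

lemma mjprod_gmat:
  "mjprod (gmat X) (gmat Y) =
     gmat (jgamma (jcross X Y)) + mscale (jinner (jgamma X) Y / 4) (mat 1)"
  by (cases X rule: jordan_coords_cases; cases Y rule: jordan_coords_cases)
   (simp add: mjprod_def vec_eq_iff forall_4 jmk_gamma jinner_jmk jcross_jmk gmat_jmk
      matrix_matrix_mult_def sum_4 qin_def quat_eq_iff quat_sel_mult mat_def;
    intro conjI; simp add: field_simps)

definition mbar :: "complex quat^4^4 \<Rightarrow> complex quat^4^4"
  where "mbar N = (\<chi> i j. qbar (N $ i $ j))"

text \<open>Complex conjugation changes the sign of the factor \<open>\<i>\<close> in the first row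
  and column, and \<gamma> compensates for it.\<close>

lemma gmat_tau_gamma: "gmat (jtau (jgamma X)) = mbar (gmat X)"
  by (cases X rule: jordan_coords_cases)
   (simp add: jmk_gamma jmk_tau gmat_jmk mbar_def vec_eq_iff forall_4 quat_eq_iff)

subsection \<open>The trace form and the cross product\<close>

lemma jscale_add: "k *\<^sub>J (X + Y) = k *\<^sub>J X + k *\<^sub>J Y"
  and jscale_diff: "k *\<^sub>J (X - Y) = k *\<^sub>J X - k *\<^sub>J Y"
  and jscale_add_left: "(k + l) *\<^sub>J X = k *\<^sub>J X + l *\<^sub>J X"
  and jscale_minus: "k *\<^sub>J (- X) = - (k *\<^sub>J X)"
  and jscale_minus_left: "(- k) *\<^sub>J X = - (k *\<^sub>J X)"
  and jscale_jscale [simp]: "k *\<^sub>J l *\<^sub>J X = (k * l) *\<^sub>J X"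
  and jscale_1 [simp]: "1 *\<^sub>J X = X"
  and jscale_0 [simp]: "0 *\<^sub>J X = 0"
  and jscale_zero [simp]: "k *\<^sub>J 0 = (0 :: jC)"
  for X Y :: jC
  by (cases X rule: jordan_coords_cases; cases Y rule: jordan_coords_cases;
      simp add: jmk_scale jmk_add jmk_diff jmk_minus jmk_zero jmk_eq_iff quat_eq_iff algebra_simps)+

lemma jscale_eq_0_iff: "k *\<^sub>J X = 0 \<longleftrightarrow> k = 0 \<or> X = 0" for X :: jC
  by (metis jscale_0 jscale_1 jscale_jscale jscale_zero left_inverse)

lemma jgamma_add: "jgamma (X + Y) = jgamma X + jgamma Y"
  and jgamma_minus: "jgamma (- X) = - jgamma X"
  and jgamma_scale: "jgamma (k *\<^sub>J X) = k *\<^sub>J jgamma X"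
  and jgamma_gamma [simp]: "jgamma (jgamma X) = X"
  and jgamma_0 [simp]: "jgamma 0 = (0 :: jC)"
  for X Y :: jC
  by (cases X rule: jordan_coords_cases; cases Y rule: jordan_coords_cases;
      simp add: jmk_gamma jmk_scale jmk_add jmk_minus jmk_zero jmk_eq_iff quat_eq_iff algebra_simps)+

lemma jtau_tau [simp]: "jtau (jtau X) = X"
  and jtau_gamma: "jtau (jgamma X) = jgamma (jtau X)"
  by (cases X rule: jordan_coords_cases; simp add: jmk_gamma jmk_tau jmk_eq_iff quat_eq_iff)+

lemma jinner_commute: "jinner X Y = jinner Y X"
  and jinner_add_left: "jinner (X + Z) Y = jinner X Y + jinner Z Y"
  and jinner_scale_left: "jinner (k *\<^sub>J X) Y = k * jinner X Y"
  for X Y :: jC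
  by (cases X rule: jordan_coords_cases; cases Y rule: jordan_coords_cases; cases Z rule: jordan_coords_cases;
      simp add: jmk_scale jmk_add jinner_jmk qin_def algebra_simps)+

lemma jinner_add_right: "jinner X (Y + Z) = jinner X Y + jinner X Z"
  and jinner_scale_right: "jinner X (k *\<^sub>J Y) = k * jinner X Y"
  for X Y :: jC
  by (metis jinner_commute jinner_add_left jinner_scale_left)+

lemma jinner_0 [simp]: "jinner 0 X = 0" "jinner X 0 = 0" for X :: jC
  by (metis jinner_scale_left jinner_scale_right jscale_0 mult_zero_left)+

lemma jinner_minus: "jinner (- X) Y = - jinner X Y" "jinner X (- Y) = - jinner X Y" for X :: jC
  by (metis jinner_scale_left jinner_scale_right jscale_1 jscale_minus_left mult_minus1)+

lemma jinner_diff: "jinner (X - Z) Y = jinner X Y - jinner Z Y"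
  "jinner X (Y - Z) = jinner X Y - jinner X Z" for X :: jC
  by (metis diff_conv_add_uminus jinner_add_left jinner_minus(1))
    (metis diff_conv_add_uminus jinner_add_right jinner_minus(2))

lemma jcross_commute: "jcross X Y = jcross Y X" for X Y :: jC
  by (cases X rule: jordan_coords_cases; cases Y rule: jordan_coords_cases)
    (simp add: jcross_jmk jmk_eq_iff quat_eq_iff quat_sel_mult qin_def algebra_simps)

lemma jcross_add_left: "jcross (X + Z) Y = jcross X Y + jcross Z Y" for X Y :: jC
  by (cases X rule: jordan_coords_cases; cases Y rule: jordan_coords_cases; cases Z rule: jordan_coords_cases)
    (simp add: jmk_add jcross_jmk jmk_eq_iff quat_eq_iff quat_sel_mult qin_def;
      intro conjI; simp add: field_simps)

lemma jcross_scale_left: "jcross (k *\<^sub>J X) Y = k *\<^sub>J jcross X Y" for X Y :: jC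
  by (cases X rule: jordan_coords_cases; cases Y rule: jordan_coords_cases)
    (simp add: jmk_scale jcross_jmk jmk_eq_iff quat_eq_iff quat_sel_mult qin_def;
      intro conjI; simp add: field_simps)

lemma jcross_scale_right: "jcross X (k *\<^sub>J Y) = k *\<^sub>J jcross X Y" for X Y :: jC
  by (metis jcross_commute jcross_scale_left)

lemma jcross_0 [simp]: "jcross 0 X = 0" "jcross X 0 = 0" for X :: jC
  by (metis jcross_scale_left jcross_scale_right jscale_0)+

lemma jcross_gamma: "jgamma (jcross X Y) = jcross (jgamma X) (jgamma Y)" for X Y :: jC
  by (cases X rule: jordan_coords_cases; cases Y rule: jordan_coords_cases)
    (simp add: jmk_gamma jcross_jmk jmk_eq_iff quat_eq_iff quat_sel_mult qin_def algebra_simps)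

definition qtri :: "'a::comm_ring_1 quat \<Rightarrow> 'a quat \<Rightarrow> 'a quat \<Rightarrow> 'a"
  where "qtri x y z = q0 (x * y * z)"

lemma qtri_cycle: "qtri x y z = qtri y z x" "qtri x y z = qtri z x y"
  by (simp_all add: qtri_def quat_sel_mult algebra_simps)

lemma qin_qtri:
  "qin (n * qcnj p) t = qtri (qcnj n) t p" "qin (r * m) t = qtri (qcnj t) r m"
  "qin (qcnj (x * y)) z = qtri x y z"
  by (simp_all add: qtri_def qin_def quat_sel_mult algebra_simps)

lemma qin_linear:
  "qin (x + y) z = qin x z + qin y z" "qin (x - y) z = qin x z - qin y z"
  "qin (- x) z = - qin x z" "qin (qscale k x) z = k * qin x z"
  by (simp_all add: qin_def algebra_simps)

lemma qin_commute: "qin x y = qin y x"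
  by (simp add: qin_def algebra_simps)

lemma qin_0 [simp]: "qin x 0 = 0" "qin 0 x = 0"
  by (simp_all add: qin_def)

text \<open>The rules for \<^const>\<open>qin\<close> write both sides in terms of the cyclic trilinear form \<^const>\<open>qtri\<close>,
  which avoids an expansion into the 81 coordinates.\<close>

lemma jinner_jcross: "jinner (jcross X Y) Z = jinner X (jcross Y Z)" for X Y Z :: jC
proof -
  have "jinner (jcross X Y) Z = jinner (jcross Y Z) X"
    apply (cases X rule: jordan_coords_cases; cases Y rule: jordan_coords_cases; cases Z rule: jordan_coords_cases)
    apply (simp only: jcross_jmk jinner_jmk qin_linear qcnj_add qcnj_diff)
    apply (simp only: qin_qtri(1))
    apply (simp only: qin_qtri(2-3))
    apply (simp add: qin_commute qtri_cycle field_simps)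
    done
  then show ?thesis
    by (simp add: jinner_commute)
qed

lemma jinner_nondegenerate:
  fixes X :: jC
  assumes "\<And>Y. jinner X Y = 0"
  shows "X = 0"
proof (cases X rule: jordan_coords_cases)
  case (1 a b c m1 m2 m3 n1 n2 n3)
  note h = assms[unfolded 1]
  have "x = 0" if "\<And>y. qin x y = 0" for x :: "complex quat"
    using that[of "Quat 1 0 0 0"] that[of "Quat 0 1 0 0"] that[of "Quat 0 0 1 0"] that[of "Quat 0 0 0 1"]
    by (simp add: qin_def quat_eq_iff)
  moreover have "qin m1 y = 0" "qin m2 y = 0" "qin m3 y = 0" "qin n1 y = 0" "qin n2 y = 0" "qin n3 y = 0" for y
    using h[of "jmk 0 0 0 y 0 0 0 0 0"] h[of "jmk 0 0 0 0 y 0 0 0 0"] h[of "jmk 0 0 0 0 0 y 0 0 0"]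
      h[of "jmk 0 0 0 0 0 0 y 0 0"] h[of "jmk 0 0 0 0 0 0 0 y 0"] h[of "jmk 0 0 0 0 0 0 0 0 y"]
    by (simp_all add: jinner_jmk)
  moreover have "a = 0" "b = 0" "c = 0"
    using h[of "jmk 1 0 0 0 0 0 0 0 0"] h[of "jmk 0 1 0 0 0 0 0 0 0"] h[of "jmk 0 0 1 0 0 0 0 0 0"]
    by (simp_all add: jinner_jmk qin_def)
  ultimately show ?thesis
    by (auto simp: 1 jmk_zero jmk_eq_iff)
qed

lemma jinner_cancel:
  fixes X Y :: jC
  assumes "\<And>Z. jinner X Z = jinner Y Z"
  shows "X = Y"
  using jinner_nondegenerate[of "X - Y"] assms by (simp add: jinner_diff)

text \<open>Nondegeneracy makes the description in \<open>jtransp\<close> unique, so exhibiting one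
  adjoint identifies the transpose.\<close>

lemma jtransp_eqI:
  assumes "\<And>X Y. jinner (\<phi> X) Y = jinner X (\<psi> Y)"
  shows "jtransp \<phi> = \<psi>"
  unfolding jtransp_def
proof (rule the_equality)
  show "\<forall>X Y. jinner (\<phi> X) Y = jinner X (\<psi> Y)"
    using assms by blast
next
  fix \<theta> assume "\<forall>X Y. jinner (\<phi> X) Y = jinner X (\<theta> Y)"
  then have "jinner X (\<theta> Y) = jinner X (\<psi> Y)" for X Y
    using assms by metis
  then show "\<theta> = \<psi>"
    by (metis jinner_cancel jinner_commute ext)
qed

text \<open>\<open>jcross\<close> with a fixed element is self-adjoint for the trace form, so taking
  the adjoint reverses the composition of W and X, and the three terms of \<open>jvee X W\<close>
  become those of \<open>jvee W X\<close>.\<close>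

lemma jinner_jvee: "jinner (jvee X W U) V = jinner U (jvee W X V)"
proof -
  have "jinner (jcross W (jcross X U)) V = jinner U (jcross X (jcross W V))"
    by (metis jcross_commute jinner_jcross)
  then show ?thesis
    by (simp add: jvee_def jinner_add_left jinner_add_right jinner_diff jinner_scale_left
        jinner_scale_right jinner_commute algebra_simps)
qed

lemma jtransp_jvee:
  "jtransp (\<lambda>U. (- 1/2) *\<^sub>J (jvee X W U + jvee Z Y U)) =
     (\<lambda>V. (- 1/2) *\<^sub>J (jvee W X V + jvee Y Z V))"
  by (rule jtransp_eqI)
    (simp add: jinner_add_left jinner_add_right jinner_scale_left jinner_scale_right jinner_jvee)

text \<open>The description operator inside \<open>jtransp\<close> is eliminated here; later
  computations with the product start from this explicit form.\<close>

lemma pcross_apply: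
  "pcross (X, Y, \<xi>, \<eta>) (Z, W, \<zeta>, \<omega>) (U, V, u, v) =
    (let A = (- 1/4) *\<^sub>J (2 *\<^sub>J jcross Y W - \<xi> *\<^sub>J Z - \<zeta> *\<^sub>J X);
         B = (1/4) *\<^sub>J (2 *\<^sub>J jcross X Z - \<eta> *\<^sub>J W - \<omega> *\<^sub>J Y);
         \<nu> = 1/8 * (jinner X W + jinner Z Y - 3 * (\<xi> * \<omega> + \<zeta> * \<eta>))
     in ((- 1/2) *\<^sub>J (jvee X W U + jvee Z Y U) - (1/3 * \<nu>) *\<^sub>J U + 2 *\<^sub>J jcross B V + v *\<^sub>J A,
         2 *\<^sub>J jcross A U - (- 1/2) *\<^sub>J (jvee W X V + jvee Y Z V) + (1/3 * \<nu>) *\<^sub>J V + u *\<^sub>J B,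
         jinner A V + \<nu> * u,
         jinner B U - \<nu> * v))"
  unfolding pcross_def pPhi_def prod.case jtransp_jvee Let_def by (rule refl)

lemma jvee_0 [simp]: "jvee 0 W U = 0" "jvee X 0 U = 0" "jvee X W 0 = 0"
  by (simp_all add: jvee_def)

text \<open>This excludes that an element of \<open>E\<^sub>7\<close> maps \<open>(0, 0, 1, 0)\<close> to some \<open>(X, 0, 0, 0)\<close>.\<close>

lemma jcross_rank_one_vanishes:
  fixes X :: jC
  assumes h: "\<And>Z W. \<exists>k. jcross W (jcross X Z) - (1/4 * jinner X W) *\<^sub>J Z = k *\<^sub>J X"
  shows "X = 0"
proof (cases X rule: jordan_coords_cases)
  case (1 a b c m1 m2 m3 n1 n2 n3)
  let ?E1 = "jmk 1 0 0 0 0 0 0 0 0" and ?E2 = "jmk 0 1 0 0 0 0 0 0 0" and ?E3 = "jmk 0 0 1 0 0 0 0 0 0"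
  let ?F1 = "jmk 0 0 0 1 0 0 0 0 0" and ?F2 = "jmk 0 0 0 0 1 0 0 0 0" and ?F3 = "jmk 0 0 0 0 0 1 0 0 0"
  note S = jcross_jmk jinner_jmk jmk_scale jmk_diff jmat_jmk
  note h' = h[unfolded 1]
  \<comment> \<open>With W = E1 the double product has no entry at (3,1) or (1,2). There F2 and F3
    contribute only -a/4 at their own positions, and both results cannot be multiples of the same X
    unless a = 0.\<close>
  have a: "a = 0"
  proof -
    obtain k where k: "jcross ?E1 (jcross (jmk a b c m1 m2 m3 n1 n2 n3) ?F2) -
        (1/4 * jinner (jmk a b c m1 m2 m3 n1 n2 n3) ?E1) *\<^sub>J ?F2 = k *\<^sub>J jmk a b c m1 m2 m3 n1 n2 n3"
      using h' by blast
    obtain l where l: "jcross ?E1 (jcross (jmk a b c m1 m2 m3 n1 n2 n3) ?F3) -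
        (1/4 * jinner (jmk a b c m1 m2 m3 n1 n2 n3) ?E1) *\<^sub>J ?F3 = l *\<^sub>J jmk a b c m1 m2 m3 n1 n2 n3"
      using h' by blast
    have "- (1/4 * a) = k * q0 m2"
      using arg_cong[OF k, of "\<lambda>Y. q0 (cfst (jmat Y $ 3 $ 1))"] by (simp add: S)
    moreover have "0 = k * q0 m3"
      using arg_cong[OF k, of "\<lambda>Y. q0 (cfst (jmat Y $ 1 $ 2))"] by (simp add: S)
    moreover have "- (1/4 * a) = l * q0 m3"
      using arg_cong[OF l, of "\<lambda>Y. q0 (cfst (jmat Y $ 1 $ 2))"] by (simp add: S)
    ultimately show ?thesis
      by auto
  qed
  have b: "b = 0"
  proof -
    obtain k where k: "jcross ?E2 (jcross (jmk a b c m1 m2 m3 n1 n2 n3) ?F3) -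
        (1/4 * jinner (jmk a b c m1 m2 m3 n1 n2 n3) ?E2) *\<^sub>J ?F3 = k *\<^sub>J jmk a b c m1 m2 m3 n1 n2 n3"
      using h' by blast
    obtain l where l: "jcross ?E2 (jcross (jmk a b c m1 m2 m3 n1 n2 n3) ?F1) -
        (1/4 * jinner (jmk a b c m1 m2 m3 n1 n2 n3) ?E2) *\<^sub>J ?F1 = l *\<^sub>J jmk a b c m1 m2 m3 n1 n2 n3"
      using h' by blast
    have "- (1/4 * b) = k * q0 m3"
      using arg_cong[OF k, of "\<lambda>Y. q0 (cfst (jmat Y $ 1 $ 2))"] by (simp add: S)
    moreover have "0 = k * q0 m1"
      using arg_cong[OF k, of "\<lambda>Y. q0 (cfst (jmat Y $ 2 $ 3))"] by (simp add: S)
    moreover have "- (1/4 * b) = l * q0 m1"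
      using arg_cong[OF l, of "\<lambda>Y. q0 (cfst (jmat Y $ 2 $ 3))"] by (simp add: S)
    ultimately show ?thesis
      by auto
  qed
  have c: "c = 0"
  proof -
    obtain k where k: "jcross ?E3 (jcross (jmk a b c m1 m2 m3 n1 n2 n3) ?F1) -
        (1/4 * jinner (jmk a b c m1 m2 m3 n1 n2 n3) ?E3) *\<^sub>J ?F1 = k *\<^sub>J jmk a b c m1 m2 m3 n1 n2 n3"
      using h' by blast
    obtain l where l: "jcross ?E3 (jcross (jmk a b c m1 m2 m3 n1 n2 n3) ?F2) -
        (1/4 * jinner (jmk a b c m1 m2 m3 n1 n2 n3) ?E3) *\<^sub>J ?F2 = l *\<^sub>J jmk a b c m1 m2 m3 n1 n2 n3"
      using h' by blast
    have "- (1/4 * c) = k * q0 m1"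
      using arg_cong[OF k, of "\<lambda>Y. q0 (cfst (jmat Y $ 2 $ 3))"] by (simp add: S)
    moreover have "0 = k * q0 m2"
      using arg_cong[OF k, of "\<lambda>Y. q0 (cfst (jmat Y $ 3 $ 1))"] by (simp add: S)
    moreover have "- (1/4 * c) = l * q0 m2"
      using arg_cong[OF l, of "\<lambda>Y. q0 (cfst (jmat Y $ 3 $ 1))"] by (simp add: S)
    ultimately show ?thesis
      by auto
  qed
  show ?thesis
  proof (rule ccontr)
    assume "X \<noteq> 0"
    then consider "\<not> (m1 = 0 \<and> n1 = 0)" | "\<not> (m2 = 0 \<and> n2 = 0)" | "\<not> (m3 = 0 \<and> n3 = 0)"
      by (auto simp: 1 a b c jmk_zero)
    then show False
    proof cases
      case nz: 1
      \<comment> \<open>W = Z = E1 isolates the (2,3) entry, with factor 1/4. If it is nonzero, then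
        k is nonzero and the (1,2) entry of X must vanish.\<close>
      obtain k where k: "jcross ?E1 (jcross (jmk a b c m1 m2 m3 n1 n2 n3) ?E1) -
          (1/4 * jinner (jmk a b c m1 m2 m3 n1 n2 n3) ?E1) *\<^sub>J ?E1 = k *\<^sub>J jmk a b c m1 m2 m3 n1 n2 n3"
        using h' by blast
      have k1: "qscale (1/4) m1 = qscale k m1"
        using arg_cong[OF k, of "\<lambda>Y. cfst (jmat Y $ 2 $ 3)"] by (simp add: S a b c quat_eq_iff)
      have k2: "qscale (1/4) n1 = qscale k n1"
        using arg_cong[OF k, of "\<lambda>Y. csnd (jmat Y $ 2 $ 3)"] by (simp add: S a b c quat_eq_iff)
      have "k \<noteq> 0"
      proof
        assume "k = 0"
        with k1 k2 have "m1 = 0 \<and> n1 = 0"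
          by (simp add: quat_eq_iff)
        with nz show False by simp
      qed
      then have m3: "m3 = 0" and n3: "n3 = 0"
        using arg_cong[OF k, of "\<lambda>Y. cfst (jmat Y $ 1 $ 2)"] arg_cong[OF k, of "\<lambda>Y. csnd (jmat Y $ 1 $ 2)"]
        by (simp_all add: S quat_eq_iff)
      \<comment> \<open>This choice moves the (2,3) entry, up to conjugation and a factor, to
        position (1,2), where X is already known to be 0.\<close>
      obtain l where l: "jcross ?E3 (jcross (jmk a b c m1 m2 m3 n1 n2 n3) ?F2) -
          (1/4 * jinner (jmk a b c m1 m2 m3 n1 n2 n3) ?E3) *\<^sub>J ?F2 = l *\<^sub>J jmk a b c m1 m2 m3 n1 n2 n3"
        using h' by blast
      have "m1 = 0" "n1 = 0"
        using arg_cong[OF l, of "\<lambda>Y. cfst (jmat Y $ 1 $ 2)"] arg_cong[OF l, of "\<lambda>Y. csnd (jmat Y $ 1 $ 2)"]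
        by (simp_all add: S m3 n3 a b c quat_eq_iff)
      with nz show False
        by simp
    next
      case nz: 2
      obtain k where k: "jcross ?E2 (jcross (jmk a b c m1 m2 m3 n1 n2 n3) ?E2) -
          (1/4 * jinner (jmk a b c m1 m2 m3 n1 n2 n3) ?E2) *\<^sub>J ?E2 = k *\<^sub>J jmk a b c m1 m2 m3 n1 n2 n3"
        using h' by blast
      have k1: "qscale (1/4) m2 = qscale k m2"
        using arg_cong[OF k, of "\<lambda>Y. cfst (jmat Y $ 3 $ 1)"] by (simp add: S a b c quat_eq_iff)
      have k2: "qscale (1/4) n2 = qscale k n2"
        using arg_cong[OF k, of "\<lambda>Y. csnd (jmat Y $ 3 $ 1)"] by (simp add: S a b c quat_eq_iff)
      have "k \<noteq> 0"
      proof
        assume "k = 0"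
        with k1 k2 have "m2 = 0 \<and> n2 = 0"
          by (simp add: quat_eq_iff)
        with nz show False by simp
      qed
      then have m1: "m1 = 0" and n1: "n1 = 0"
        using arg_cong[OF k, of "\<lambda>Y. cfst (jmat Y $ 2 $ 3)"] arg_cong[OF k, of "\<lambda>Y. csnd (jmat Y $ 2 $ 3)"]
        by (simp_all add: S quat_eq_iff)
      obtain l where l: "jcross ?E1 (jcross (jmk a b c m1 m2 m3 n1 n2 n3) ?F3) -
          (1/4 * jinner (jmk a b c m1 m2 m3 n1 n2 n3) ?E1) *\<^sub>J ?F3 = l *\<^sub>J jmk a b c m1 m2 m3 n1 n2 n3"
        using h' by blast
      have "m2 = 0" "n2 = 0"
        using arg_cong[OF l, of "\<lambda>Y. cfst (jmat Y $ 2 $ 3)"] arg_cong[OF l, of "\<lambda>Y. csnd (jmat Y $ 2 $ 3)"]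
        by (simp_all add: S m1 n1 a b c quat_eq_iff)
      with nz show False
        by simp
    next
      case nz: 3
      obtain k where k: "jcross ?E3 (jcross (jmk a b c m1 m2 m3 n1 n2 n3) ?E3) -
          (1/4 * jinner (jmk a b c m1 m2 m3 n1 n2 n3) ?E3) *\<^sub>J ?E3 = k *\<^sub>J jmk a b c m1 m2 m3 n1 n2 n3"
        using h' by blast
      have k1: "qscale (1/4) m3 = qscale k m3"
        using arg_cong[OF k, of "\<lambda>Y. cfst (jmat Y $ 1 $ 2)"] by (simp add: S a b c quat_eq_iff)
      have k2: "qscale (1/4) n3 = qscale k n3"
        using arg_cong[OF k, of "\<lambda>Y. csnd (jmat Y $ 1 $ 2)"] by (simp add: S a b c quat_eq_iff)
      have "k \<noteq> 0"
      proof
        assume "k = 0"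
        with k1 k2 have "m3 = 0 \<and> n3 = 0"
          by (simp add: quat_eq_iff)
        with nz show False by simp
      qed
      then have m2: "m2 = 0" and n2: "n2 = 0"
        using arg_cong[OF k, of "\<lambda>Y. cfst (jmat Y $ 3 $ 1)"] arg_cong[OF k, of "\<lambda>Y. csnd (jmat Y $ 3 $ 1)"]
        by (simp_all add: S quat_eq_iff)
      obtain l where l: "jcross ?E2 (jcross (jmk a b c m1 m2 m3 n1 n2 n3) ?F1) -
          (1/4 * jinner (jmk a b c m1 m2 m3 n1 n2 n3) ?E2) *\<^sub>J ?F1 = l *\<^sub>J jmk a b c m1 m2 m3 n1 n2 n3"
        using h' by blast
      have "m3 = 0" "n3 = 0"
        using arg_cong[OF l, of "\<lambda>Y. cfst (jmat Y $ 3 $ 1)"] arg_cong[OF l, of "\<lambda>Y. csnd (jmat Y $ 3 $ 1)"]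
        by (simp_all add: S m2 n2 a b c quat_eq_iff)
      with nz show False
        by simp
    qed
  qed
qed

subsection \<open>The maps commuting with \<open>\<lambda>\<gamma>\<close> and \<open>\<iota>\<close>\<close>

definition twisted_auto :: "(jC \<Rightarrow> jC) set"
  where "twisted_auto = {b. (\<forall>X Y. b (X + Y) = b X + b Y) \<and> (\<forall>k X. b (k *\<^sub>J X) = k *\<^sub>J b X) \<and> bij b \<and>
    (\<forall>X Y. jgamma (b (jgamma (jcross X Y))) = jcross (b X) (b Y)) \<and>
    (\<forall>X Y. jinner (jgamma (b (jgamma X))) (b Y) = jinner X Y) \<and>
    (\<forall>X. b (jtau (jgamma X)) = jtau (jgamma (b X)))}"

definition pact :: "(jC \<Rightarrow> jC) \<Rightarrow> pC \<Rightarrow> pC"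
  where "pact b = (\<lambda>(X, Y, \<xi>, \<eta>). (b X, jgamma (b (jgamma Y)), \<xi>, \<eta>))"

definition psig :: "pC \<Rightarrow> pC"
  where "psig = (\<lambda>(X, Y, \<xi>, \<eta>). (jgamma Y, - jgamma X, \<eta>, - \<xi>))"

lemma psig_eq: "plambda \<circ> pgamma = psig"
  by (auto simp: fun_eq_iff plambda_def pgamma_def psig_def)

text \<open>\<open>psig\<close> squares to -1, so its inverse is its negative; the same holds for
  \<open>piota\<close>.\<close>

lemma bij_psig: "bij psig"
  by (rule o_bij[of "\<lambda>P. - psig P"]) (auto simp: fun_eq_iff psig_def jgamma_minus)

lemma bij_piota: "bij piota"
  by (rule o_bij[of "\<lambda>P. - piota P"])
    (auto simp: fun_eq_iff piota_def jscale_minus jscale_minus_left)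

lemma conj_eq_iff_commute:
  assumes "bij \<sigma>"
  shows "\<sigma> \<circ> \<alpha> \<circ> inv_into UNIV \<sigma> = \<alpha> \<longleftrightarrow> \<sigma> \<circ> \<alpha> = \<alpha> \<circ> \<sigma>"
  using assms by (metis bij_is_inj bij_is_surj comp_assoc comp_id inv_o_cancel surj_iff)

lemma comp_surj_cancel: "surj g \<Longrightarrow> f \<circ> g = h \<circ> g \<longleftrightarrow> f = h"
  unfolding fun_eq_iff comp_def by (metis surjD)

text \<open>A map commuting with \<open>psig\<close> lets \<open>psig\<close> be moved to the right
  and cancelled there by surjectivity; what remains of commuting with the composite is commuting
  with \<open>piota\<close>.\<close>

lemma E7_fix_inter_iff:
  "\<alpha> \<in> E7_fix (plambda \<circ> pgamma) \<inter> E7_fix (piota \<circ> plambda \<circ> pgamma) \<longleftrightarrow>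
     \<alpha> \<in> E7 \<and> psig \<circ> \<alpha> = \<alpha> \<circ> psig \<and> piota \<circ> \<alpha> = \<alpha> \<circ> piota"
proof -
  have b: "bij (piota \<circ> psig)"
    using bij_psig bij_piota by (rule bij_comp)
  have "piota \<circ> psig \<circ> \<alpha> = \<alpha> \<circ> (piota \<circ> psig) \<longleftrightarrow> piota \<circ> \<alpha> = \<alpha> \<circ> piota"
    if "psig \<circ> \<alpha> = \<alpha> \<circ> psig"
  proof -
    have "piota \<circ> psig \<circ> \<alpha> = (piota \<circ> \<alpha>) \<circ> psig"
      using that by (simp add: comp_assoc)
    then have "piota \<circ> psig \<circ> \<alpha> = \<alpha> \<circ> (piota \<circ> psig) \<longleftrightarrow> (piota \<circ> \<alpha>) \<circ> psig = (\<alpha> \<circ> piota) \<circ> psig"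
      by (simp only: comp_assoc)
    then show ?thesis
      by (simp only: comp_surj_cancel[OF bij_is_surj[OF bij_psig]])
  qed
  then show ?thesis
    unfolding E7_fix_def comp_assoc psig_eq
    using conj_eq_iff_commute[OF bij_psig, of \<alpha>] conj_eq_iff_commute[OF b, of \<alpha>]
    by (auto simp: comp_assoc)
qed

text \<open>Evaluating the conjugated map at \<alpha> R, which by surjectivity covers every
  argument, removes the inverse.\<close>

lemma E7_iff:
  "\<alpha> \<in> E7 \<longleftrightarrow> (\<forall>P Q. \<alpha> (P + Q) = \<alpha> P + \<alpha> Q) \<and> (\<forall>k P. \<alpha> (pscale k P) = pscale k (\<alpha> P)) \<and> bij \<alpha> \<and>
    (\<forall>P Q R. \<alpha> (pcross P Q R) = pcross (\<alpha> P) (\<alpha> Q) (\<alpha> R)) \<and> (\<forall>P Q. pherm (\<alpha> P) (\<alpha> Q) = pherm P Q)"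
proof -
  have 1: "Vector_Spaces.linear pscale pscale \<alpha> \<longleftrightarrow>
      (\<forall>P Q. \<alpha> (P + Q) = \<alpha> P + \<alpha> Q) \<and> (\<forall>k P. \<alpha> (pscale k P) = pscale k (\<alpha> P))"
    using vector_space_pscale by (simp add: Vector_Spaces.linear_iff)
  have 2: "\<alpha> \<circ> pcross P Q \<circ> inv_into UNIV \<alpha> = pcross (\<alpha> P) (\<alpha> Q) \<longleftrightarrow>
      (\<forall>R. \<alpha> (pcross P Q R) = pcross (\<alpha> P) (\<alpha> Q) (\<alpha> R))" if "bij \<alpha>" for P Q
  proof -
    have "inv_into UNIV \<alpha> (\<alpha> R) = R" for R
      using that by (simp add: bij_is_inj)
    moreover have "(\<forall>S. \<alpha> (pcross P Q (inv_into UNIV \<alpha> S)) = pcross (\<alpha> P) (\<alpha> Q) S) \<longleftrightarrow>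
        (\<forall>R. \<alpha> (pcross P Q (inv_into UNIV \<alpha> (\<alpha> R))) = pcross (\<alpha> P) (\<alpha> Q) (\<alpha> R))"
      using bij_is_surj[OF that] by (metis surjD)
    ultimately show ?thesis
      by (simp add: fun_eq_iff)
  qed
  show ?thesis
    unfolding E7_def using 1 2 by auto
qed

lemma pscale_add: "pscale k (P + Q) = pscale k P + pscale k Q"
  and pscale_pscale [simp]: "pscale k (pscale l P) = pscale (k * l) P"
  and pscale_1 [simp]: "pscale 1 P = P"
  and pscale_minus_1: "pscale (- 1) P = - P"
  by (cases P; cases Q; simp add: pscale_def jscale_add jscale_diff jscale_minus_left algebra_simps)+

lemma jvee_scale:
  assumes "k * k = 1"
  shows "jvee (k *\<^sub>J X) (k *\<^sub>J W) U = jvee X W U"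
proof -
  have k: "k * (k * x) = x" for x
    using assms by (simp flip: mult.assoc)
  show ?thesis
    by (simp add: k assms jvee_def jinner_scale_left jinner_scale_right jcross_scale_left jcross_scale_right
      mult.commute mult.left_commute)
qed

lemma jvee_scale_right: "jvee X W (k *\<^sub>J U) = k *\<^sub>J jvee X W U"
  by (simp add: jvee_def jinner_scale_right jcross_scale_right jscale_add jscale_diff mult.commute mult.left_commute)

lemma jtau_minus: "jtau (- X) = - jtau X"
  by (cases X rule: jordan_coords_cases; simp add: jmk_minus jmk_tau jmk_eq_iff quat_eq_iff)

text \<open>The product is bilinear in P and Q, so k enters as k^2 = 1. This makes a central sign
  compatible with the product condition.\<close>

lemma pcross_pscale:
  assumes "k * k = 1"
  shows "pcross (pscale k P) (pscale k Q) (pscale l R) = pscale l (pcross P Q R)"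
proof -
  have k: "k * (k * x) = x" for x
    using assms by (simp flip: mult.assoc)
  show ?thesis
    by (cases P; cases Q; cases R)
      (simp add: pscale_def pcross_apply Let_def jvee_scale[OF assms] jvee_scale_right
        jinner_scale_left jinner_scale_right jcross_scale_left jcross_scale_right
        jscale_add jscale_diff jscale_minus_left assms k algebra_simps)
qed

lemma pscale_in_fix:
  assumes "k = 1 \<or> k = - 1" "\<alpha> \<in> E7" "psig \<circ> \<alpha> = \<alpha> \<circ> psig" "piota \<circ> \<alpha> = \<alpha> \<circ> piota"
  shows "pscale k \<circ> \<alpha> \<in> E7" "psig \<circ> (pscale k \<circ> \<alpha>) = (pscale k \<circ> \<alpha>) \<circ> psig"
    "piota \<circ> (pscale k \<circ> \<alpha>) = (pscale k \<circ> \<alpha>) \<circ> piota"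
proof -
  have k: "k * k = 1" "cnj k * k = 1" using assms(1) by auto
  have b: "bij (pscale k)"
    by (rule o_bij[of "pscale k"]) (auto simp: fun_eq_iff k)
  have h: "pherm (pscale k P) (pscale k Q) = pherm P Q" for P Q
    using assms(1) by (cases P; cases Q) (auto simp: pscale_def pherm_def jherm_def jinner_minus jscale_minus_left jtau_minus)
  show "pscale k \<circ> \<alpha> \<in> E7"
    using assms(2) b k h unfolding E7_iff
    by (auto simp: pscale_add bij_comp pcross_pscale mult.commute)
  have s: "psig (pscale k P) = pscale k (psig P)" "piota (pscale k P) = pscale k (piota P)" for P
    by (cases P; simp add: psig_def piota_def pscale_def jgamma_scale jscale_minus mult_ac)+
  show "psig \<circ> (pscale k \<circ> \<alpha>) = (pscale k \<circ> \<alpha>) \<circ> psig"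
    "piota \<circ> (pscale k \<circ> \<alpha>) = (pscale k \<circ> \<alpha>) \<circ> piota"
    using assms(3,4) s by (auto simp: fun_eq_iff)
qed

text \<open>X transforms by b and W by the contragredient b'. Pairings between the two are
  invariant, and the double product passes from b through b' back to b.\<close>

lemma jvee_equivariant:
  assumes add: "\<And>X Y. b (X + Y) = b X + b Y" and sc: "\<And>k X. b (k *\<^sub>J X) = k *\<^sub>J b X"
    and c1: "\<And>X Y. b' (jcross X Y) = jcross (b X) (b Y)"
    and c2: "\<And>X Y. b (jcross X Y) = jcross (b' X) (b' Y)"
    and i: "\<And>X Y. jinner (b' X) (b Y) = jinner X Y"
  shows "b (jvee X W U) = jvee (b X) (b' W) (b U)"
proof -
  have m: "b (X - Y) = b X - b Y" for X Y
    using add[of "X - Y" Y] by (simp add: algebra_simps)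
  show ?thesis
    using i[of W X] i[of W U] by (simp add: jvee_def add m sc c1 c2 jinner_commute)
qed

lemma pact_in_E7:
  assumes "b \<in> twisted_auto"
  shows "pact b \<in> E7" "psig \<circ> pact b = pact b \<circ> psig" "piota \<circ> pact b = pact b \<circ> piota"
proof -
  define b' where "b' = (\<lambda>X. jgamma (b (jgamma X)))"
  have add: "b (X + Y) = b X + b Y" "b' (X + Y) = b' X + b' Y"
    and sc: "b (k *\<^sub>J X) = k *\<^sub>J b X" "b' (k *\<^sub>J X) = k *\<^sub>J b' X" and bij: "bij b"
    and c1: "b' (jcross X Y) = jcross (b X) (b Y)"
    and i: "jinner (b' X) (b Y) = jinner X Y" and t: "b (jtau (jgamma X)) = jtau (jgamma (b X))" for X Y k
    using assms by (auto simp: twisted_auto_def b'_def jgamma_add jgamma_scale)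
  have m: "b (- X) = - b X" "b' (- X) = - b' X" for X
    using sc(1)[of "- 1" X] sc(2)[of "- 1" X] by (simp_all add: jscale_minus_left)
  \<comment> \<open>Applying \<gamma> to both arguments exchanges b and b', so this is the twisted
    form of \<open>c1\<close>.\<close>
  have c2: "b (jcross X Y) = jcross (b' X) (b' Y)" for X Y
    using c1[of "jgamma X" "jgamma Y"] by (simp add: b'_def flip: jcross_gamma) (metis jgamma_gamma)
  have i': "jinner (b X) (b' Y) = jinner X Y" for X Y
    using i by (simp add: jinner_commute)
  have v: "b (jvee X W U) = jvee (b X) (b' W) (b U)" "b' (jvee X W U) = jvee (b' X) (b W) (b' U)" for X W U
    using jvee_equivariant[of b b'] jvee_equivariant[of b' b] add sc c1 c2 i i' by simp_all
  have ic: "jinner (jcross (b' X) (b' Y)) (b' Z) = jinner (jcross X Y) Z"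
    "jinner (jcross (b X) (b Y)) (b Z) = jinner (jcross X Y) Z" for X Y Z
    by (simp_all add: i i' flip: c1 c2)
  have p: "pact b (X, Y, \<xi>, \<eta>) = (b X, b' Y, \<xi>, \<eta>)" for X Y \<xi> \<eta>
    by (simp add: pact_def b'_def)
  have d: "b (X - Y) = b X - b Y" "b' (X - Y) = b' X - b' Y" for X Y
    using add(1)[of "X - Y" Y] add(2)[of "X - Y" Y] by (simp_all add: algebra_simps)
  have "bij (pact b)"
  proof -
    have "pact b \<circ> pact (inv_into UNIV b) = id" "pact (inv_into UNIV b) \<circ> pact b = id"
      using bij by (auto simp: pact_def fun_eq_iff bij_is_surj surj_f_inv_f bij_is_inj)
    then show ?thesis
      by (metis o_bij)
  qed
  moreover have "pact b (P + Q) = pact b P + pact b Q" for P Q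
    by (cases P; cases Q) (simp add: p add)
  moreover have "pact b (pscale k P) = pscale k (pact b P)" for k P
    by (cases P) (simp add: p sc pscale_def)
  moreover have "pact b (pcross P Q R) = pcross (pact b P) (pact b Q) (pact b R)" for P Q R
    by (cases P; cases Q; cases R) (simp add: p pcross_apply Let_def v add sc d m c1 c2 ic jinner_diff jinner_minus jinner_scale_left i i')
  \<comment> \<open>Commuting with \<tau>\<gamma> means that \<tau> exchanges b and b', so
    invariance of the Hermitian form reduces to that of the bilinear pairing.\<close>
  moreover have "jinner (jtau (b X)) (b Y) = jinner (jtau X) Y" "jinner (jtau (b' X)) (b' Y) = jinner (jtau X) Y" for X Y
  proof -
    have "jtau (b X) = b' (jtau X)" "jtau (b' X) = b (jtau X)" for X
      using t[of X] t[of "jgamma X"] by (simp_all add: b'_def jtau_gamma)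
    then show "jinner (jtau (b X)) (b Y) = jinner (jtau X) Y" "jinner (jtau (b' X)) (b' Y) = jinner (jtau X) Y"
      by (simp_all add: i i')
  qed
  then have "pherm (pact b P) (pact b Q) = pherm P Q" for P Q
    by (cases P; cases Q) (simp add: p pherm_def jherm_def)
  ultimately show "pact b \<in> E7"
    by (simp add: E7_iff)
  show "psig \<circ> pact b = pact b \<circ> psig" "piota \<circ> pact b = pact b \<circ> piota"
    using m by (auto simp: psig_def piota_def fun_eq_iff p sc) (simp_all add: b'_def jgamma_minus)
qed

section \<open>Products on the eigenspaces of \<iota> and the shape of a fixed element\<close>

lemma pcross_minus_plus:
  "pcross (X, 0, \<xi>, 0) (0, W, 0, \<omega>) (U, 0, u, 0) =
    ((- 1/2) *\<^sub>J jvee X W U - (1/24 * (jinner X W - 3 * (\<xi> * \<omega>))) *\<^sub>J U, 0,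
      1/8 * (jinner X W - 3 * (\<xi> * \<omega>)) * u, 0)"
  by (simp add: pcross_apply Let_def)

lemma pcross_minus_minus:
  "pcross (X, 0, \<xi>, 0) (Z, 0, \<zeta>, 0) (U, V, u, v) =
    (jcross (jcross X Z) V + (v / 4) *\<^sub>J (\<xi> *\<^sub>J Z + \<zeta> *\<^sub>J X),
     (1/2) *\<^sub>J jcross (\<xi> *\<^sub>J Z + \<zeta> *\<^sub>J X) U + (u / 2) *\<^sub>J jcross X Z,
     1/4 * jinner (\<xi> *\<^sub>J Z + \<zeta> *\<^sub>J X) V, 1/2 * jinner (jcross X Z) U)"
proof -
  have A: "(- 1/4) *\<^sub>J (2 *\<^sub>J jcross 0 0 - \<xi> *\<^sub>J Z - \<zeta> *\<^sub>J X) = (1/4) *\<^sub>J (\<xi> *\<^sub>J Z + \<zeta> *\<^sub>J X)"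
    by (simp add: jscale_add jscale_diff jscale_minus jscale_minus_left)
  show ?thesis
    unfolding pcross_apply A Let_def
    by (simp add: jcross_scale_left jinner_scale_left)
qed

text \<open>(X x X) x W arises once from \<open>jvee X W X\<close> and once from P x P, and cancels.
  In the first component the coefficient of (X,W) is -1/3 - 1/24 and that of \<xi>\<omega> is 1/8 -
  1/2; both are -3/8.\<close>

lemma pcross_form:
  "pcross (X, 0, \<xi>, 0) (0, W, 0, \<omega>) (X, 0, \<xi>, 0) - pcross (X, 0, \<xi>, 0) (X, 0, \<xi>, 0) (0, W, 0, \<omega>) =
    pscale (- 3/8 * (jinner X W + \<xi> * \<omega>)) (X, 0, \<xi>, 0)"
proof -
  have "jvee X W X = (2/3 * jinner X W) *\<^sub>J X - 2 *\<^sub>J jcross (jcross X X) W"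
    by (simp add: jvee_def jinner_commute[of W] jcross_commute[of W] flip: jscale_add_left)
  then show ?thesis
    unfolding pcross_minus_plus pcross_minus_minus
    by (simp add: pscale_def jinner_add_left jinner_scale_left jscale_diff jscale_add jscale_minus_left
        jscale_add_left[symmetric])
      (simp add: field_simps flip: jscale_add_left jscale_minus_left)
qed

text \<open>A scalar plus a map into the line of (0,0,1,0); in the third component -3/8 splits as
  1/8 - 1/2. The image of (0,0,1,0) under an element of the group must share this shape.\<close>

lemma pcross_fst_unit:
  "pcross (0, 0, 1, 0) (0, W, 0, \<omega>) (U, 0, u, 0) =
    pscale (\<omega> / 8) (U, 0, u, 0) + pscale (- 1/2 * (\<omega> * u)) (0, 0, 1, 0)"
  unfolding pcross_minus_plus by (simp add: pscale_def flip: jscale_minus_left)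

lemma fix_imp_pact:
  assumes E7: "\<alpha> \<in> E7" and sig: "psig \<circ> \<alpha> = \<alpha> \<circ> psig" and iota: "piota \<circ> \<alpha> = \<alpha> \<circ> piota"
  obtains b k where "b \<in> twisted_auto" "k = 1 \<or> k = - 1" "\<alpha> = pscale k \<circ> pact b"
proof -
  have add: "\<alpha> (P + Q) = \<alpha> P + \<alpha> Q" and sc: "\<alpha> (pscale k P) = pscale k (\<alpha> P)" and bij: "bij \<alpha>"
    and cross: "\<alpha> (pcross P Q R) = pcross (\<alpha> P) (\<alpha> Q) (\<alpha> R)"
    and herm: "pherm (\<alpha> P) (\<alpha> Q) = pherm P Q" for P Q R k
    using E7[unfolded E7_iff] by blast+
  have inj: "\<alpha> P = \<alpha> Q \<longleftrightarrow> P = Q" for P Q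
    using bij by (metis bij_is_inj injD)
  have diff: "\<alpha> (P - Q) = \<alpha> P - \<alpha> Q" for P Q
    using add[of "P - Q" Q] by (simp add: algebra_simps)
  have a0: "\<alpha> 0 = 0"
    using diff[of 0 0] by simp
  have iota': "\<alpha> (piota P) = piota (\<alpha> P)" and sig': "\<alpha> (psig P) = psig (\<alpha> P)" for P
    using iota sig by (metis comp_apply)+
  have half: "x = - x \<longleftrightarrow> x = 0" "- x = x \<longleftrightarrow> x = 0" for x :: jC
  proof -
    have "x + x = 2 *\<^sub>J x"
      by (metis jscale_1 jscale_add_left one_add_one)
    then show "x = - x \<longleftrightarrow> x = 0"
      by (metis add.inverse_neutral add.right_inverse jscale_eq_0_iff zero_neq_numeral)
    then show "- x = x \<longleftrightarrow> x = 0"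
      by metis
  qed
  have iJ: "\<i> *\<^sub>J X = \<i> *\<^sub>J Y \<longleftrightarrow> X = Y" for X Y :: jC
    by (metis complex_i_not_zero jscale_1 jscale_jscale left_inverse)
  have minus: "piota P = pscale (- \<i>) P \<longleftrightarrow> fst (snd P) = 0 \<and> snd (snd (snd P)) = 0" for P
    by (cases P) (simp add: piota_def pscale_def jscale_minus_left flip: jscale_minus, simp add: iJ half)
  have plus: "piota P = pscale \<i> P \<longleftrightarrow> fst P = 0 \<and> fst (snd (snd P)) = 0" for P
    by (cases P) (simp add: piota_def pscale_def jscale_minus_left flip: jscale_minus, simp add: iJ half)
  have minus_iff: "(\<exists>X \<xi>. \<alpha> P = (X, 0, \<xi>, 0)) \<longleftrightarrow> (\<exists>X \<xi>. P = (X, 0, \<xi>, 0))" for P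
  proof -
    have "piota (\<alpha> P) = pscale (- \<i>) (\<alpha> P) \<longleftrightarrow> piota P = pscale (- \<i>) P"
      by (metis iota' sc inj)
    then show ?thesis
      by (cases P; cases "\<alpha> P") (auto simp: minus)
  qed
  have plus_iff: "(\<exists>X \<xi>. \<alpha> P = (0, X, 0, \<xi>)) \<longleftrightarrow> (\<exists>X \<xi>. P = (0, X, 0, \<xi>))" for P
  proof -
    have "piota (\<alpha> P) = pscale \<i> (\<alpha> P) \<longleftrightarrow> piota P = pscale \<i> P"
      by (metis iota' sc inj)
    then show ?thesis
      by (cases P; cases "\<alpha> P") (auto simp: plus)
  qed
  define a where "a X \<xi> = fst (\<alpha> (X, 0, \<xi>, 0))" for X \<xi>
  define f where "f X \<xi> = fst (snd (snd (\<alpha> (X, 0, \<xi>, 0))))" for X \<xi>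
  have am: "\<alpha> (X, 0, \<xi>, 0) = (a X \<xi>, 0, f X \<xi>, 0)" for X \<xi>
    using minus_iff[of "(X, 0, \<xi>, 0)"] by (auto simp: a_def f_def)
  \<comment> \<open>A vector of V+ is minus the \<open>psig\<close>-image of one in V-, so \<alpha>
    on V+ is expressed by the same a and f.\<close>
  have ap: "\<alpha> (0, Y, 0, \<eta>) = (0, jgamma (a (jgamma Y) \<eta>), 0, f (jgamma Y) \<eta>)" for Y \<eta>
  proof -
    have "(0, Y, 0, \<eta>) = - psig (jgamma Y, 0, \<eta>, 0)"
      by (simp add: psig_def)
    then have "\<alpha> (0, Y, 0, \<eta>) = - psig (\<alpha> (jgamma Y, 0, \<eta>, 0))"
      using diff[of 0] a0 by (metis diff_0 sig')
    then show ?thesis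
      by (simp add: am psig_def)
  qed
  \<comment> \<open>\<alpha> applied to \<open>pcross_form\<close> yields two multiples of \<alpha>
    P; for nonzero P injectivity equates the coefficients.\<close>
  have form: "jinner (a X \<xi>) (jgamma (a (jgamma W) \<omega>)) + f X \<xi> * f (jgamma W) \<omega> = jinner X W + \<xi> * \<omega>" for X W \<xi> \<omega>
  proof (cases "X = 0 \<and> \<xi> = 0")
    case True
    then show ?thesis
      using am[of 0 0] a0 by (simp add: zero_prod_def)
  next
    case False
    let ?P = "(X, 0, \<xi>, 0)" and ?Q = "(0, W, 0, \<omega>)"
    let ?l = "- 3/8 * (jinner X W + \<xi> * \<omega>)"
    let ?m = "- 3/8 * (jinner (a X \<xi>) (jgamma (a (jgamma W) \<omega>)) + f X \<xi> * f (jgamma W) \<omega>)"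
    have "pscale ?m (\<alpha> ?P) = pcross (\<alpha> ?P) (\<alpha> ?Q) (\<alpha> ?P) - pcross (\<alpha> ?P) (\<alpha> ?P) (\<alpha> ?Q)"
      unfolding am ap by (rule pcross_form[symmetric])
    also have "\<dots> = \<alpha> (pcross ?P ?Q ?P - pcross ?P ?P ?Q)"
      by (simp only: cross diff)
    also have "\<dots> = pscale ?l (\<alpha> ?P)"
      by (simp only: pcross_form sc)
    finally have "\<alpha> (pscale ?m ?P) = \<alpha> (pscale ?l ?P)"
      by (simp only: sc)
    then have "pscale ?m ?P = pscale ?l ?P"
      by (simp only: inj)
    then have 1: "?m *\<^sub>J X = ?l *\<^sub>J X" and 2: "?m * \<xi> = ?l * \<xi>"
      by (simp_all only: pscale_def prod.case prod.inject)
    from 1 have "(?m - ?l) *\<^sub>J X = 0"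
      using jscale_add_left[of "?m - ?l" ?l X] by (simp only: diff_add_cancel) simp
    moreover have "m = l" if "m * \<xi> = l * \<xi>" "(m - l) *\<^sub>J X = 0" for m l
      using that False by (auto simp: jscale_eq_0_iff)
    ultimately have "?m = ?l"
      using 2 by blast
    then show ?thesis
      by (simp only: mult_cancel_left) simp
  qed
  let ?X0 = "a 0 1" and ?k = "f 0 1"
  \<comment> \<open>P x P = 0 for P = (0,0,1,0) carries over to its image (X0,0,k,0), whose square
    applied to (0,0,0,1) has first component k X0 / 2.\<close>
  have X0k: "?k *\<^sub>J ?X0 = 0"
  proof -
    obtain R where R: "\<alpha> R = (0, 0, 0, 1)"
      using bij by (metis bij_is_surj surjD)
    have "pcross (0, 0, 1, 0) (0, 0, 1, 0) R = 0"
      by (cases R) (simp add: pcross_minus_minus zero_prod_def)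
    then have "pcross (?X0, 0, ?k, 0) (?X0, 0, ?k, 0) (0, 0, 0, 1) = 0"
      by (metis a0 am cross R)
    then have "(1/4) *\<^sub>J (?k *\<^sub>J ?X0 + ?k *\<^sub>J ?X0) = 0"
      by (simp add: pcross_minus_minus zero_prod_def)
    then show ?thesis
      by (simp add: jscale_eq_0_iff flip: jscale_add_left)
  qed
  have "?k \<noteq> 0"
  proof
    assume k0: "?k = 0"
    \<comment> \<open>Q and R are pulled back from (0,W,0,0) and (Z,0,0,0). By
      \<open>pcross_fst_unit\<close> the product acts on R as the scalar \<omega>/8 modulo the line
      of X0, and \<open>form\<close> identifies \<omega> as (X0,W). The scalars add up to 1/12 +
      1/24 + 1/8 = 1/4.\<close>
    have "\<exists>l. jcross W (jcross ?X0 Z) - (1/4 * jinner ?X0 W) *\<^sub>J Z = l *\<^sub>J ?X0" for W Z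
    proof -
      obtain Q R where QR: "\<alpha> Q = (0, W, 0, 0)" "\<alpha> R = (Z, 0, 0, 0)"
        using bij by (metis bij_is_surj surjD)
      then obtain W' \<omega> Z' \<zeta> where Q: "Q = (0, W', 0, \<omega>)" and R: "R = (Z', 0, \<zeta>, 0)"
        using minus_iff plus_iff by metis
      have "jgamma (a (jgamma W') \<omega>) = W" "f (jgamma W') \<omega> = 0"
        using QR(1) by (simp_all add: Q ap)
      then have om: "jinner ?X0 W = \<omega>"
        using form[of 0 1 W' \<omega>] k0 by simp
      let ?l = "- 1/2 * (\<omega> * \<zeta>)"
      have "pcross (\<alpha> (0, 0, 1, 0)) (\<alpha> Q) (\<alpha> R) = pscale (\<omega> / 8) (\<alpha> R) + pscale ?l (\<alpha> (0, 0, 1, 0))"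
        unfolding Q R by (simp only: pcross_fst_unit add sc flip: cross)
      then have "pcross (?X0, 0, 0, 0) (0, W, 0, 0) (Z, 0, 0, 0) =
          pscale (\<omega> / 8) (Z, 0, 0, 0) + pscale ?l (?X0, 0, 0, 0)"
        by (simp only: am QR k0)
      then have *: "(- 1/2) *\<^sub>J jvee ?X0 W Z - (1/24 * \<omega>) *\<^sub>J Z = (\<omega> / 8) *\<^sub>J Z + ?l *\<^sub>J ?X0"
        unfolding pcross_minus_plus by (simp add: pscale_def om)
      have "(- 1/2) *\<^sub>J jvee ?X0 W Z =
          jcross W (jcross ?X0 Z) - (1/4 * jinner W Z) *\<^sub>J ?X0 - (1/12 * \<omega>) *\<^sub>J Z"
        by (simp add: jvee_def om jscale_add jscale_diff jscale_minus_left)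
      with * have "jcross W (jcross ?X0 Z) =
         (1/4 * jinner W Z) *\<^sub>J ?X0 + (1/12 * \<omega>) *\<^sub>J Z + (1/24 * \<omega>) *\<^sub>J Z + (\<omega> / 8) *\<^sub>J Z + ?l *\<^sub>J ?X0"
        by (simp add: algebra_simps)
      also have "\<dots> = (1/4 * jinner W Z + ?l) *\<^sub>J ?X0 + (1/12 * \<omega> + 1/24 * \<omega> + \<omega> / 8) *\<^sub>J Z"
        by (simp only: jscale_add_left add_ac)
      also have "1/12 * \<omega> + 1/24 * \<omega> + \<omega> / 8 = 1/4 * jinner ?X0 W"
        by (simp add: om)
      finally show ?thesis
        by (intro exI[of _ "1/4 * jinner W Z + ?l"]) simp
    qed
    then have "?X0 = 0"
      by (rule jcross_rank_one_vanishes)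
    then have "\<alpha> (0, 0, 1, 0) = 0"
      using k0 by (simp add: am zero_prod_def)
    then have "(0, 0, 1, 0) = (0 :: pC)"
      by (metis a0 inj)
    then show False
      by (simp add: zero_prod_def)
  qed
  then have X0: "?X0 = 0"
    using X0k by (simp add: jscale_eq_0_iff)
  have kk: "?k * ?k = 1"
    using form[of 0 1 0 1] by (simp add: X0)
  then have k1: "?k = 1 \<or> ?k = - 1"
    by (metis power2_eq_square power2_eq_1_iff)
  have fX: "f X 0 = 0" for X
    using form[of X 0 0 1] \<open>?k \<noteq> 0\<close> by (simp add: X0)
  \<comment> \<open>Since k = 1/k, the map k \<alpha> fixes (0,0,1,0); b is its restriction to the
    first component.\<close>
  define b where "b X = ?k *\<^sub>J a X 0" for X
  have alpha: "\<alpha> P = pscale ?k (pact b P)" for P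
  proof -
    obtain X Y \<xi> \<eta> where P: "P = (X, Y, \<xi>, \<eta>)" by (cases P)
    have "P = (X, 0, 0, 0) + pscale \<xi> (0, 0, 1, 0) + (0, Y, 0, 0) + pscale \<eta> (0, 0, 0, 1)"
      by (simp add: P pscale_def)
    then have "\<alpha> P = \<alpha> (X, 0, 0, 0) + pscale \<xi> (\<alpha> (0, 0, 1, 0)) + \<alpha> (0, Y, 0, 0) + pscale \<eta> (\<alpha> (0, 0, 0, 1))"
      by (simp only: add sc)
    then show ?thesis
      by (simp add: P am ap X0 fX b_def pact_def pscale_def jgamma_scale kk flip: mult.assoc)
  qed
  then have "\<alpha> = pscale ?k \<circ> pact b"
    by (simp add: fun_eq_iff)
  have pact: "pact b P = pscale ?k (\<alpha> P)" for P
    by (simp add: alpha kk)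
  have pact_cross: "pact b (pcross P Q R) = pcross (pact b P) (pact b Q) (pact b R)" for P Q R
    by (simp add: pact cross pcross_pscale[OF kk])
  have b0: "b 0 = 0"
    using am[of 0 0] a0 by (simp add: b_def zero_prod_def)
  then have bm: "pact b (X, 0, \<xi>, 0) = (b X, 0, \<xi>, 0)" for X \<xi>
    by (simp add: pact_def)
  have b_add: "b (X + Y) = b X + b Y" and b_scale: "b (c *\<^sub>J X) = c *\<^sub>J b X" for X Y c
    using add[of "(X, 0, 0, 0)" "(Y, 0, 0, 0)"] sc[of c "(X, 0, 0, 0)"]
    by (simp_all add: am b_def pscale_def jscale_add mult.commute)
  have b_inj: "X = Y" if "b X = b Y" for X Y
  proof -
    have "\<alpha> (X, 0, 0, 0) = \<alpha> (Y, 0, 0, 0)"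
      using that by (simp add: alpha bm)
    then show ?thesis
      by (simp add: inj)
  qed
  have b_surj: "\<exists>X. b X = Z" for Z
  proof -
    obtain R where R: "\<alpha> R = (?k *\<^sub>J Z, 0, 0, 0)"
      using bij by (metis bij_is_surj surjD)
    then obtain X \<xi> where X: "R = (X, 0, \<xi>, 0)"
      using minus_iff by metis
    have "pact b R = (Z, 0, 0, 0)"
      unfolding pact R by (simp add: pscale_def kk)
    then show ?thesis
      by (auto simp: X bm)
  qed
  \<comment> \<open>For vectors (X,0,0,0) and (Y,0,0,0) the product applied to (0,0,1,0) has the V+
    component X x Y / 2, from which the relation is read off.\<close>
  have b_cross: "jgamma (b (jgamma (jcross X Y))) = jcross (b X) (b Y)" for X Y
  proof -
    have "pact b (pcross (X, 0, 0, 0) (Y, 0, 0, 0) (0, 0, 1, 0)) =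
        pcross (b X, 0, 0, 0) (b Y, 0, 0, 0) (0, 0, 1, 0)"
      by (simp only: pact_cross bm b0)
    then have "jgamma (b (jgamma ((1/2) *\<^sub>J jcross X Y))) = (1/2) *\<^sub>J jcross (b X) (b Y)"
      by (simp add: pcross_minus_minus pact_def)
    then have "(1/2) *\<^sub>J jgamma (b (jgamma (jcross X Y))) = (1/2) *\<^sub>J jcross (b X) (b Y)"
      by (simp add: jgamma_scale b_scale)
    then show ?thesis
      by (metis (no_types) jscale_1 jscale_jscale mult.commute nonzero_divide_eq_eq zero_neq_numeral)
  qed
  have b_inner: "jinner (jgamma (b (jgamma X))) (b Y) = jinner X Y" for X Y
  proof -
    have "jinner (a Y 0) (jgamma (a (jgamma X) 0)) = jinner Y X"
      using form[of Y 0 X 0] by (simp add: fX)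
    then show ?thesis
      by (simp add: b_def jgamma_scale jinner_scale_left jinner_scale_right jinner_commute[of Y]
          jinner_commute[of _ "a Y 0"] kk flip: mult.assoc)
  qed
  \<comment> \<open>\<tau> b X and \<gamma> b \<gamma> \<tau> X pair equally with every b Z, the
    first by the Hermitian form and the second by the bilinear one. Since b is surjective, they
    agree.\<close>
  have b_real: "b (jtau (jgamma X)) = jtau (jgamma (b X))" for X
  proof -
    have "jinner (jtau (b X)) (b Z) = jinner (jgamma (b (jgamma (jtau X)))) (b Z)" for Z
    proof -
      have "pherm (pscale ?k (\<alpha> (X, 0, 0, 0))) (pscale ?k (\<alpha> (Z, 0, 0, 0))) = pherm (X, 0, 0, 0) (Z, 0, 0, 0)"
        using herm by (simp flip: sc) (use k1 in \<open>auto simp: pscale_def pherm_def jherm_def jtau_minus jinner_minus jscale_minus_left\<close>)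
      then show ?thesis
        by (simp add: bm b_inner pherm_def jherm_def flip: pact)
    qed
    then have "jtau (b X) = jgamma (b (jgamma (jtau X)))"
      using b_surj by (metis jinner_cancel)
    then show ?thesis
      by (simp add: jtau_gamma)
  qed
  have "b \<in> twisted_auto"
    unfolding twisted_auto_def bij_def inj_def surj_def
    using b_add b_scale b_inj b_surj b_cross b_inner b_real by (auto, metis)
  then show thesis
    using that k1 \<open>\<alpha> = _\<close> by blast
qed

subsection \<open>Quaternionic matrices as real matrices\<close>

text \<open>The matrices of left multiplications turn quaternionic matrices into real ones, for which a right
  inverse is known to be a left inverse.\<close>

definition lmult :: "'a::comm_ring_1 quat \<Rightarrow> 'a^4^4"
  where "lmult x = vector [
    vector [q0 x, - q1 x, - q2 x, - q3 x],
    vector [q1 x, q0 x, - q3 x, q2 x],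
    vector [q2 x, q3 x, q0 x, - q1 x],
    vector [q3 x, - q2 x, q1 x, q0 x]]"

lemma lmult_mult: "lmult (x * y) $ i $ j = (\<Sum>k\<in>UNIV. lmult x $ i $ k * lmult y $ k $ j)"
  using exhaust_4[of i] exhaust_4[of j]
  by (auto simp: lmult_def quat_sel_mult sum_4 algebra_simps)

lemma lmult_add: "lmult (x + y) = lmult x + lmult y"
  by (simp add: lmult_def vec_eq_iff forall_4)

lemma lmult_sum: "lmult (sum f S) $ i $ j = (\<Sum>k\<in>S. lmult (f k) $ i $ j)"
proof (induction S rule: infinite_finite_induct)
  case (insert x F)
  then show ?case by (simp add: lmult_add)
qed (use exhaust_4[of i] exhaust_4[of j] in \<open>auto simp: lmult_def\<close>)

definition real_mat :: "'a::comm_ring_1 quat^'n^'n \<Rightarrow> 'a^('n \<times> 4)^('n \<times> 4)"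
  where "real_mat A = (\<chi> p q. lmult (A $ fst p $ fst q) $ snd p $ snd q)"

lemma real_mat_mult: "real_mat (A ** B) = real_mat A ** real_mat B"
  by (simp add: real_mat_def matrix_matrix_mult_def vec_eq_iff lmult_sum lmult_mult
      sum.cartesian_product case_prod_beta)

lemma lmult_1: "lmult 1 = mat 1" and lmult_0: "lmult 0 = 0"
  by (auto simp: lmult_def vec_eq_iff forall_4 mat_def)

lemma real_mat_1: "real_mat (mat 1) = mat 1"
  by (auto simp: real_mat_def mat_def vec_eq_iff lmult_1 lmult_0 prod_eq_iff)

lemma real_mat_inj:
  assumes "real_mat A = real_mat B"
  shows "A = B"
proof -
  have "lmult (A $ i $ j) $ k $ 1 = lmult (B $ i $ j) $ k $ 1" for i j k
    using assms by (auto simp: real_mat_def vec_eq_iff dest!: spec[of _ "(i, k)"] spec[of _ "(j, 1)"])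
  from this[of _ _ 1] this[of _ _ 2] this[of _ _ 3] this[of _ _ 4] show ?thesis
    by (simp add: vec_eq_iff quat_eq_iff lmult_def)
qed

lemma quat_matrix_left_right_inverse:
  fixes A B :: "'a::field quat^'n^'n"
  assumes "A ** B = mat 1"
  shows "B ** A = mat 1"
  using assms by (metis matrix_left_right_inverse real_mat_1 real_mat_inj real_mat_mult)

lemma mmult_add: "(A + B) ** C = A ** C + B ** C" "A' ** (B' + C') = A' ** B' + A' ** C'"
  and mmult_diff: "(A - B) ** C = A ** C - B ** C" "A' ** (B' - C') = A' ** B' - A' ** C'"
  for A B :: "'a::ring_1^'n^'m" and B' C' :: "'a^'p^'n"
  by (simp_all add: vec_eq_iff matrix_matrix_mult_def algebra_simps sum.distrib sum_subtractf)

subsection \<open>Jordan homomorphisms of the quaternionic Hermitian matrices\<close>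

type_synonym qmat = "real quat^4^4"

text \<open>T is a total function on all matrices, but the conditions bind only its values at
  Hermitian ones. Preservation of the trace ensures that the diagonal units go to projections of
  trace one.\<close>

definition herm_jordan_hom :: "(qmat \<Rightarrow> qmat) \<Rightarrow> bool"
  where "herm_jordan_hom T \<longleftrightarrow>
    (\<forall>M N. madj M = M \<longrightarrow> madj N = N \<longrightarrow> T (M + N) = T M + T N \<and> T (mjprod M N) = mjprod (T M) (T N)) \<and>
    (\<forall>r M. madj M = M \<longrightarrow> T (mscale r M) = mscale r (T M) \<and> madj (T M) = T M \<and> mtr (T M) = mtr M) \<and>
    T (mat 1) = mat 1"

lemma herm_jordan_homD:
  assumes "herm_jordan_hom T"
  shows "madj M = M \<Longrightarrow> madj N = N \<Longrightarrow> T (M + N) = T M + T N"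
    "madj M = M \<Longrightarrow> madj N = N \<Longrightarrow> T (mjprod M N) = mjprod (T M) (T N)"
    "madj M = M \<Longrightarrow> T (mscale r M) = mscale r (T M)"
    "madj M = M \<Longrightarrow> madj (T M) = T M" "madj M = M \<Longrightarrow> mtr (T M) = mtr M"
    "T (mat 1) = mat 1"
  using assms by (simp_all only: herm_jordan_hom_def simp_thms)

section \<open>Matrix units and Peirce components\<close>

definition munit :: "'n \<Rightarrow> 'n \<Rightarrow> 'a::comm_ring_1 quat \<Rightarrow> 'a quat^'n^'n"
  where "munit i j x = (\<chi> k l. if k = i \<and> l = j then x else 0)"

definition mher :: "'n \<Rightarrow> 'n \<Rightarrow> 'a::comm_ring_1 quat \<Rightarrow> 'a quat^'n^'n"
  where "mher i j x = munit i j x + munit j i (qcnj x)"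

lemma munit_nth: "munit i j x $ k $ l = (if k = i \<and> l = j then x else 0)"
  by (simp add: munit_def)

lemma munit_mult_nth:
  "(munit i j x ** N) $ k $ l = (if k = i then x * N $ j $ l else 0)"
  "(N ** munit i j x) $ k $ l = (if l = j then N $ k $ i * x else 0)"
  by (auto simp: munit_def matrix_matrix_mult_def if_distrib[of "\<lambda>z. z * _"] if_distrib[of "\<lambda>z. _ * z"] cong: if_cong)

lemma munit_mult: "munit i j x ** munit k l y = (if j = k then munit i l (x * y) else 0)"
  by (auto simp: vec_eq_iff munit_mult_nth munit_nth)

lemma madj_munit: "madj (munit i j x) = munit j i (qcnj x)"
  by (auto simp: vec_eq_iff munit_nth)

lemma munit_linear:
  "munit i j (x + y) = munit i j x + munit i j y" "munit i j (qscale r x) = mscale r (munit i j x)"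
  by (auto simp: vec_eq_iff munit_nth)

lemma madj_mher: "madj (mher i j x) = mher i j x"
  by (simp add: mher_def madj_add madj_munit add.commute)

lemma mher_linear:
  "mher i j (x + y) = mher i j x + mher i j y" "mher i j (qscale r x) = mscale r (mher i j x)"
  by (simp_all add: mher_def munit_linear qcnj_add qcnj_scale mscale_add)

lemma mher_nth: "i \<noteq> j \<Longrightarrow> mher i j x $ i $ j = x"
  by (simp add: mher_def munit_nth)

lemma mher_flip: "mher j i x = mher i j (qcnj x)"
  by (simp add: mher_def add.commute)

lemma mjprod_herm: "madj M = M \<Longrightarrow> madj N = N \<Longrightarrow> madj (mjprod M N) = mjprod M N"
  by (simp add: mjprod_def madj_mscale madj_add madj_mult add.commute)

lemma mjprod_mher_mher:
  assumes "i \<noteq> j" "j \<noteq> k" "i \<noteq> k"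
  shows "mjprod (mher i j x) (mher j k y) = mscale (1/2) (mher i k (x * y))"
  using assms
  by (simp add: mjprod_def mher_def mmult_add munit_mult qcnj_mult)

text \<open>The square sees only the norm of x. This forces unit norm on entries whose square is
  prescribed.\<close>

lemma mjprod_mher_self:
  fixes x :: "real quat"
  assumes "i \<noteq> j"
  shows "mjprod (mher i j x) (mher i j x) = mscale (qin x x) (munit i i 1 + munit j j 1)"
proof -
  have "x * qcnj x = qscale (qin x x) 1" "qcnj x * x = qscale (qin x x) 1"
    by (simp_all add: quat_eq_iff quat_sel_mult qin_def algebra_simps)
  then show ?thesis
    using assms
    by (simp add: mjprod_def mher_def mmult_add munit_mult munit_linear
      mscale_add) (auto simp: vec_eq_iff munit_nth quat_eq_iff)
qed

text \<open>Each of the two multiplications acts as 1/2 on the (i,j) Peirce space, and together they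
  remove every other entry. Being written in Jordan products, the projection passes through
  T.\<close>

lemma peirce_offdiag:
  fixes N :: "'a::field_char_0 quat^'n^'n"
  assumes "i \<noteq> j" "madj N = N"
  shows "mscale 4 (mjprod (munit i i 1) (mjprod (munit j j 1) N)) = mher i j (N $ i $ j)"
proof -
  have "N $ j $ i = qcnj (N $ i $ j)"
    using assms(2) by (metis madj_nth)
  with assms(1) show ?thesis
    by (auto simp: vec_eq_iff mjprod_def mher_def munit_nth munit_mult_nth mmult_add mscale_mult_left mscale_mult_right mscale_add)
qed

text \<open>Multiplication L by the unit has eigenvalues 1, 1/2 and 0, and 2 L^2 - L is the
  projection onto eigenvalue 1.\<close>

lemma peirce_diag:
  fixes N :: "'a::field_char_0 quat^'n^'n"
  shows "mscale 2 (mjprod (munit i i 1) (mjprod (munit i i 1) N)) - mjprod (munit i i 1) N = munit i i (N $ i $ i)"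
proof -
  have "qscale (1/2) x + qscale (1/2) x = x" for x :: "'a quat"
    by (simp flip: qscale_add_left)
  then show ?thesis
    by (auto simp: vec_eq_iff mjprod_def munit_nth munit_mult_nth mmult_add mscale_mult_left mscale_mult_right mscale_add qscale_add)
qed

lemma herm_jordan_hom_conjugate:
  assumes T: "herm_jordan_hom T" and A: "A ** madj A = mat 1"
  shows "herm_jordan_hom (\<lambda>N. madj A ** T N ** A)"
proof -
  have A': "madj A ** A = mat 1"
    using A by (rule quat_matrix_left_right_inverse)
  have m: "(madj A ** M ** A) ** (madj A ** N ** A) = madj A ** (M ** N) ** A" for M N
  proof -
    have "(madj A ** M ** A) ** (madj A ** N ** A) = madj A ** (M ** (A ** madj A) ** N) ** A"
      by (simp only: matrix_mul_assoc)
    then show ?thesis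
      by (simp only: A matrix_mul_rid)
  qed
  have t: "mtr (madj A ** M ** A) = mtr M" for M
  proof -
    have "mtr (madj A ** M ** A) = mtr (A ** (madj A ** M))"
      by (rule mtr_mult_commute)
    then show ?thesis
      by (simp only: matrix_mul_assoc A matrix_mul_lid)
  qed
  let ?C = "\<lambda>N. madj A ** N ** A"
  have j: "?C (mjprod M N) = mjprod (?C M) (?C N)" for M N
    unfolding mjprod_def m by (simp only: mscale_mult_left mscale_mult_right mmult_add)
  have h: "madj (?C M) = ?C M" if "madj M = M" for M
    using that by (simp add: madj_mult matrix_mul_assoc)
  have o: "?C (mat 1) = mat 1"
    by (simp add: A')
  have l: "?C (M + N) = ?C M + ?C N" "?C (mscale r M) = mscale r (?C M)" for M N r
    by (simp_all only: mscale_mult_left mscale_mult_right mmult_add)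
  show ?thesis
    unfolding herm_jordan_hom_def
    by (intro conjI allI impI; simp only: herm_jordan_homD[OF T] t j h o l)
qed

text \<open>Over the reals this trace is the sum of the norms of all entries.\<close>

lemma mtr_mult_madj_eq_0:
  fixes M :: "real quat^'n^'n"
  assumes "mtr (M ** madj M) = 0"
  shows "M = 0"
proof -
  have q: "q0 (x * qcnj x) = qin x x" for x :: "real quat"
    by (simp add: quat_sel_mult qin_def)
  have nn: "0 \<le> qin x x" for x :: "real quat"
    by (simp add: qin_def)
  have "(\<Sum>i\<in>UNIV. \<Sum>k\<in>UNIV. qin (M $ i $ k) (M $ i $ k)) = 0"
    using assms by (simp add: mtr_def matrix_matrix_mult_def q0_sum q)
  then have "qin (M $ i $ k) (M $ i $ k) = 0" for i k
    by (simp add: sum_nonneg_eq_0_iff nn sum_nonneg)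
  then have "(q0 (M $ i $ k))\<^sup>2 + (q1 (M $ i $ k))\<^sup>2 + (q2 (M $ i $ k))\<^sup>2 + (q3 (M $ i $ k))\<^sup>2 = 0" for i k
    by (simp add: qin_def power2_eq_square)
  then show ?thesis
    by (simp add: vec_eq_iff quat_eq_iff add_nonneg_eq_0_iff)
qed

text \<open>For a nonzero diagonal entry d = p_kk the matrix q = p e_kk p / d is a projection below
  p of trace one, so p - q is a projection of trace zero and vanishes. Hence p_ab = p_ak p_kb / d,
  and the factor 1/d is shared equally between the two vectors.\<close>

lemma rank_one_projection:
  fixes p :: qmat
  assumes h: "madj p = p" and i: "p ** p = p" and t: "mtr p = 1"
  obtains v where "\<And>a b. p $ a $ b = v a * qcnj (v b)"
proof -
  obtain k where k: "q0 (p $ k $ k) \<noteq> 0"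
    using t by (metis (no_types, lifting) mtr_def sum.neutral zero_neq_one)
  define d where "d = q0 (p $ k $ k)"
  have pa: "qcnj (p $ b $ a) = p $ a $ b" for a b
    using h by (metis madj_nth)
  have "p $ k $ k = qscale d 1"
    using pa[of k k] by (simp add: d_def quat_eq_iff)
  then have epe: "munit k k 1 ** p ** munit k k 1 = mscale d (munit k k 1)"
    by (auto simp: vec_eq_iff munit_mult_nth munit_nth)
  \<comment> \<open>The (k,k) entry of p p = p writes d as a sum of norms; its positivity provides
    the square root below.\<close>
  have "d = (\<Sum>l\<in>UNIV. qin (p $ k $ l) (p $ k $ l))"
  proof -
    have "d = q0 ((p ** p) $ k $ k)"
      by (simp add: i d_def)
    also have "\<dots> = (\<Sum>l\<in>UNIV. q0 (p $ k $ l * qcnj (p $ k $ l)))"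
      by (simp add: matrix_matrix_mult_def q0_sum pa)
    finally show ?thesis
      by (simp add: qin_def quat_sel_mult)
  qed
  then have "d \<ge> 0"
    by (simp add: sum_nonneg qin_def)
  with k have d: "d > 0"
    by (simp add: d_def)
  let ?e = "munit k k 1 :: qmat"
  define q where "q = mscale (1/d) (p ** ?e ** p)"
  have qh: "madj q = q"
    by (simp add: q_def madj_mscale madj_mult madj_munit h matrix_mul_assoc)
  have pq: "p ** q = q"
    by (simp add: q_def mscale_mult_right matrix_mul_assoc i)
  have qp: "q ** p = q"
    by (simp add: q_def mscale_mult_left i flip: matrix_mul_assoc)
  have "(p ** ?e ** p) ** (p ** ?e ** p) = p ** (?e ** (p ** p) ** ?e) ** p"
    by (simp add: matrix_mul_assoc)
  also have "\<dots> = mscale d (p ** ?e ** p)"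
    by (simp only: i epe mscale_mult_left mscale_mult_right)
  finally have qq: "q ** q = q"
    using d by (simp add: q_def mscale_mult_left mscale_mult_right)
  have "mtr (p ** ?e ** p) = mtr (?e ** p)"
    using mtr_mult_commute[of "p ** ?e" p] by (simp add: i matrix_mul_assoc mtr_mult_commute[of p])
  also have "\<dots> = d"
    by (simp add: mtr_def munit_mult_nth d_def if_distrib[of q0] cong: if_cong)
  finally have "mtr q = 1"
    using d by (simp add: q_def mtr_mscale)
  then have "mtr ((p - q) ** madj (p - q)) = 0"
    by (simp add: madj_diff h qh mmult_diff i qq pq qp mtr_diff t)
  then have "p = q"
    using mtr_mult_madj_eq_0 by fastforce
  have "p $ a $ b = qscale (1 / sqrt d) (p $ a $ k) * qcnj (qscale (1 / sqrt d) (p $ b $ k))" for a b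
  proof -
    have "p $ a $ b = qscale (1/d) ((p ** ?e ** p) $ a $ b)"
      using \<open>p = q\<close> by (metis q_def mscale_nth)
    also have "(p ** ?e ** p) $ a $ b = p $ a $ k * p $ k $ b"
      by (simp add: munit_mult_nth flip: matrix_mul_assoc)
        (simp add: matrix_matrix_mult_def[of p] munit_mult_nth if_distrib[of "\<lambda>z. _ * z"] cong: if_cong)
    finally show ?thesis
      using d by (simp add: qcnj_scale pa qscale_mult_left qscale_mult_right)
  qed
  then show thesis
    by (rule that[of "\<lambda>a. qscale (1 / sqrt d) (p $ a $ k)"])
qed

lemma mat1_eq_sum_munit: "(mat 1 :: 'a::comm_ring_1 quat^4^4) = munit 1 1 1 + munit 2 2 1 + munit 3 3 1 + munit 4 4 1"
  by (simp add: vec_eq_iff forall_4 mat_def munit_nth)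

lemma madj_munit_1 [simp]: "madj (munit i i 1) = munit i i 1"
  by (simp add: madj_munit)

text \<open>Each T(e_ii) is a Hermitian idempotent of trace one, hence v_i v_i^*. With the v_i as
  columns of A, the product A A^* is the sum of the T(e_ii), that is T(E) = E, so unitarity follows
  without showing orthogonality of the v_i.\<close>

lemma herm_jordan_hom_diagonalise:
  assumes T: "herm_jordan_hom T"
  obtains A where "A ** madj A = mat 1" "\<And>i. madj A ** T (munit i i 1) ** A = munit i i 1"
proof -
  have "\<exists>v. \<forall>a b. T (munit i i 1) $ a $ b = v a * qcnj (v b)" for i
  proof -
    have m: "mjprod (munit i i 1) (munit i i 1) = (munit i i 1 :: qmat)"
      by (auto simp: mjprod_def munit_mult vec_eq_iff munit_nth quat_eq_iff)
    have "mjprod (T (munit i i 1)) (T (munit i i 1)) = T (munit i i 1)"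
      using herm_jordan_homD(2)[OF T, of "munit i i 1" "munit i i 1"] by (simp add: m)
    moreover have "mjprod M M = M ** M" for M :: qmat
      by (simp add: mjprod_def vec_eq_iff quat_eq_iff)
    ultimately have "T (munit i i 1) ** T (munit i i 1) = T (munit i i 1)"
      by simp
    moreover have "mtr (munit i i 1 :: qmat) = 1"
      by (simp add: mtr_def munit_nth if_distrib[of q0] cong: if_cong)
    ultimately show ?thesis
      using rank_one_projection[of "T (munit i i 1)"] herm_jordan_homD(4,5)[OF T, of "munit i i 1"]
      by (metis madj_munit_1)
  qed
  then obtain V where V: "T (munit i i 1) $ a $ b = V i a * qcnj (V i b)" for i a b
    by metis
  define A :: qmat where "A = (\<chi> a j. V j a)"
  have p: "A ** munit j j 1 ** madj A = T (munit j j 1)" for j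
    by (simp add: vec_eq_iff V A_def matrix_matrix_mult_def[of "_ ** _"] munit_mult_nth
        if_distrib[of "\<lambda>z. z * _"] cong: if_cong)
  have "A ** madj A = A ** mat 1 ** madj A"
    by simp
  also have "\<dots> = T (munit 1 1 1) + T (munit 2 2 1) + T (munit 3 3 1) + T (munit 4 4 1)"
    unfolding mat1_eq_sum_munit by (simp add: mmult_add p)
  also have "\<dots> = T (mat 1)"
    unfolding mat1_eq_sum_munit by (simp add: herm_jordan_homD(1)[OF T] madj_add)
  finally have AA: "A ** madj A = mat 1"
    by (simp add: herm_jordan_homD(6)[OF T])
  have "madj A ** T (munit j j 1) ** A = munit j j 1" for j
  proof -
    have "madj A ** T (munit j j 1) ** A = (madj A ** A) ** munit j j 1 ** (madj A ** A)"
      by (simp only: matrix_mul_assoc flip: p)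
    then show ?thesis
      by (simp add: quat_matrix_left_right_inverse[OF AA])
  qed
  with AA show thesis
    by (rule that)
qed

text \<open>T fixes the diagonal units and thus commutes with the Peirce projections built from
  them. A diagonal entry of a Hermitian matrix is real, so real linearity forces T to keep
  it.\<close>

lemma herm_jordan_hom_peirce:
  assumes T: "herm_jordan_hom T" and e: "\<And>i. T (munit i i 1) = munit i i 1" and N: "madj N = N"
  shows "i \<noteq> j \<Longrightarrow> T (mher i j (N $ i $ j)) = mher i j (T N $ i $ j)" "T N $ i $ i = N $ i $ i"
proof -
  show "T (mher i j (N $ i $ j)) = mher i j (T N $ i $ j)" if "i \<noteq> j"
    by (simp add: peirce_offdiag[OF that, symmetric] herm_jordan_homD[OF T] N mjprod_herm e)
  obtain r where r: "N $ i $ i = qscale r 1"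
  proof
    have "qcnj (N $ i $ i) = N $ i $ i"
      using N by (metis madj_nth)
    then show "N $ i $ i = qscale (q0 (N $ i $ i)) 1"
      by (simp add: quat_eq_iff)
  qed
  let ?e = "munit i i 1 :: qmat"
  have m: "madj (mscale (- 1) (mjprod ?e N)) = mscale (- 1) (mjprod ?e N)"
    by (simp add: madj_mscale mjprod_herm N)
  have d: "mscale (- 1) M = - M" for M :: qmat
    by (simp add: vec_eq_iff quat_eq_iff)
  have "munit i i (T N $ i $ i) = T (mscale 2 (mjprod ?e (mjprod ?e N)) + mscale (- 1) (mjprod ?e N))"
    using m by (simp add: peirce_diag[symmetric] herm_jordan_homD[OF T] N mjprod_herm madj_mscale e)
      (simp add: d)
  also have "\<dots> = T (munit i i (N $ i $ i))"
    by (simp add: d peirce_diag)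
  also have "\<dots> = munit i i (N $ i $ i)"
    by (simp add: r munit_linear herm_jordan_homD[OF T] e)
  finally show "T N $ i $ i = N $ i $ i"
    by (auto simp: vec_eq_iff munit_nth split: if_splits)
qed

text \<open>Summing \<open>f u x u\<^sup>-\<^sup>1\<close> over \<open>u = 1, i, j, k\<close> gives an element \<open>Q\<close> with \<open>f v Q = Q v\<close> for all \<open>v\<close>, which is
  nonzero for some \<open>x\<close>.\<close>

lemma quat_endomorphism_inner:
  fixes f :: "real quat \<Rightarrow> real quat"
  assumes add: "\<And>x y. f (x + y) = f x + f y" and sc: "\<And>r x. f (qscale r x) = qscale r (f x)"
    and mult: "\<And>x y. f (x * y) = f x * f y" and one: "f 1 = 1"
  obtains q where "q * qcnj q = 1" "\<And>x. f x = q * x * qcnj q"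
proof -
  define u1 u2 u3 :: "real quat" where "u1 = Quat 0 1 0 0" and "u2 = Quat 0 0 1 0" and "u3 = Quat 0 0 0 1"
  note u = u1_def u2_def u3_def
  have uu: "u1 * u1 = - 1" "u2 * u2 = - 1" "u3 * u3 = - 1" "u1 * u2 = u3" "u2 * u3 = u1" "u3 * u1 = u2"
    "u2 * u1 = - u3" "u3 * u2 = - u1" "u1 * u3 = - u2"
    by (simp_all add: u quat_eq_iff quat_sel_mult)
  have fm: "f (- x) = - f x" for x
  proof -
    have "- y = qscale (- 1) y" for y :: "real quat"
      by (simp add: quat_eq_iff)
    then show ?thesis
      by (simp add: sc)
  qed
  define a b c where "a = f u1" and "b = f u2" and "c = f u3"
  have ff: "a * a = - 1" "b * b = - 1" "c * c = - 1" "a * b = c" "b * c = a" "c * a = b"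
    "b * a = - c" "c * b = - a" "a * c = - b"
    unfolding a_def b_def c_def by (simp_all add: fm one uu flip: mult)
  have ffz: "a * (a * z) = - z" "b * (b * z) = - z" "c * (c * z) = - z" "a * (b * z) = c * z" "b * (c * z) = a * z"
    "c * (a * z) = b * z" "b * (a * z) = - (c * z)" "c * (b * z) = - (a * z)" "a * (c * z) = - (b * z)" for z
    by (simp_all add: ff flip: mult.assoc)
  define Q where "Q x = x - a * (x * u1) - b * (x * u2) - c * (x * u3)" for x
  have Qu: "a * Q x = Q x * u1" "b * Q x = Q x * u2" "c * Q x = Q x * u3" for x
    by (simp_all add: Q_def algebra_simps ffz uu)
  have dec: "v = qscale (q0 v) 1 + qscale (q1 v) u1 + qscale (q2 v) u2 + qscale (q3 v) u3" for v
    by (simp add: u quat_eq_iff)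
  have comm: "f v * Q x = Q x * v" for v x
  proof -
    have "f v = qscale (q0 v) 1 + qscale (q1 v) a + qscale (q2 v) b + qscale (q3 v) c"
      by (subst dec[of v], simp only: add sc one a_def b_def c_def)
    then have "f v * Q x = Q x * (qscale (q0 v) 1 + qscale (q1 v) u1 + qscale (q2 v) u2 + qscale (q3 v) u3)"
      by (simp only: distrib_left distrib_right qscale_mult_left qscale_mult_right Qu mult_1 mult_1_right)
    then show ?thesis
      by (simp flip: dec)
  qed
  have "\<exists>x. Q x \<noteq> 0"
  proof (rule ccontr)
    assume "\<not> ?thesis"
    then have "Q 1 - Q u1 * u1 - Q u2 * u2 - Q u3 * u3 = 0"
      by simp
    \<comment> \<open>In this combination the terms with a, b and c cancel and 4 remains, so Q
      cannot vanish at all of 1, u1, u2, u3.\<close>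
    moreover have "Q 1 - Q u1 * u1 - Q u2 * u2 - Q u3 * u3 = 1 + 1 + 1 + 1"
      unfolding Q_def by (simp add: algebra_simps uu)
    ultimately have "q0 (1 + 1 + 1 + 1 :: real quat) = q0 (0 :: real quat)"
      by simp
    then show False
      by (simp only: quat_sel)
  qed
  then obtain x where x: "Q x \<noteq> 0"
    by blast
  define n where "n = qin (Q x) (Q x)"
  have "n > 0"
  proof -
    have "(q0 (Q x))\<^sup>2 + (q1 (Q x))\<^sup>2 + (q2 (Q x))\<^sup>2 + (q3 (Q x))\<^sup>2 \<noteq> 0"
      using x by (simp add: quat_eq_iff add_nonneg_eq_0_iff)
    moreover have "(q0 (Q x))\<^sup>2 + (q1 (Q x))\<^sup>2 + (q2 (Q x))\<^sup>2 + (q3 (Q x))\<^sup>2 \<ge> 0"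
      by simp
    ultimately show ?thesis
      unfolding n_def qin_def power2_eq_square[symmetric] by linarith
  qed
  define q where "q = qscale (1 / sqrt n) (Q x)"
  have "Q x * qcnj (Q x) = qscale n 1"
    by (simp add: n_def quat_eq_iff quat_sel_mult qin_def algebra_simps)
  then have qq: "q * qcnj q = 1"
    using \<open>n > 0\<close> by (simp add: q_def qcnj_scale qscale_mult_left qscale_mult_right)
  have "f v * q = q * v" for v
    by (simp add: q_def qscale_mult_left qscale_mult_right comm)
  then have "f v * (q * qcnj q) = q * v * qcnj q" for v
    by (simp flip: mult.assoc)
  then have "f v = q * v * qcnj q" for v
    by (simp add: qq)
  with qq show thesis
    by (rule that)
qed

definition mdiag :: "('n \<Rightarrow> 'a::comm_ring_1 quat) \<Rightarrow> 'a quat^'n^'n"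
  where "mdiag u = (\<chi> i j. if i = j then u i else 0)"

lemma mdiag_mult_nth: "(mdiag u ** N) $ i $ j = u i * N $ i $ j" "(N ** mdiag u) $ i $ j = N $ i $ j * u j"
  by (simp_all add: mdiag_def matrix_matrix_mult_def if_distrib[of "\<lambda>z. z * _"] if_distrib[of "\<lambda>z. _ * z"] cong: if_cong)

lemma madj_mdiag: "madj (mdiag u) = mdiag (\<lambda>i. qcnj (u i))"
  by (auto simp: vec_eq_iff mdiag_def)

lemma mdiag_unitary: "(\<And>i. u i * qcnj (u i) = 1) \<Longrightarrow> mdiag u ** madj (mdiag u) = mat 1"
  by (simp add: vec_eq_iff mdiag_mult_nth madj_mdiag) (simp add: mdiag_def mat_def)

lemma mscale_cancel:
  fixes M N :: qmat
  shows "r \<noteq> 0 \<Longrightarrow> mscale r M = mscale r N \<longleftrightarrow> M = N"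
  by (auto simp: vec_eq_iff quat_eq_iff)

text \<open>The coordinate maps of T satisfy g_ik(xy) = g_ij(x) g_jk(y) for distinct indices. Once
  all of them fix 1, setting x or y to 1 shows that they coincide, and the common map is a unital
  real-linear endomorphism of H, hence inner.\<close>

lemma herm_jordan_hom_offdiag:
  assumes T: "herm_jordan_hom T" and e: "\<And>i. T (munit i i 1) = munit i i 1"
    and one: "\<And>j. j \<noteq> 1 \<Longrightarrow> T (mher j 1 1) $ j $ 1 = 1"
  obtains q where "q * qcnj q = 1" "\<And>N. madj N = N \<Longrightarrow> T N = mdiag (\<lambda>_. q) ** N ** madj (mdiag (\<lambda>_. q))"
proof -
  define g where "g i j x = T (mher i j x) $ i $ j" for i j x
  have p: "T (mher i j x) = mher i j (g i j x)" if "i \<noteq> j" for i j x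
    using herm_jordan_hom_peirce(1)[OF T e madj_mher that, of i j x] that by (simp add: mher_nth g_def)
  have Tg: "T N $ i $ j = g i j (N $ i $ j)" if "madj N = N" "i \<noteq> j" for N i j
    using herm_jordan_hom_peirce(1)[OF T e that] p[OF that(2)] that(2) by (metis mher_nth)
  have add: "g i j (x + y) = g i j x + g i j y" and sc: "g i j (qscale r x) = qscale r (g i j x)" for i j x y r
    by (simp_all add: g_def mher_linear herm_jordan_homD[OF T] madj_mher)
  have mult: "g i k (x * y) = g i j x * g j k y" if "i \<noteq> j" "j \<noteq> k" "i \<noteq> k" for i j k x y
  proof -
    have "mscale (1/2) (T (mher i k (x * y))) = T (mjprod (mher i j x) (mher j k y))"
      by (simp add: mjprod_mher_mher[OF that] herm_jordan_homD(3)[OF T] madj_mher)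
    also have "\<dots> = mjprod (T (mher i j x)) (T (mher j k y))"
      by (intro herm_jordan_homD(2)[OF T] madj_mher)
    also have "\<dots> = mscale (1/2) (mher i k (g i j x * g j k y))"
      using that by (simp add: p mjprod_mher_mher)
    finally have "T (mher i k (x * y)) = mher i k (g i j x * g j k y)"
      by (simp add: mscale_cancel)
    then show ?thesis
      using that by (simp add: g_def[of i k] mher_nth)
  qed
  have j1: "g j 1 1 = 1" if "j \<noteq> 1" for j
    using one[OF that] by (simp add: g_def)
  have flip: "g j i x = qcnj (g i j (qcnj x))" if "i \<noteq> j" for i j x
  proof -
    have "T (mher j i x) = mher i j (g i j (qcnj x))"
      by (simp only: mher_flip[of j i] p[OF that])
    then have "g j i x = mher i j (g i j (qcnj x)) $ j $ i"
      by (simp add: g_def[of j i])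
    then show ?thesis
      using that by (simp add: mher_def munit_nth)
  qed
  \<comment> \<open>Only entries in the first column are normalised by assumption; the others are
    reached by passing through index 1.\<close>
  have g1: "g i j 1 = 1" if "i \<noteq> j" for i j
  proof (cases "i = 1 \<or> j = 1")
    case True
    then show ?thesis
      using that j1[of i] j1[of j] flip[of j i 1] by auto
  next
    case False
    then show ?thesis
      using that mult[of i 1 j 1 1] j1[of i] j1[of j] flip[of j 1 1] by auto
  qed
  have R1: "g i k x = g i j x" if "i \<noteq> j" "j \<noteq> k" "i \<noteq> k" for i j k x
    using mult[OF that, of x 1] g1[OF that(2)] by simp
  have R2: "g i k x = g j k x" if "i \<noteq> j" "j \<noteq> k" "i \<noteq> k" for i j k x
    using mult[OF that, of 1 x] g1[OF that(1)] by simp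
  define f where "f = g 1 2"
  have f1: "g 1 j x = f x" if "j \<noteq> 1" for j x
    using R1[of 1 2 j x] that by (cases "j = 2") (auto simp: f_def)
  have f2: "g i j x = f x" if "i \<noteq> j" "j \<noteq> 1" for i j x
    using R2[of i 1 j x] f1[of j x] that by (cases "i = 1") auto
  have f: "g i j x = f x" if "i \<noteq> j" for i j x
  proof (cases "j = 1")
    case True
    \<comment> \<open>A third index: going from i through k to 1 reduces the first column to the
      columns already treated.\<close>
    define k :: 4 where "k = (if i = 2 then 3 else 2)"
    have "k \<noteq> i" "k \<noteq> 1"
      by (auto simp: k_def)
    then show ?thesis
      using R1[of i k j x] f2[of i k x] that True by auto
  qed (use f2 that in auto)
  have fm: "f (x * y) = f x * f y" for x y
    using mult[of 1 3 2 x y] by (simp add: f)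
  have fo: "f 1 = 1"
    using g1[of 1 2] by (simp add: f_def)
  have fa: "f (x + y) = f x + f y" and fs: "f (qscale r x) = qscale r (f x)" for x y r
    unfolding f_def by (rule add, rule sc)
  obtain q where q: "q * qcnj q = 1" "\<And>x. f x = q * x * qcnj q"
    by (rule quat_endomorphism_inner[of f, OF fa fs fm fo]) blast
  have "T N = mdiag (\<lambda>_. q) ** N ** madj (mdiag (\<lambda>_. q))" if N: "madj N = N" for N
  proof -
    have "T N $ i $ j = q * N $ i $ j * qcnj q" for i j
    proof (cases "i = j")
      case True
      have "qcnj (N $ i $ i) = N $ i $ i"
        using N by (metis madj_nth)
      then have r: "N $ i $ i = qscale (q0 (N $ i $ i)) 1"
        by (simp add: quat_eq_iff)
      have "q * N $ i $ i * qcnj q = N $ i $ i"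
        by (subst (1 2) r) (simp add: qscale_mult_left qscale_mult_right q)
      then show ?thesis
        using True herm_jordan_hom_peirce(2)[OF T e N, of i] by simp
    next
      case False
      then show ?thesis
        by (simp add: Tg[OF N] f q)
    qed
    then show ?thesis
      by (simp add: vec_eq_iff mdiag_mult_nth madj_mdiag)
  qed
  with q(1) show thesis
    by (rule that)
qed

lemma herm_jordan_hom_conjugation:
  assumes T: "herm_jordan_hom T"
  obtains A where "A ** madj A = mat 1" "\<And>N. madj N = N \<Longrightarrow> T N = A ** N ** madj A"
proof -
  obtain A0 where A0: "A0 ** madj A0 = mat 1" and e1: "\<And>i. madj A0 ** T (munit i i 1) ** A0 = munit i i 1"
    using herm_jordan_hom_diagonalise[OF T] by metis
  define T1 where "T1 N = madj A0 ** T N ** A0" for N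
  have T1: "herm_jordan_hom T1"
    using herm_jordan_hom_conjugate[OF T A0] by (simp add: T1_def[abs_def])
  have e1: "T1 (munit i i 1) = munit i i 1" for i
    by (simp add: T1_def e1)
  \<comment> \<open>Conjugation by the diagonal matrix of the u j multiplies the (j,1) entry by the
    conjugate of u j on the left and by u 1 = 1 on the right, which turns u j into 1.\<close>
  define u where "u j = (if j = 1 then 1 else T1 (mher j 1 1) $ j $ 1)" for j
  have pu: "T1 (mher j 1 1) = mher j 1 (u j)" if "j \<noteq> 1" for j
    using herm_jordan_hom_peirce(1)[OF T1 e1 madj_mher that, of j 1 1] that by (simp add: mher_nth u_def)
  have nu: "u j * qcnj (u j) = 1" for j
  proof (cases "j = 1")
    case False
    let ?e = "munit j j 1 + munit 1 1 1 :: qmat"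
    have "T1 (mjprod (mher j 1 1) (mher j 1 1)) = ?e"
      by (simp add: mjprod_mher_self[OF False] qin_def herm_jordan_homD[OF T1] e1 madj_add)
    moreover have "T1 (mjprod (mher j 1 1) (mher j 1 1)) = mjprod (T1 (mher j 1 1)) (T1 (mher j 1 1))"
      by (intro herm_jordan_homD(2)[OF T1] madj_mher)
    ultimately have "mscale (qin (u j) (u j)) ?e = ?e"
      by (simp only: pu[OF False] mjprod_mher_self[OF False])
    then have "mscale (qin (u j) (u j)) ?e $ j $ j = ?e $ j $ j"
      by simp
    then have "qin (u j) (u j) = 1"
      using False by (simp add: munit_nth quat_eq_iff)
    then show ?thesis
      by (simp add: quat_eq_iff quat_sel_mult qin_def)
  qed (simp add: u_def)
  have nu': "qcnj (u j) * u j = 1" for j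
    using nu[of j] by (simp add: quat_eq_iff quat_sel_mult algebra_simps)
  define D where "D = mdiag u"
  have D: "D ** madj D = mat 1"
    unfolding D_def using nu by (rule mdiag_unitary)
  define T2 where "T2 N = madj D ** T1 N ** D" for N
  have T2: "herm_jordan_hom T2"
    using herm_jordan_hom_conjugate[OF T1 D] by (simp add: T2_def[abs_def])
  have T2_nth: "T2 N $ i $ j = qcnj (u i) * T1 N $ i $ j * u j" for N i j
    by (simp add: T2_def D_def madj_mdiag mdiag_mult_nth)
  have e2: "T2 (munit i i 1) = munit i i 1" for i
    by (simp add: vec_eq_iff T2_nth e1 munit_nth nu')
  have "T2 (mher j 1 1) $ j $ 1 = 1" if "j \<noteq> 1" for j
    using nu'[of j] by (simp add: T2_nth pu[OF that] mher_nth[OF that]) (simp add: u_def)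
  then obtain q where q: "q * qcnj q = 1" and Tq: "\<And>N. madj N = N \<Longrightarrow> T2 N = mdiag (\<lambda>_. q) ** N ** madj (mdiag (\<lambda>_. q))"
    using herm_jordan_hom_offdiag[OF T2 e2] by metis
  define B where "B = mdiag (\<lambda>_::4. q)"
  have B: "B ** madj B = mat 1"
    unfolding B_def using q by (intro mdiag_unitary)
  have undo: "M = A ** (madj A ** M ** A) ** madj A" if "A ** madj A = mat 1" for A M :: qmat
  proof -
    have "A ** (madj A ** M ** A) ** madj A = (A ** madj A) ** M ** (A ** madj A)"
      by (simp only: matrix_mul_assoc)
    then show ?thesis
      by (simp add: that)
  qed
  have "T N = (A0 ** D ** B) ** N ** madj (A0 ** D ** B)" if N: "madj N = N" for N
  proof -
    have "T N = A0 ** (D ** (B ** N ** madj B) ** madj D) ** madj A0"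
      using undo[OF A0, of "T N"] undo[OF D, of "T1 N"] Tq[OF N] by (simp add: T1_def T2_def B_def)
    then show ?thesis
      by (simp only: madj_mult matrix_mul_assoc)
  qed
  moreover have "(A0 ** D ** B) ** madj (A0 ** D ** B) = mat 1"
  proof -
    have "(A0 ** D ** B) ** madj (A0 ** D ** B) = A0 ** (D ** (B ** madj B) ** madj D) ** madj A0"
      by (simp only: madj_mult matrix_mul_assoc)
    then show ?thesis
      by (simp only: B D A0 matrix_mul_rid)
  qed
  ultimately show thesis
    using that by blast
qed

subsection \<open>The action of the symplectic group\<close>

definition cplx_mat :: "qmat \<Rightarrow> complex quat^4^4"
  where "cplx_mat A = (\<chi> i j. map_quat complex_of_real (A $ i $ j))"

definition re_mat :: "complex quat^4^4 \<Rightarrow> qmat"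
  where "re_mat A = (\<chi> i j. map_quat Re (A $ i $ j))"

lemma map_quat_of_real_sum:
  "map_quat complex_of_real (sum f S) = (\<Sum>k\<in>S. map_quat complex_of_real (f k))"
  by (induction S rule: infinite_finite_induct) (simp_all add: quat_eq_iff)

lemma cplx_mat_mult: "cplx_mat (A ** B) = cplx_mat A ** cplx_mat B"
  by (simp add: cplx_mat_def matrix_matrix_mult_def vec_eq_iff map_quat_of_real_sum)
    (simp add: quat_eq_iff quat_sel_mult sum_4)

lemma cplx_mat_madj: "cplx_mat (madj A) = madj (cplx_mat A)"
  by (simp add: cplx_mat_def vec_eq_iff quat_eq_iff)

lemma cplx_mat_1: "cplx_mat (mat 1) = mat 1"
  by (auto simp: cplx_mat_def vec_eq_iff mat_def quat_eq_iff)

lemma cplx_mat_add: "cplx_mat (A + B) = cplx_mat A + cplx_mat B"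
  and cplx_mat_mscale: "cplx_mat (mscale r A) = mscale (complex_of_real r) (cplx_mat A)"
  and mtr_cplx_mat: "mtr (cplx_mat A) = complex_of_real (mtr A)"
  and re_mat_cplx_mat: "re_mat (cplx_mat A) = A"
  by (simp_all add: cplx_mat_def re_mat_def vec_eq_iff quat_eq_iff mtr_def)

lemma cplx_mat_inj: "cplx_mat A = cplx_mat B \<longleftrightarrow> A = B"
  by (metis re_mat_cplx_mat)

lemma cplx_mat_mjprod: "cplx_mat (mjprod A B) = mjprod (cplx_mat A) (cplx_mat B)"
  by (simp add: mjprod_def cplx_mat_mscale cplx_mat_add cplx_mat_mult)

lemma cnj_eq_imp_of_real: "cnj z = z \<Longrightarrow> complex_of_real (Re z) = z"
  by (metis Reals_cnj_iff of_real_Re)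

lemma cplx_mat_re_mat: "mbar N = N \<Longrightarrow> cplx_mat (re_mat N) = N"
  by (simp add: cplx_mat_def re_mat_def mbar_def vec_eq_iff quat_eq_iff cnj_eq_imp_of_real)

lemma mbar_cplx_mat: "mbar (cplx_mat A) = cplx_mat A"
  by (simp add: cplx_mat_def mbar_def vec_eq_iff quat_eq_iff)

lemma qbar_sum: "qbar (sum f S) = (\<Sum>k\<in>S. qbar (f k))"
  by (induction S rule: infinite_finite_induct) (simp_all add: quat_eq_iff)

lemma mbar_mult: "mbar (M ** N) = mbar M ** mbar N"
  by (simp add: mbar_def matrix_matrix_mult_def vec_eq_iff qbar_sum)
    (simp add: quat_eq_iff quat_sel_mult sum_4)

lemma mbar_madj: "mbar (madj M) = madj (mbar M)"
  by (simp add: mbar_def vec_eq_iff quat_eq_iff)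

lemma gmat_inj: "gmat X = gmat Y \<longleftrightarrow> X = Y"
  by (metis hmat_gmat)

definition sp_act :: "qmat \<Rightarrow> jC \<Rightarrow> jC"
  where "sp_act A X = hmat (cplx_mat A ** gmat X ** madj (cplx_mat A))"

lemma cplx_mat_unitary:
  assumes "A ** madj A = mat 1"
  shows "cplx_mat A ** madj (cplx_mat A) = mat 1" "madj (cplx_mat A) ** cplx_mat A = mat 1"
  using assms quat_matrix_left_right_inverse[OF assms] by (simp_all flip: cplx_mat_madj cplx_mat_mult add: cplx_mat_1)

text \<open>Conjugation by a unitary matrix keeps the trace zero and the matrix Hermitian, so
  \<open>gmat\<close> undoes \<open>hmat\<close> here.\<close>

lemma gmat_sp_act:
  assumes "A ** madj A = mat 1"
  shows "gmat (sp_act A X) = cplx_mat A ** gmat X ** madj (cplx_mat A)"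
proof -
  have "mtr (cplx_mat A ** gmat X ** madj (cplx_mat A)) = mtr (madj (cplx_mat A) ** (cplx_mat A ** gmat X))"
    by (rule mtr_mult_commute)
  then have "mtr (cplx_mat A ** gmat X ** madj (cplx_mat A)) = 0"
    by (simp add: matrix_mul_assoc cplx_mat_unitary[OF assms] mtr_gmat)
  then show ?thesis
    unfolding sp_act_def by (subst gmat_hmat) (simp_all add: madj_mult madj_gmat matrix_mul_assoc)
qed

lemma sp_act_mult:
  assumes "B ** madj B = mat 1"
  shows "sp_act (A ** B) X = sp_act A (sp_act B X)"
  by (simp add: sp_act_def[of A] gmat_sp_act[OF assms] sp_act_def[of "A ** B"] cplx_mat_mult madj_mult matrix_mul_assoc)

lemma sp_act_1: "sp_act (mat 1) X = X"
  by (simp add: sp_act_def cplx_mat_1 hmat_gmat)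

lemma sp_act_add: "sp_act A (X + Y) = sp_act A X + sp_act A Y"
  and sp_act_scale: "sp_act A (k *\<^sub>J X) = k *\<^sub>J sp_act A X"
  by (simp_all add: sp_act_def gmat_add gmat_scale mmult_add hmat_add mscale_mult_left mscale_mult_right hmat_mscale)

lemma mjprod_conjugate:
  assumes "madj A ** A = mat 1"
  shows "mjprod (A ** M ** madj A) (A ** N ** madj A) = A ** mjprod M N ** madj A"
proof -
  have "(A ** M ** madj A) ** (A ** N ** madj A) = A ** (M ** N) ** madj A" for M N
  proof -
    have "(A ** M ** madj A) ** (A ** N ** madj A) = A ** (M ** (madj A ** A) ** N) ** madj A"
      by (simp only: matrix_mul_assoc)
    then show ?thesis
      by (simp only: assms matrix_mul_rid)
  qed
  then show ?thesis
    unfolding mjprod_def by (simp only: mmult_add mscale_mult_left mscale_mult_right)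
qed

lemma sp_act_twisted_auto:
  assumes A: "A ** madj A = mat 1"
  shows "sp_act A \<in> twisted_auto"
proof -
  note U = cplx_mat_unitary[OF A]
  have A': "madj A ** madj (madj A) = mat 1"
    using quat_matrix_left_right_inverse[OF A] by simp
  have "bij (sp_act A)"
  proof (rule o_bij)
    show "sp_act (madj A) \<circ> sp_act A = id"
      using sp_act_mult[OF A, of "madj A"] A' by (auto simp: fun_eq_iff sp_act_1)
    show "sp_act A \<circ> sp_act (madj A) = id"
      using sp_act_mult[OF A', of A] A by (auto simp: fun_eq_iff sp_act_1)
  qed
  moreover have inner: "jinner (jgamma (sp_act A X)) (sp_act A Y) = jinner (jgamma X) Y" for X Y
  proof -
    have "jinner (jgamma (sp_act A X)) (sp_act A Y) =
        mtr ((cplx_mat A ** gmat X ** madj (cplx_mat A)) ** (cplx_mat A ** gmat Y ** madj (cplx_mat A)))"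
      by (simp only: gmat_sp_act[OF A] flip: mtr_gmat_mult)
    also have "\<dots> = mtr (madj (cplx_mat A) ** ((cplx_mat A ** gmat X ** madj (cplx_mat A)) ** (cplx_mat A ** gmat Y)))"
      by (simp only: matrix_mul_assoc mtr_mult_commute[of _ "madj (cplx_mat A)"])
    also have "\<dots> = mtr ((madj (cplx_mat A) ** cplx_mat A) ** gmat X ** (madj (cplx_mat A) ** cplx_mat A) ** gmat Y)"
      by (simp only: matrix_mul_assoc)
    finally show ?thesis
      by (simp add: U mtr_gmat_mult)
  qed
  \<comment> \<open>Conjugation respects the Jordan product. Comparing \<open>mjprod_gmat\<close>
    for the images and for X, Y, the scalar terms agree by \<open>inner\<close> and cancel.\<close>
  moreover have cross: "jgamma (sp_act A (jgamma (jcross X Y))) = jcross (sp_act A X) (sp_act A Y)" for X Y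
  proof -
    let ?C = "\<lambda>N. cplx_mat A ** N ** madj (cplx_mat A)"
    have "gmat (jgamma (jcross (sp_act A X) (sp_act A Y))) + mscale (jinner (jgamma X) Y / 4) (mat 1) =
        mjprod (?C (gmat X)) (?C (gmat Y))"
      using mjprod_gmat[of "sp_act A X" "sp_act A Y"] by (simp only: gmat_sp_act[OF A] inner)
    also have "\<dots> = ?C (gmat (jgamma (jcross X Y)) + mscale (jinner (jgamma X) Y / 4) (mat 1))"
      by (simp only: mjprod_conjugate[OF U(2)] mjprod_gmat)
    also have "\<dots> = gmat (sp_act A (jgamma (jcross X Y))) + mscale (jinner (jgamma X) Y / 4) (mat 1)"
      by (simp add: mmult_add mscale_mult_left mscale_mult_right U gmat_sp_act[OF A])
    finally have "jgamma (jcross (sp_act A X) (sp_act A Y)) = sp_act A (jgamma (jcross X Y))"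
      by (simp add: gmat_inj)
    then show ?thesis
      by (metis jgamma_gamma)
  qed
  moreover have "jinner (jgamma (sp_act A (jgamma X))) (sp_act A Y) = jinner X Y" for X Y
    by (simp add: inner)
  moreover have "sp_act A (jtau (jgamma X)) = jtau (jgamma (sp_act A X))" for X
  proof -
    have "gmat (sp_act A (jtau (jgamma X))) = gmat (jtau (jgamma (sp_act A X)))"
      by (simp add: gmat_sp_act[OF A] gmat_tau_gamma mbar_mult mbar_cplx_mat mbar_madj)
    then show ?thesis
      by (simp add: gmat_inj)
  qed
  ultimately show ?thesis
    by (simp add: twisted_auto_def sp_act_add sp_act_scale)
qed

section \<open>From twisted automorphisms back to symplectic matrices\<close>

definition gmat1 :: "jC \<Rightarrow> complex \<Rightarrow> complex quat^4^4"
  where "gmat1 X m = gmat X + mscale m (mat 1)"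

lemma hmat_mat1: "hmat (mat 1) = 0"
proof -
  have "gmat (hmat (mat 1)) = 0"
    by (simp add: gmat_hmat mtr_mat1)
  moreover have "gmat 0 = 0"
    using gmat_scale[of 0 0] by simp
  ultimately show ?thesis
    by (metis gmat_inj)
qed

lemma hmat_gmat1: "hmat (gmat1 X m) = X"
  by (simp add: gmat1_def hmat_add hmat_mscale hmat_mat1 hmat_gmat)

lemma mtr_gmat1: "mtr (gmat1 X m) = 4 * m"
  by (simp add: gmat1_def mtr_add mtr_mscale mtr_mat1 mtr_gmat)

lemma gmat1_hmat: "madj N = N \<Longrightarrow> gmat1 (hmat N) (mtr N / 4) = N"
  by (simp add: gmat1_def gmat_hmat)

text \<open>The Jordan algebra of all Hermitian matrices in terms of J^C + C. A linear map that
  respects \<gamma>(X x Y) and (\<gamma>X,Y) therefore extends by the identity on C to a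
  homomorphism.\<close>

lemma mjprod_gmat1:
  "mjprod (gmat1 X m) (gmat1 Y n) =
     gmat1 (jgamma (jcross X Y) + n *\<^sub>J X + m *\<^sub>J Y) (jinner (jgamma X) Y / 4 + m * n)"
proof -
  have "mjprod (gmat1 X m) (gmat1 Y n) = mjprod (gmat X) (gmat Y) + mscale n (gmat X) + mscale m (gmat Y) + mscale (m * n) (mat 1)"
    by (simp add: mjprod_def gmat1_def mmult_add mscale_mult_left mscale_mult_right)
      (simp add: vec_eq_iff quat_eq_iff algebra_simps)
  then show ?thesis
    by (simp add: mjprod_gmat gmat1_def gmat_add gmat_scale mscale_add_left)
qed

lemma gmat1_linear:
  "gmat1 X m + gmat1 Y n = gmat1 (X + Y) (m + n)" "mscale k (gmat1 X m) = gmat1 (k *\<^sub>J X) (k * m)"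
  by (simp_all add: gmat1_def gmat_add gmat_scale mscale_add mscale_add_left)

lemma jtau_add: "jtau (X + Y) = jtau X + jtau Y"
  and jtau_scale: "jtau (k *\<^sub>J X) = cnj k *\<^sub>J jtau X"
  by (cases X rule: jordan_coords_cases; cases Y rule: jordan_coords_cases;
      simp add: jmk_scale jmk_add jmk_tau jmk_eq_iff quat_eq_iff)+

lemma twisted_auto_imp_sp_act:
  assumes b: "b \<in> twisted_auto"
  obtains A where "A ** madj A = mat 1" "b = sp_act A"
proof -
  have add: "b (X + Y) = b X + b Y" and sc: "b (k *\<^sub>J X) = k *\<^sub>J b X"
    and cross: "jgamma (b (jgamma (jcross X Y))) = jcross (b X) (b Y)"
    and inner: "jinner (jgamma (b (jgamma X))) (b Y) = jinner X Y"
    and real: "b (jtau (jgamma X)) = jtau (jgamma (b X))" for X Y k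
    using b by (simp_all add: twisted_auto_def)
  have b0: "b 0 = 0"
    using sc[of 0 0] by simp
  have cross': "b (jgamma (jcross X Y)) = jgamma (jcross (b X) (b Y))" for X Y
    using cross[of X Y] by (metis jgamma_gamma)
  have inner': "jinner (jgamma (b X)) (b Y) = jinner (jgamma X) Y" for X Y
    using inner[of "jgamma X" Y] by simp
  \<comment> \<open>N = g X + m E goes to g(b X) + m E, where m is a quarter of the trace;
    \<open>re_mat\<close> returns the result to real coefficients.\<close>
  define T where "T N = re_mat (gmat1 (b (hmat (cplx_mat N))) (mtr (cplx_mat N) / 4))" for N
  have cm: "cplx_mat N = gmat1 (hmat (cplx_mat N)) (mtr (cplx_mat N) / 4)" if "madj N = N" for N
    using that by (metis gmat1_hmat cplx_mat_madj)
  have mb: "mbar (gmat1 X (complex_of_real r)) = gmat1 (jtau (jgamma X)) (complex_of_real r)" for X r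
    unfolding gmat1_def gmat_tau_gamma by (simp add: mbar_def vec_eq_iff quat_eq_iff mat_def)
  \<comment> \<open>For real Hermitian N the element X is fixed by \<tau>\<gamma>. Since b commutes
    with \<tau>\<gamma>, the image matrix is real too and \<open>re_mat\<close> loses
    nothing.\<close>
  have cT: "cplx_mat (T N) = gmat1 (b (hmat (cplx_mat N))) (mtr (cplx_mat N) / 4)" if N: "madj N = N" for N
  proof -
    let ?X = "hmat (cplx_mat N)" and ?r = "mtr N / 4"
    have r: "mtr (cplx_mat N) / 4 = complex_of_real ?r"
      by (simp add: mtr_cplx_mat)
    have "gmat1 (jtau (jgamma ?X)) (complex_of_real ?r) = gmat1 ?X (complex_of_real ?r)"
      using mb[of ?X ?r] cm[OF N] mbar_cplx_mat[of N] by (simp only: r)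
    then have "jtau (jgamma ?X) = ?X"
      by (metis hmat_gmat1)
    then have "mbar (gmat1 (b ?X) (complex_of_real ?r)) = gmat1 (b ?X) (complex_of_real ?r)"
      by (simp only: mb flip: real)
    then show ?thesis
      unfolding T_def r by (rule cplx_mat_re_mat)
  qed
  have "herm_jordan_hom T"
    unfolding herm_jordan_hom_def
  proof (intro conjI allI impI)
    fix M N :: qmat assume M: "madj M = M" and N: "madj N = N"
    have "cplx_mat (T (M + N)) = cplx_mat (T M + T N)"
      using M N by (simp add: cplx_mat_add cT madj_add hmat_add add mtr_add gmat1_linear add_divide_distrib)
    then show "T (M + N) = T M + T N"
      by (simp add: cplx_mat_inj)
    let ?X = "hmat (cplx_mat M)" and ?Y = "hmat (cplx_mat N)" and ?m = "mtr (cplx_mat M) / 4" and ?n = "mtr (cplx_mat N) / 4"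
    have p: "cplx_mat (mjprod M N) = gmat1 (jgamma (jcross ?X ?Y) + ?n *\<^sub>J ?X + ?m *\<^sub>J ?Y) (jinner (jgamma ?X) ?Y / 4 + ?m * ?n)"
      unfolding cplx_mat_mjprod by (subst cm[OF M], subst cm[OF N]) (rule mjprod_gmat1)
    have "cplx_mat (T (mjprod M N)) = gmat1 (b (jgamma (jcross ?X ?Y) + ?n *\<^sub>J ?X + ?m *\<^sub>J ?Y)) (jinner (jgamma ?X) ?Y / 4 + ?m * ?n)"
      unfolding cT[OF mjprod_herm[OF M N]] p hmat_gmat1 mtr_gmat1 by (simp add: add_divide_distrib)
    also have "\<dots> = mjprod (gmat1 (b ?X) ?m) (gmat1 (b ?Y) ?n)"
      unfolding mjprod_gmat1 by (simp only: add sc cross' inner')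
    also have "\<dots> = cplx_mat (mjprod (T M) (T N))"
      by (simp only: cplx_mat_mjprod cT[OF M] cT[OF N])
    finally show "T (mjprod M N) = mjprod (T M) (T N)"
      by (simp add: cplx_mat_inj)
  next
    fix r and M :: qmat assume M: "madj M = M"
    have "cplx_mat (T (mscale r M)) = cplx_mat (mscale r (T M))"
      using M by (simp add: cplx_mat_mscale cT madj_mscale hmat_mscale sc mtr_mscale gmat1_linear)
    then show "T (mscale r M) = mscale r (T M)"
      by (simp add: cplx_mat_inj)
    have "cplx_mat (madj (T M)) = cplx_mat (T M)"
      by (simp add: cplx_mat_madj cT[OF M] gmat1_def madj_add madj_gmat madj_mscale)
    then show "madj (T M) = T M"
      by (simp add: cplx_mat_inj)
    have "mtr (cplx_mat (T M)) = mtr (cplx_mat M)"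
      by (simp add: cT[OF M] mtr_gmat1)
    then show "mtr (T M) = mtr M"
      by (simp add: mtr_cplx_mat)
  next
    have "cplx_mat (T (mat 1)) = cplx_mat (mat 1)"
      by (simp add: cT cplx_mat_1 hmat_mat1 b0 mtr_mat1 gmat1_def gmat_scale[of 0 0, simplified])
    then show "T (mat 1) = mat 1"
      by (simp add: cplx_mat_inj)
  qed
  then obtain A where A: "A ** madj A = mat 1" and TA: "\<And>N. madj N = N \<Longrightarrow> T N = A ** N ** madj A"
    using herm_jordan_hom_conjugation by metis
  have r: "b X = sp_act A X" if X: "jtau (jgamma X) = X" for X
  proof -
    have c: "cplx_mat (re_mat (gmat X)) = gmat X"
      by (rule cplx_mat_re_mat) (simp add: X flip: gmat_tau_gamma)
    have "cplx_mat (madj (re_mat (gmat X))) = cplx_mat (re_mat (gmat X))"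
      by (simp add: cplx_mat_madj c madj_gmat)
    then have h: "madj (re_mat (gmat X)) = re_mat (gmat X)"
      by (simp add: cplx_mat_inj)
    have "gmat (b X) = cplx_mat (T (re_mat (gmat X)))"
      by (simp add: cT[OF h] c hmat_gmat mtr_gmat gmat1_def)
    also have "\<dots> = cplx_mat A ** gmat X ** madj (cplx_mat A)"
      by (simp add: TA[OF h] cplx_mat_mult cplx_mat_madj c)
    finally show ?thesis
      by (metis sp_act_def hmat_gmat)
  qed
  have "b X = sp_act A X" for X
  proof -
    \<comment> \<open>Real and imaginary parts with respect to the antilinear involution
      \<tau>\<gamma>: both Y and Z are fixed by it, and X is a complex combination of them.\<close>
    define Y where "Y = X + jtau (jgamma X)"
    define Z where "Z = \<i> *\<^sub>J (X - jtau (jgamma X))"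
    have d: "jtau (V - W) = jtau V - jtau W" "jgamma (V - W) = jgamma V - jgamma W" for V W :: jC
      by (metis diff_conv_add_uminus jtau_add jtau_minus)
        (metis diff_conv_add_uminus jgamma_add jgamma_minus)
    have Y: "jtau (jgamma Y) = Y"
      by (simp add: Y_def jgamma_add jtau_add jtau_gamma add.commute)
    have Z: "jtau (jgamma Z) = Z"
      by (simp add: Z_def jgamma_scale jtau_scale d jtau_gamma jscale_minus_left jscale_diff)
    have "X = (1/2) *\<^sub>J Y + (- \<i> / 2) *\<^sub>J Z"
      by (simp add: Y_def Z_def jscale_add jscale_diff flip: jscale_add_left)
    then show ?thesis
      by (metis add sc sp_act_add sp_act_scale r Y Z)
  qed
  then have "b = sp_act A"
    by (simp add: fun_eq_iff)
  with A show thesis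
    by (rule that)
qed

section \<open>Uniqueness of the symplectic matrix up to sign\<close>

lemma commuting_quat_matrix_scalar:
  fixes C :: qmat
  assumes c: "\<And>i j x. i \<noteq> j \<Longrightarrow> C ** mher i j x = mher i j x ** C"
  obtains r where "C = mscale r (mat 1)"
proof -
  have e: "(C ** mher i j x) $ k $ l = (if l = j then C $ k $ i * x else 0) + (if l = i then C $ k $ j * qcnj x else 0)"
    "(mher i j x ** C) $ k $ l = (if k = i then x * C $ j $ l else 0) + (if k = j then qcnj x * C $ i $ l else 0)" for i j k l x
    by (simp_all add: mher_def mmult_add munit_mult_nth)
  \<comment> \<open>With a third index j, the (k,j) entries of the two products with
    \<open>mher i j 1\<close> are C_ki and 0.\<close>
  have off: "C $ k $ i = 0" if "k \<noteq> i" for k i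
  proof -
    have "\<exists>j::4. j \<noteq> k \<and> j \<noteq> i"
    proof -
      have "card {k, i} < CARD(4)"
        using that by simp
      then have "{k, i} \<noteq> UNIV"
        by auto
      then show ?thesis
        by blast
    qed
    then obtain j where j: "j \<noteq> k" "j \<noteq> i" by blast
    have "(C ** mher i j 1) $ k $ j = (mher i j 1 ** C) $ k $ j"
      using c[of i j 1] j by simp
    then show ?thesis
      using that j by (simp add: e)
  qed
  have d: "C $ i $ i * x = x * C $ j $ j" if "i \<noteq> j" for i j x
  proof -
    have "(C ** mher i j x) $ i $ j = (mher i j x ** C) $ i $ j"
      using c[OF that] by simp
    then show ?thesis
      using that by (simp add: e)
  qed
  define z where "z = C $ 1 $ 1"
  have z: "C $ i $ i = z" for i
    using d[of 1 i 1] by (cases "i = 1") (auto simp: z_def)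
  have "z * x = x * z" for x
    using d[of 1 2 x] by (simp add: z)
  from this[of "Quat 0 1 0 0"] this[of "Quat 0 0 1 0"] have "z = qscale (q0 z) 1"
    by (simp add: quat_eq_iff quat_sel_mult)
  then have "C = mscale (q0 z) (mat 1)"
    using off z by (auto simp: vec_eq_iff mat_def)
  then show thesis
    by (rule that)
qed

text \<open>C = B^* A acts trivially, so it commutes with all real trace-free Hermitian matrices,
  which become values of \<open>gmat\<close>. Hence C is a real scalar r, and unitarity gives r^2 =
  1.\<close>

lemma sp_act_eq_imp:
  assumes A: "A ** madj A = mat 1" and B: "B ** madj B = mat 1" and eq: "sp_act A = sp_act B"
  shows "A = B \<or> A = - B"
proof -
  have B': "madj B ** madj (madj B) = mat 1"
    using quat_matrix_left_right_inverse[OF B] by simp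
  define C where "C = madj B ** A"
  have BC: "B ** C = A"
    by (simp add: C_def matrix_mul_assoc B)
  have C: "C ** madj C = mat 1"
  proof -
    have "C ** madj C = madj B ** (A ** madj A) ** B"
      by (simp only: C_def madj_mult madj_madj matrix_mul_assoc)
    then show ?thesis
      using B' by (simp add: A)
  qed
  have "sp_act C X = X" for X
    using sp_act_mult[OF A, of "madj B" X] sp_act_mult[OF B, of "madj B" X] B' by (simp add: C_def eq sp_act_1)
  then have g: "gmat X = cplx_mat C ** gmat X ** madj (cplx_mat C)" for X
    using gmat_sp_act[OF C, of X] by simp
  have "C ** N = N ** C" if N: "madj N = N" "mtr N = 0" for N
  proof -
    have "gmat (hmat (cplx_mat N)) = cplx_mat N"
      using N by (subst gmat_hmat) (simp_all flip: cplx_mat_madj add: mtr_cplx_mat)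
    then have "cplx_mat N = cplx_mat (C ** N ** madj C)"
      using g[of "hmat (cplx_mat N)"] by (simp add: cplx_mat_mult cplx_mat_madj)
    then have "N ** C = C ** N ** (madj C ** C)"
      unfolding cplx_mat_inj matrix_mul_assoc by simp
    then show ?thesis
      by (simp add: quat_matrix_left_right_inverse[OF C])
  qed
  moreover have "mtr (mher i j x) = 0" if "i \<noteq> j" for i j and x :: "real quat"
    using that by (auto simp: mtr_def mher_def munit_nth intro!: sum.neutral)
  ultimately obtain r where r: "C = mscale r (mat 1)"
    using commuting_quat_matrix_scalar[of C] madj_mher by metis
  have "mat 1 = C ** madj C"
    by (simp only: C)
  also have "\<dots> = mscale (r * r) (mat 1)"
    by (simp add: r madj_mscale mscale_mult_left mscale_mult_right)
  finally have "(mat 1 :: qmat) $ 1 $ 1 = mscale (r * r) (mat 1 :: qmat) $ 1 $ 1"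
    by (rule arg_cong[where f = "\<lambda>M. M $ 1 $ 1"])
  then have "r * r = 1"
    by (simp add: mat_def quat_eq_iff)
  then have "r = 1 \<or> r = - 1"
    by (metis power2_eq_square power2_eq_1_iff)
  moreover have "A = mscale r B"
    by (simp add: r mscale_mult_right flip: BC)
  moreover have "mscale (- 1) B = - B"
    by (simp add: vec_eq_iff quat_eq_iff)
  ultimately show ?thesis
    by auto
qed

lemma sp_act_minus: "sp_act (- A) = sp_act A"
proof -
  have "cplx_mat (- A) = - cplx_mat A"
    by (simp add: cplx_mat_def vec_eq_iff quat_eq_iff)
  moreover have "- M ** N = - (M ** N)" "M ** - N = - (M ** N)" "madj (- M) = - madj M" for M N :: "complex quat^4^4"
    by (simp_all add: vec_eq_iff matrix_matrix_mult_def sum_negf qcnj_minus)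
  ultimately show ?thesis
    by (simp add: sp_act_def fun_eq_iff)
qed

subsection \<open>Topology\<close>

lemma continuous_on_quat_sel:
  "continuous_on UNIV (q0 :: 'a::topological_space quat \<Rightarrow> 'a)" "continuous_on UNIV (q1 :: 'a quat \<Rightarrow> 'a)"
  "continuous_on UNIV (q2 :: 'a quat \<Rightarrow> 'a)" "continuous_on UNIV (q3 :: 'a quat \<Rightarrow> 'a)"
proof -
  have *: "(\<lambda>(a, b, c, d). Quat a b c d) -` (q0 -` B) = B \<times> UNIV \<times> UNIV \<times> UNIV"
    "(\<lambda>(a, b, c, d). Quat a b c d) -` (q1 -` B) = UNIV \<times> B \<times> UNIV \<times> UNIV"
    "(\<lambda>(a, b, c, d). Quat a b c d) -` (q2 -` B) = UNIV \<times> UNIV \<times> B \<times> UNIV"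
    "(\<lambda>(a, b, c, d). Quat a b c d) -` (q3 -` B) = UNIV \<times> UNIV \<times> UNIV \<times> B" for B :: "'a set"
    by auto
  show "continuous_on UNIV (q0 :: 'a quat \<Rightarrow> 'a)" "continuous_on UNIV (q1 :: 'a quat \<Rightarrow> 'a)"
    "continuous_on UNIV (q2 :: 'a quat \<Rightarrow> 'a)" "continuous_on UNIV (q3 :: 'a quat \<Rightarrow> 'a)"
    by (simp_all only: continuous_on_open_vimage[OF open_UNIV] Int_UNIV_right open_quat_def *)
      (auto intro!: open_Times)
qed

lemma continuous_on_quat_iff:
  "continuous_on S f \<longleftrightarrow> continuous_on S (\<lambda>x. q0 (f x)) \<and> continuous_on S (\<lambda>x. q1 (f x)) \<and>
    continuous_on S (\<lambda>x. q2 (f x)) \<and> continuous_on S (\<lambda>x. q3 (f x))" (is "?l \<longleftrightarrow> ?r")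
proof
  assume ?l
  then show ?r
    by (intro conjI continuous_on_compose2[OF continuous_on_quat_sel(1)]
      continuous_on_compose2[OF continuous_on_quat_sel(2)] continuous_on_compose2[OF continuous_on_quat_sel(3)]
      continuous_on_compose2[OF continuous_on_quat_sel(4)]) auto
next
  assume r: ?r
  have "continuous_on UNIV (\<lambda>(a, b, c, d). Quat a b c d)"
    by (simp add: continuous_on_open_vimage open_quat_def)
  then have "continuous_on S (\<lambda>x. (\<lambda>(a, b, c, d). Quat a b c d) (q0 (f x), q1 (f x), q2 (f x), q3 (f x)))"
    by (rule continuous_on_compose2) (use r in \<open>auto intro!: continuous_on_Pair\<close>)
  then show ?l
    by simp
qed

lemma continuous_on_cay_sel:
  "continuous_on UNIV (cfst :: 'a::topological_space cay \<Rightarrow> 'a quat)"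
  "continuous_on UNIV (csnd :: 'a cay \<Rightarrow> 'a quat)"
proof -
  have *: "(\<lambda>(m, a). Cay m a) -` (cfst -` B) = B \<times> UNIV"
    "(\<lambda>(m, a). Cay m a) -` (csnd -` B) = UNIV \<times> B" for B :: "'a quat set"
    by auto
  show "continuous_on UNIV (cfst :: 'a::topological_space cay \<Rightarrow> 'a quat)"
    "continuous_on UNIV (csnd :: 'a cay \<Rightarrow> 'a quat)"
    by (simp_all only: continuous_on_open_vimage[OF open_UNIV] Int_UNIV_right open_cay_def *)
      (auto intro!: open_Times)
qed

lemma continuous_on_cay_iff:
  "continuous_on S f \<longleftrightarrow> continuous_on S (\<lambda>x. cfst (f x)) \<and> continuous_on S (\<lambda>x. csnd (f x))" (is "?l \<longleftrightarrow> ?r")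
proof
  assume ?l
  then show ?r
    by (intro conjI continuous_on_compose2[OF continuous_on_cay_sel(1)]
      continuous_on_compose2[OF continuous_on_cay_sel(2)]) auto
next
  assume r: ?r
  have "continuous_on UNIV (\<lambda>(m, a). Cay m a)"
    by (simp add: continuous_on_open_vimage open_cay_def)
  then have "continuous_on S (\<lambda>x. (\<lambda>(m, a). Cay m a) (cfst (f x), csnd (f x)))"
    by (rule continuous_on_compose2) (use r in \<open>auto intro!: continuous_on_Pair\<close>)
  then show ?l
    by simp
qed

lemma continuous_on_vec_iff:
  fixes f :: "'a::topological_space \<Rightarrow> 'b::topological_space^'n"
  shows "continuous_on S f \<longleftrightarrow> (\<forall>i. continuous_on S (\<lambda>x. f x $ i))"
  unfolding continuous_on_def by (metis tendsto_vec_nth vec_tendstoI)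

text \<open>The topology on \<open>jordan\<close> is induced by \<open>jmat\<close>, so continuity
  can be tested on the entries.\<close>

lemma continuous_on_jordan_iff:
  fixes f :: "'a::topological_space \<Rightarrow> 'b::{field, topological_space} jordan"
  shows "continuous_on S f \<longleftrightarrow>
    (\<forall>i j. continuous_on S (\<lambda>x. cfst (jmat (f x) $ i $ j)) \<and> continuous_on S (\<lambda>x. csnd (jmat (f x) $ i $ j)))"
proof -
  have "continuous_on S f \<longleftrightarrow> continuous_on S (\<lambda>x. jmat (f x))"
  proof
    have "continuous_on UNIV (jmat :: 'b jordan \<Rightarrow> _)"
      unfolding continuous_on_open_vimage[OF open_UNIV] open_jordan_def Int_UNIV_right by blast
    then show "continuous_on S (\<lambda>x. jmat (f x))" if "continuous_on S f"
      by (rule continuous_on_compose2) (use that in auto)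
  next
    assume j: "continuous_on S (\<lambda>x. jmat (f x))"
    show "continuous_on S f"
      unfolding continuous_on_open_invariant
    proof (intro allI impI)
      fix B :: "'b jordan set" assume "open B"
      then obtain V where V: "open V" "B = jmat -` V"
        unfolding open_jordan_def by blast
      then obtain A where "open A" "A \<inter> S = (\<lambda>x. jmat (f x)) -` V \<inter> S"
        using j unfolding continuous_on_open_invariant by blast
      then show "\<exists>A. open A \<and> A \<inter> S = f -` B \<inter> S"
        using V(2) by (intro exI[of _ A]) (simp add: vimage_def)
    qed
  qed
  then show ?thesis
    by (simp add: continuous_on_vec_iff continuous_on_cay_iff)
qed

lemma continuous_on_quat_ops:
  fixes f g :: "'a::topological_space \<Rightarrow> 'b::real_normed_field quat"
  shows "continuous_on S f \<Longrightarrow> continuous_on S g \<Longrightarrow> continuous_on S (\<lambda>x. f x * g x)"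
    and "continuous_on S f \<Longrightarrow> continuous_on S (\<lambda>x. - f x)"
    and "continuous_on S f \<Longrightarrow> continuous_on S (\<lambda>x. qcnj (f x))"
    and "continuous_on S f \<Longrightarrow> continuous_on S (\<lambda>x. qscale k (f x))"
  by (simp_all add: continuous_on_quat_iff quat_sel_mult) (auto intro!: continuous_intros)

lemma continuous_on_quat_sum:
  fixes f :: "'i \<Rightarrow> 'a::topological_space \<Rightarrow> 'b::real_normed_field quat"
  assumes "\<And>i. continuous_on S (f i)"
  shows "continuous_on S (\<lambda>x. \<Sum>i\<in>I. f i x)"
proof (induction I rule: infinite_finite_induct)
  case (insert i I)
  with assms[of i] show ?case
    by (auto simp: continuous_on_quat_iff intro!: continuous_on_add)
qed (simp_all add: continuous_on_quat_iff)

lemma continuous_on_jmk: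
  assumes "continuous_on S a" "continuous_on S b" "continuous_on S c" "continuous_on S m1" "continuous_on S m2"
    "continuous_on S m3" "continuous_on S n1" "continuous_on S n2" "continuous_on S n3"
  shows "continuous_on S (\<lambda>x. jmk (a x) (b x) (c x) (m1 x) (m2 x) (m3 x) (n1 x) (n2 x) (n3 x))"
  using assms
  by (simp add: continuous_on_jordan_iff forall_3 jmat_jmk continuous_on_quat_ops)
    (simp add: continuous_on_quat_iff)

lemma continuous_on_jgamma:
  "continuous_on S f \<Longrightarrow> continuous_on S (\<lambda>x. jgamma (f x))" for f :: "'a::topological_space \<Rightarrow> jC"
  by (simp add: continuous_on_jordan_iff jgamma.rep_eq cmat_map_def continuous_on_quat_ops)

lemma continuous_on_jminus:
  "continuous_on S f \<Longrightarrow> continuous_on S (\<lambda>x. - f x)" for f :: "'a::topological_space \<Rightarrow> jC"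
  by (simp add: continuous_on_jordan_iff uminus_jordan.rep_eq continuous_on_quat_ops)

lemma continuous_on_sp_act: "continuous_on S (\<lambda>A. sp_act A X)"
proof -
  have e: "continuous_on S (\<lambda>A :: qmat. A $ i $ j)" for i j
    using continuous_on_id[of S, unfolded continuous_on_vec_iff] by blast
  have c: "continuous_on S (\<lambda>A. cplx_mat A $ i $ j)" for i j
    using e[of i j] by (simp add: cplx_mat_def continuous_on_quat_iff continuous_on_of_real)
  have n: "continuous_on S (\<lambda>A. (cplx_mat A ** gmat X ** madj (cplx_mat A)) $ i $ j)" for i j
    unfolding matrix_matrix_mult_def
    by (simp add: continuous_on_quat_sum continuous_on_quat_ops c continuous_on_const)
  have q: "continuous_on S (\<lambda>A. q0 ((cplx_mat A ** gmat X ** madj (cplx_mat A)) $ i $ j))" for i j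
    using n[of i j] by (simp add: continuous_on_quat_iff)
  show ?thesis
    unfolding sp_act_def hmat_def mtr_def
    by (intro continuous_on_jmk continuous_on_quat_ops n continuous_on_diff continuous_on_add
        continuous_on_divide continuous_on_sum q continuous_on_const) simp_all
qed

lemma continuous_on_pact:
  assumes "z = id \<or> z = uminus"
  shows "continuous_on S (\<lambda>A. z (pact (sp_act A) P))"
proof (cases P)
  case (fields X Y \<xi> \<eta>)
  show ?thesis
    using assms
    by (auto simp: fields pact_def intro!: continuous_on_Pair continuous_on_jgamma continuous_on_jminus
        continuous_on_sp_act)
qed

text \<open>Hausdorffness of spaces of maps is derived from such separating complex-valued
  coordinates instead of separation classes on \<open>quat\<close>, \<open>cay\<close> and
  \<open>jordan\<close>.\<close>

lemma pC_separated:
  fixes P Q :: pC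
  assumes "P \<noteq> Q"
  obtains c :: "pC \<Rightarrow> complex" where "continuous_on UNIV c" "c P \<noteq> c Q"
proof -
  have q: "\<exists>c :: 'x \<Rightarrow> complex. continuous_on UNIV c \<and> c x \<noteq> c y"
    if "continuous_on UNIV h" "h x \<noteq> h y" for h :: "'x::topological_space \<Rightarrow> complex quat" and x y
    using that by (auto simp: continuous_on_quat_iff quat_eq_iff)
  have j: "\<exists>c :: 'x \<Rightarrow> complex. continuous_on UNIV c \<and> c x \<noteq> c y"
    if h: "continuous_on UNIV h" "h x \<noteq> h y" for h :: "'x::topological_space \<Rightarrow> jC" and x y
  proof -
    obtain i j where "jmat (h x) $ i $ j \<noteq> jmat (h y) $ i $ j"
      using h(2) by (auto simp: jordan_eq_iff vec_eq_iff)
    then consider "cfst (jmat (h x) $ i $ j) \<noteq> cfst (jmat (h y) $ i $ j)" |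
        "csnd (jmat (h x) $ i $ j) \<noteq> csnd (jmat (h y) $ i $ j)"
      by (auto simp: cay_eq_iff)
    moreover have "continuous_on UNIV (\<lambda>x. cfst (jmat (h x) $ i $ j))" "continuous_on UNIV (\<lambda>x. csnd (jmat (h x) $ i $ j))"
      using h(1) by (auto simp: continuous_on_jordan_iff)
    ultimately show ?thesis
      by cases (use q in blast)+
  qed
  have f: "continuous_on UNIV (\<lambda>P :: pC. fst P)" "continuous_on UNIV (\<lambda>P :: pC. fst (snd P))"
    "continuous_on UNIV (\<lambda>P :: pC. fst (snd (snd P)))" "continuous_on UNIV (\<lambda>P :: pC. snd (snd (snd P)))"
    by (intro continuous_on_fst continuous_on_snd continuous_on_id)+
  consider "fst P \<noteq> fst Q" | "fst (snd P) \<noteq> fst (snd Q)" | "fst (snd (snd P)) \<noteq> fst (snd (snd Q))" |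
      "snd (snd (snd P)) \<noteq> snd (snd (snd Q))"
    using assms by (auto simp: prod_eq_iff)
  then show thesis
  proof cases
    case 1 then show thesis using j[OF f(1)] that by blast
  next
    case 2 then show thesis using j[OF f(2)] that by blast
  next
    case 3 then show thesis using f(3) that by blast
  next
    case 4 then show thesis using f(4) that by blast
  qed
qed

lemma Hausdorff_space_pC_maps: "Hausdorff_space (top_of_set (S :: (pC \<Rightarrow> pC) set))"
  unfolding Hausdorff_space_def
proof (intro allI impI)
  fix f g :: "pC \<Rightarrow> pC" assume h: "f \<in> topspace (top_of_set S) \<and> g \<in> topspace (top_of_set S) \<and> f \<noteq> g"
  then obtain P where "f P \<noteq> g P"
    by (auto simp: fun_eq_iff)
  then obtain c :: "pC \<Rightarrow> complex" where c: "continuous_on UNIV c" "c (f P) \<noteq> c (g P)"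
    by (rule pC_separated)
  then obtain U V where UV: "open U" "open V" "c (f P) \<in> U" "c (g P) \<in> V" "U \<inter> V = {}"
    using hausdorff[OF c(2)] by auto
  have o: "open ((\<lambda>h. c (h P)) -` W)" if "open W" for W
  proof -
    have "continuous_on UNIV (\<lambda>h. c (h P))"
      using c(1) continuous_on_product_coordinates[of P] by (rule continuous_on_compose2) auto
    then show ?thesis
      using that by (simp add: continuous_on_open_vimage)
  qed
  show "\<exists>U V. openin (top_of_set S) U \<and> openin (top_of_set S) V \<and> f \<in> U \<and> g \<in> V \<and> disjnt U V"
    using h UV o[of U] o[of V]
    by (intro exI[of _ "S \<inter> (\<lambda>h. c (h P)) -` U"] exI[of _ "S \<inter> (\<lambda>h. c (h P)) -` V"])
      (auto simp: disjnt_def openin_open_Int)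
qed

section \<open>Compactness of Sp(4)\<close>

lemma qmat_adj_eq: "qmat_adj = madj"
  by (simp add: fun_eq_iff qmat_adj_def madj_def)

lemma carrier_Sp4: "carrier Sp4 = {A. A ** madj A = mat 1}"
  by (simp add: Sp4_def qmat_adj_eq)

lemma norm_vec_le_sum: "norm x \<le> (\<Sum>i\<in>UNIV. norm (x $ i))" for x :: "'a::real_normed_vector^'n"
  unfolding norm_vec_def by (rule L2_set_le_sum) simp

text \<open>Closedness and boundedness are checked in the Euclidean space of real coordinates; the
  compact set found there is mapped onto the group by a continuous surjection.\<close>

lemma compact_Sp4: "compact (carrier Sp4)"
proof -
  define g :: "real^4^4^4 \<Rightarrow> qmat" where "g v = (\<chi> i j. Quat (v $ i $ j $ 1) (v $ i $ j $ 2) (v $ i $ j $ 3) (v $ i $ j $ 4))" for v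
  have e: "continuous_on UNIV (\<lambda>v :: real^4^4^4. v $ i $ j $ k)" for i j k
    by (intro continuous_on_component continuous_on_id)
  have g: "continuous_on UNIV g"
    by (simp add: continuous_on_vec_iff g_def continuous_on_quat_iff e)
  have gij: "continuous_on UNIV (\<lambda>v. g v $ i $ j)" for i j
    using g by (simp add: continuous_on_vec_iff)
  define C where "C = g -` carrier Sp4"
  have m: "continuous_on UNIV (\<lambda>v. (g v ** madj (g v)) $ i $ j)" for i j
    unfolding matrix_matrix_mult_def by (simp add: continuous_on_quat_sum continuous_on_quat_ops gij)
  have "C = (\<Inter>i. \<Inter>j. {v. q0 ((g v ** madj (g v)) $ i $ j) = q0 (mat 1 $ i $ j)} \<inter> {v. q1 ((g v ** madj (g v)) $ i $ j) = q1 (mat 1 $ i $ j)}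
    \<inter> {v. q2 ((g v ** madj (g v)) $ i $ j) = q2 (mat 1 $ i $ j)} \<inter> {v. q3 ((g v ** madj (g v)) $ i $ j) = q3 (mat 1 $ i $ j)})"
    by (auto simp: C_def carrier_Sp4 vec_eq_iff quat_eq_iff)
  also have "closed \<dots>"
    using m by (intro closed_INT ballI closed_Int closed_Collect_eq continuous_on_const) (auto simp: continuous_on_quat_iff)
  finally have closed: "closed C" .
  \<comment> \<open>The (i,i) entry of A A^* is the sum of the norms in row i; being 1, it bounds
    every coordinate.\<close>
  have "\<bar>v $ i $ j $ k\<bar> \<le> 1" if "v \<in> C" for v i j k
  proof -
    have "(g v ** madj (g v)) $ i $ i = 1"
      using that by (simp add: C_def carrier_Sp4 mat_def)
    then have "q0 ((g v ** madj (g v)) $ i $ i) = 1"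
      by simp
    then have s: "(\<Sum>l\<in>UNIV. qin (g v $ i $ l) (g v $ i $ l)) = 1"
      by (simp add: matrix_matrix_mult_def q0_sum quat_sel_mult qin_def)
    have "qin (g v $ i $ j) (g v $ i $ j) \<le> (\<Sum>l\<in>UNIV. qin (g v $ i $ l) (g v $ i $ l))"
      by (rule member_le_sum) (auto simp: qin_def)
    then have "(v $ i $ j $ 1)\<^sup>2 + (v $ i $ j $ 2)\<^sup>2 + (v $ i $ j $ 3)\<^sup>2 + (v $ i $ j $ 4)\<^sup>2 \<le> 1"
      unfolding s by (simp add: qin_def g_def power2_eq_square)
    moreover have "(v $ i $ j $ k)\<^sup>2 \<le> (v $ i $ j $ 1)\<^sup>2 + (v $ i $ j $ 2)\<^sup>2 + (v $ i $ j $ 3)\<^sup>2 + (v $ i $ j $ 4)\<^sup>2"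
      using exhaust_4[of k] by auto
    ultimately show ?thesis
      by (simp add: abs_square_le_1[symmetric])
  qed
  note le1 = this
  have "norm v \<le> (\<Sum>i\<in>(UNIV::4 set). \<Sum>j\<in>(UNIV::4 set). \<Sum>k\<in>(UNIV::4 set). 1)" if "v \<in> C" for v
  proof -
    have 1: "norm (v $ i $ j) \<le> (\<Sum>k\<in>(UNIV::4 set). 1)" for i j
      using le1[OF that] by (intro order_trans[OF norm_vec_le_sum] sum_mono) simp
    have 2: "norm (v $ i) \<le> (\<Sum>j\<in>(UNIV::4 set). \<Sum>k\<in>(UNIV::4 set). 1)" for i
      by (intro order_trans[OF norm_vec_le_sum] sum_mono 1)
    show ?thesis
      by (intro order_trans[OF norm_vec_le_sum] sum_mono 2)
  qed
  then have "bounded C"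
    unfolding bounded_iff by blast
  with closed have "compact C"
    by (simp add: compact_eq_bounded_closed)
  moreover have "g ` C = carrier Sp4"
  proof -
    have "\<exists>v. A = g v" for A
      by (rule exI[of _ "\<chi> i j. vector [q0 (A $ i $ j), q1 (A $ i $ j), q2 (A $ i $ j), q3 (A $ i $ j)]"])
        (simp add: g_def vec_eq_iff)
    then have "surj g"
      by (simp add: surj_def)
    then show ?thesis
      unfolding C_def by (rule surj_image_vimage_eq)
  qed
  ultimately show ?thesis
    by (metis compact_continuous_image continuous_on_subset g subset_UNIV)
qed

text \<open>A preimage is the union of its slices, and each slice is open because the points of the
  second factor are open.\<close>

lemma continuous_map_prod_discrete:
  assumes "\<And>y. y \<in> topspace Y \<Longrightarrow> openin Y {y}"
    and "\<And>y. y \<in> topspace Y \<Longrightarrow> continuous_map X Z (\<lambda>x. f (x, y))"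
  shows "continuous_map (prod_topology X Y) Z f"
  unfolding continuous_map
proof (intro conjI allI impI)
  show "f ` topspace (prod_topology X Y) \<subseteq> topspace Z"
    using assms(2) by (force simp: continuous_map_def Pi_iff)
  fix V assume V: "openin Z V"
  have "{p \<in> topspace (prod_topology X Y). f p \<in> V} = (\<Union>y\<in>topspace Y. {x \<in> topspace X. f (x, y) \<in> V} \<times> {y})"
    by auto
  moreover have "openin (prod_topology X Y) ({x \<in> topspace X. f (x, y) \<in> V} \<times> {y})" if "y \<in> topspace Y" for y
    using assms that V by (auto simp: openin_prod_Times_iff continuous_map_def)
  ultimately show "openin (prod_topology X Y) {p \<in> topspace (prod_topology X Y). f p \<in> V}"
    by auto
qed

lemma topspace_quotient_topology: "topspace (quotient_topology T f) = f ` topspace T"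
proof -
  have "openin (quotient_topology T f) (f ` topspace T)"
  proof -
    have "{x \<in> topspace T. f x \<in> f ` topspace T} = topspace T"
      by auto
    then show ?thesis
      by (simp add: openin_quotient_topology)
  qed
  then show ?thesis
    by (metis openin_quotient_topology openin_subset openin_topspace subset_antisym)
qed

lemma continuous_map_quotient_topology: "continuous_map T (quotient_topology T f) f"
  unfolding continuous_map by (auto simp: topspace_quotient_topology openin_quotient_topology)

lemma continuous_map_from_quotient_topology:
  assumes "continuous_map T Z (\<lambda>x. g (f x))"
  shows "continuous_map (quotient_topology T f) Z g"
  unfolding continuous_map
proof (intro conjI allI impI)
  show "g ` topspace (quotient_topology T f) \<subseteq> topspace Z"
    using assms by (auto simp: topspace_quotient_topology continuous_map_def Pi_iff)
  fix V assume "openin Z V"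
  then have "openin T {x \<in> topspace T. g (f x) \<in> V}"
    using assms by (simp add: continuous_map_def)
  moreover have "{x \<in> topspace T. f x \<in> {y \<in> f ` topspace T. g y \<in> V}} = {x \<in> topspace T. g (f x) \<in> V}"
    by auto
  ultimately show "openin (quotient_topology T f) {x \<in> topspace (quotient_topology T f). g x \<in> V}"
    by (auto simp: topspace_quotient_topology openin_quotient_topology)
qed

subsection \<open>The isomorphism\<close>

lemma mat_minus_mult:
  fixes A B :: "'a::ring_1^'n^'n"
  shows "- A ** B = - (A ** B)" "A ** - B = - (A ** B)"
  by (simp_all add: vec_eq_iff matrix_matrix_mult_def sum_negf)

lemma madj_minus: "madj (- A) = - madj A"
  by (simp add: vec_eq_iff qcnj_minus)

lemma group_Sp4: "group Sp4"
proof (rule groupI)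
  fix A B assume "A \<in> carrier Sp4" "B \<in> carrier Sp4"
  then have AB: "A ** madj A = mat 1" "B ** madj B = mat 1"
    by (simp_all add: carrier_Sp4)
  have "(A ** B) ** madj (A ** B) = A ** (B ** madj B) ** madj A"
    by (simp only: madj_mult matrix_mul_assoc)
  then show "A \<otimes>\<^bsub>Sp4\<^esub> B \<in> carrier Sp4"
    unfolding carrier_Sp4 by (simp add: AB) (simp add: Sp4_def)
next
  fix A assume "A \<in> carrier Sp4"
  then have "madj A ** A = mat 1"
    by (simp add: carrier_Sp4 quat_matrix_left_right_inverse)
  then show "\<exists>B\<in>carrier Sp4. B \<otimes>\<^bsub>Sp4\<^esub> A = \<one>\<^bsub>Sp4\<^esub>"
    by (intro bexI[of _ "madj A"]) (simp_all add: carrier_Sp4, simp add: Sp4_def)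
qed (simp_all add: carrier_Sp4, simp_all add: Sp4_def matrix_mul_assoc)

lemma Sp4_mult [simp]: "A \<otimes>\<^bsub>Sp4\<^esub> B = A ** B" and Sp4_one [simp]: "\<one>\<^bsub>Sp4\<^esub> = mat 1"
  by (simp_all add: Sp4_def)

lemma normal_center_Sp4: "{mat 1, - mat 1} \<lhd> Sp4"
proof -
  interpret group Sp4 by (rule group_Sp4)
  have "subgroup {mat 1, - mat 1} Sp4"
  proof (rule subgroupI)
    show "{mat 1, - mat 1} \<subseteq> carrier Sp4"
      by (simp add: carrier_Sp4 madj_minus mat_minus_mult)
    have "inv\<^bsub>Sp4\<^esub> (- mat 1) = - mat 1"
      by (rule inv_equality) (simp_all add: carrier_Sp4 madj_minus mat_minus_mult)
    then show "inv\<^bsub>Sp4\<^esub> A \<in> {mat 1, - mat 1}" if "A \<in> {mat 1, - mat 1}" for A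
      using that inv_one by (auto simp del: inv_one)
  qed (auto simp: mat_minus_mult)
  moreover have "A ** h ** inv\<^bsub>Sp4\<^esub> A \<in> {mat 1, - mat 1}" if "A \<in> carrier Sp4" "h \<in> {mat 1, - mat 1}" for A h
    using r_inv[OF that(1)] that(2) by (auto simp: mat_minus_mult)
  ultimately show ?thesis
    by (simp add: normal_inv_iff)
qed

lemma rcos_center_Sp4: "{mat 1, - mat 1} #>\<^bsub>Sp4\<^esub> A = {A, - A}"
  by (auto simp: r_coset_def mat_minus_mult)

lemma group_sign: "group (comp_group {id, uminus})"
  by (rule groupI) (auto simp: comp_group_def fun_eq_iff)

definition sp_map :: "qmat \<Rightarrow> pC \<Rightarrow> pC"
  where "sp_map A = pact (sp_act A)"

lemma sp_map_minus: "sp_map (- A) = sp_map A"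
  by (simp add: sp_map_def sp_act_minus)

lemma sp_map_mult: "B \<in> carrier Sp4 \<Longrightarrow> sp_map (A ** B) = sp_map A \<circ> sp_map B"
  by (auto simp: sp_map_def pact_def fun_eq_iff carrier_Sp4 sp_act_mult)

lemma sp_map_uminus: "sp_map A \<circ> uminus = uminus \<circ> sp_map A"
proof -
  have "sp_act A (- X) = - sp_act A X" for X
    using sp_act_scale[of A "- 1" X] by (simp add: jscale_minus_left)
  then show ?thesis
    by (auto simp: sp_map_def pact_def fun_eq_iff jgamma_minus)
qed

lemma sp_map_eq_imp:
  assumes "A \<in> carrier Sp4" "B \<in> carrier Sp4" "sp_map A = sp_map B"
  shows "A = B \<or> A = - B"
proof -
  have "sp_act A X = sp_act B X" for X
    using fun_cong[OF assms(3), of "(X, 0, 0, 0)"] by (simp add: sp_map_def pact_def)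
  then show ?thesis
    using sp_act_eq_imp assms(1,2) by (simp add: carrier_Sp4 fun_eq_iff)
qed

lemma E7_fix_inter_eq:
  "E7_fix (plambda \<circ> pgamma) \<inter> E7_fix (piota \<circ> plambda \<circ> pgamma) =
     {z \<circ> sp_map A | z A. z \<in> {id, uminus} \<and> A \<in> carrier Sp4}" (is "?K = ?R")
proof
  have k: "pscale 1 = id" "pscale (- 1) = uminus"
    by (simp_all add: fun_eq_iff pscale_minus_1)
  show "?K \<subseteq> ?R"
  proof
    fix \<alpha> assume "\<alpha> \<in> ?K"
    then obtain b k where bk: "b \<in> twisted_auto" "k = 1 \<or> k = - 1" "\<alpha> = pscale k \<circ> pact b"
      unfolding E7_fix_inter_iff by (metis fix_imp_pact)
    moreover obtain A where "A ** madj A = mat 1" "b = sp_act A"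
      using bk(1) by (rule twisted_auto_imp_sp_act)
    ultimately show "\<alpha> \<in> ?R"
      using k by (force simp: sp_map_def carrier_Sp4)
  qed
  show "?R \<subseteq> ?K"
  proof
    fix \<alpha> assume "\<alpha> \<in> ?R"
    then obtain z A where \<alpha>: "\<alpha> = z \<circ> sp_map A" "z \<in> {id, uminus}" "A ** madj A = mat 1"
      by (auto simp: carrier_Sp4)
    then have "z = pscale 1 \<or> z = pscale (- 1)"
      by (auto simp: k)
    then obtain k where "z = pscale k" "k = 1 \<or> k = - 1"
      by blast
    then show "\<alpha> \<in> ?K"
      unfolding E7_fix_inter_iff \<alpha> sp_map_def
      using pscale_in_fix[OF _ pact_in_E7[OF sp_act_twisted_auto[OF \<alpha>(3)]]] by simp
  qed
qed

text \<open>The two maps are distinguished by a continuous real function: the real part of the third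
  component of the value at (0,0,1,0) is 1 or -1.\<close>

lemma openin_sign:
  assumes "z \<in> {id, uminus :: pC \<Rightarrow> pC}"
  shows "openin (top_of_set {id, uminus}) {z}"
proof -
  define s where "s h = Re (fst (snd (snd (h (0, 0, 1, 0)))))" for h :: "pC \<Rightarrow> pC"
  have "continuous_on UNIV (\<lambda>h :: pC \<Rightarrow> pC. h (0, 0, 1, 0))"
    by (rule continuous_on_product_coordinates)
  then have s: "continuous_on UNIV s"
    unfolding s_def by (intro continuous_on_Re continuous_on_fst continuous_on_snd)
  have "open (s -` {0<..})" "open (s -` {..<0})"
    using s by (simp_all add: continuous_on_open_vimage)
  moreover have "{id} = {id, uminus} \<inter> s -` {0<..}" "{uminus} = {id, uminus} \<inter> s -` {..<0}"
    by (auto simp: s_def)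
  ultimately have "openin (top_of_set {id, uminus}) {id :: pC \<Rightarrow> pC}"
    "openin (top_of_set {id, uminus}) {uminus :: pC \<Rightarrow> pC}"
    unfolding openin_open by blast+
  with assms show ?thesis
    by auto
qed

text \<open>\<open>sp_map A\<close> keeps the third component of (0,0,1,0) equal to 1, so the sign
  can be read off there and then cancelled.\<close>

lemma sign_comp_sp_map_eq:
  assumes z: "z \<in> {id, uminus}" "z' \<in> {id, uminus}" and eq: "z \<circ> sp_map A = z' \<circ> sp_map B"
  shows "z = z' \<and> sp_map A = sp_map B"
proof -
  have v: "fst (snd (snd (sp_map A (0, 0, 1, 0)))) = 1" for A
    by (simp add: sp_map_def pact_def)
  have "fst (snd (snd ((z \<circ> sp_map A) (0, 0, 1, 0)))) = fst (snd (snd ((z' \<circ> sp_map B) (0, 0, 1, 0))))"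
    by (simp only: eq)
  then have "z = z'"
    using z by (auto simp: v)
  moreover have "sp_map A P = sp_map B P" for P
    using fun_cong[OF eq, of P] z(1) \<open>z = z'\<close> by auto
  ultimately show ?thesis
    by (simp add: fun_eq_iff)
qed

theorem theorem4p15p4:
  fixes Z2 :: "(real quat^4^4) set" and ZZ2 K :: "(pC \<Rightarrow> pC) set"
  defines "Z2 \<equiv> {mat 1, - mat 1}"
    and "ZZ2 \<equiv> {id, uminus}"
    and "K \<equiv> E7_fix (plambda \<circ> pgamma) \<inter> E7_fix (piota \<circ> plambda \<circ> pgamma)"
  shows "top_group_iso
    (comp_group K) (top_of_set K)
    ((Sp4 Mod Z2) \<times>\<times> comp_group ZZ2)
    (prod_topology
      (quotient_topology (top_of_set (carrier Sp4)) (\<lambda>A. Z2 #>\<^bsub>Sp4\<^esub> A))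
      (top_of_set ZZ2))"
proof -
  let ?\<pi> = "\<lambda>A. Z2 #>\<^bsub>Sp4\<^esub> A" and ?H = "(Sp4 Mod Z2) \<times>\<times> comp_group ZZ2"
  let ?Q = "quotient_topology (top_of_set (carrier Sp4)) ?\<pi>"
  let ?T = "prod_topology ?Q (top_of_set ZZ2)"
  have normal: "Z2 \<lhd> Sp4"
    unfolding Z2_def by (rule normal_center_Sp4)
  interpret normal Z2 Sp4
    by (rule normal)
  have K: "K = {z \<circ> sp_map A | z A. z \<in> ZZ2 \<and> A \<in> carrier Sp4}"
    unfolding K_def ZZ2_def by (rule E7_fix_inter_eq)
  have pi: "?\<pi> A = {A, - A}" for A
    unfolding Z2_def by (rule rcos_center_Sp4)
  \<comment> \<open>On a coset {A, -A} the image under \<open>sp_map\<close> is a singleton, so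
    \<open>the_elem\<close> selects the common value.\<close>
  define \<Phi> where "\<Phi> = (\<lambda>(S, z :: pC \<Rightarrow> pC). z \<circ> the_elem (sp_map ` S))"
  have \<Phi>: "\<Phi> (?\<pi> A, z) = z \<circ> sp_map A" for A z
    by (simp add: \<Phi>_def pi sp_map_minus)
  have carrier_H: "carrier ?H = ?\<pi> ` carrier Sp4 \<times> ZZ2"
    by (auto simp: FactGroup_def RCOSETS_def comp_group_def)
  have group_H: "group ?H"
    unfolding ZZ2_def by (rule DirProd_group[OF factorgroup_is_group group_sign])
  have "\<Phi> \<in> hom ?H (comp_group K)"
  proof (rule homI)
    fix x y assume "x \<in> carrier ?H" "y \<in> carrier ?H"
    then obtain A z B z' where x: "x = (?\<pi> A, z)" "A \<in> carrier Sp4" "z \<in> ZZ2"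
      and y: "y = (?\<pi> B, z')" "B \<in> carrier Sp4" "z' \<in> ZZ2"
      unfolding carrier_H by blast
    show "\<Phi> x \<in> carrier (comp_group K)"
      using x by (auto simp: \<Phi> comp_group_def K)
    have "x \<otimes>\<^bsub>?H\<^esub> y = (?\<pi> (A ** B), z \<circ> z')"
      using x y rcos_sum[of A B] by (simp add: FactGroup_def comp_group_def)
    then have "\<Phi> (x \<otimes>\<^bsub>?H\<^esub> y) = z \<circ> z' \<circ> (sp_map A \<circ> sp_map B)"
      using y(2) by (simp add: \<Phi> sp_map_mult)
    moreover have "sp_map A \<circ> z' = z' \<circ> sp_map A"
      using y(3) sp_map_uminus[of A] by (auto simp: ZZ2_def)
    then have "z \<circ> z' \<circ> (sp_map A \<circ> sp_map B) = (z \<circ> sp_map A) \<circ> (z' \<circ> sp_map B)"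
      by (simp only: fun_eq_iff comp_apply) simp
    ultimately show "\<Phi> (x \<otimes>\<^bsub>?H\<^esub> y) = \<Phi> x \<otimes>\<^bsub>comp_group K\<^esub> \<Phi> y"
      by (simp add: x(1) y(1) \<Phi> comp_group_def)
  qed
  moreover have inj: "inj_on \<Phi> (carrier ?H)"
  proof (rule inj_onI)
    fix x y assume "x \<in> carrier ?H" "y \<in> carrier ?H" and eq: "\<Phi> x = \<Phi> y"
    then obtain A z B z' where x: "x = (?\<pi> A, z)" "A \<in> carrier Sp4" "z \<in> ZZ2"
      and y: "y = (?\<pi> B, z')" "B \<in> carrier Sp4" "z' \<in> ZZ2"
      unfolding carrier_H by blast
    have "z = z' \<and> sp_map A = sp_map B"
      using eq x y by (intro sign_comp_sp_map_eq) (auto simp: ZZ2_def \<Phi>)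
    then show "x = y"
      using sp_map_eq_imp[OF x(2) y(2)] by (auto simp: x(1) y(1) pi)
  qed
  moreover have img: "\<Phi> ` carrier ?H = K"
    unfolding carrier_H K by (force simp: \<Phi>)
  ultimately have iso: "\<Phi> \<in> iso ?H (comp_group K)"
    by (simp add: iso_def bij_betw_def comp_group_def)
  have topspace_T: "topspace ?T = carrier ?H"
    unfolding carrier_H by (simp add: topspace_quotient_topology)
  have "homeomorphic_map ?T (top_of_set K) \<Phi>"
  proof (rule continuous_imp_homeomorphic_map)
    \<comment> \<open>Continuity is checked for each fixed sign and before passing to cosets; the
      quotient topology and the discreteness of the second factor do the rest.\<close>
    have "continuous_map (top_of_set (carrier Sp4)) euclidean (\<lambda>A. \<Phi> (?\<pi> A, z))" if "z \<in> ZZ2" for z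
    proof -
      have "continuous_on (carrier Sp4) (\<lambda>A. z (sp_map A P))" for P
        using that unfolding sp_map_def by (intro continuous_on_pact) (simp add: ZZ2_def)
      then have "continuous_on (carrier Sp4) (\<lambda>A. \<Phi> (?\<pi> A, z))"
        unfolding \<Phi> by (intro continuous_on_coordinatewise_then_product) simp
      then show ?thesis
        by simp
    qed
    then have "continuous_map ?Q euclidean (\<lambda>S. \<Phi> (S, z))" if "z \<in> ZZ2" for z
      using that by (intro continuous_map_from_quotient_topology)
    then have "continuous_map ?T euclidean \<Phi>"
      by (intro continuous_map_prod_discrete) (auto simp: ZZ2_def intro: openin_sign)
    then show "continuous_map ?T (top_of_set K) \<Phi>"
      using img topspace_T by (auto simp: continuous_map_in_subtopology)
    have "compactin ?Q (?\<pi> ` carrier Sp4)"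
      using compact_Sp4 by (intro image_compactin[OF _ continuous_map_quotient_topology]) (simp add: compactin_subtopology)
    then have "compact_space ?Q"
      by (simp add: compact_space_def topspace_quotient_topology)
    moreover have "compact_space (top_of_set ZZ2)"
      by (intro compact_space_subtopology) (simp add: ZZ2_def finite_imp_compact)
    ultimately show "compact_space ?T"
      by (simp add: compact_space_prod_topology)
    show "Hausdorff_space (top_of_set K)"
      by (rule Hausdorff_space_pC_maps)
    show "\<Phi> ` topspace ?T = topspace (top_of_set K)" "inj_on \<Phi> (topspace ?T)"
      using img inj topspace_T by simp_all
  qed
  then obtain g where g: "homeomorphic_maps ?T (top_of_set K) \<Phi> g"
    by (auto simp: homeomorphic_map_maps)
  \<comment> \<open>One and the same map must be the isomorphism and the homeomorphism. The
    algebraic inverse is \<open>inv_into\<close>, the topological one is g, and they agree on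
    K.\<close>
  have "homeomorphic_map (top_of_set K) ?T (inv_into (carrier ?H) \<Phi>)"
  proof (rule homeomorphic_map_eq)
    show "homeomorphic_map (top_of_set K) ?T g"
      using g by (simp add: homeomorphic_maps_map)
    show "g y = inv_into (carrier ?H) \<Phi> y" if "y \<in> topspace (top_of_set K)" for y
    proof -
      have "y \<in> \<Phi> ` carrier ?H"
        using that by (simp only: img topspace_euclidean_subtopology)
      then obtain x where "x \<in> carrier ?H" "y = \<Phi> x"
        by blast
      moreover have "g (\<Phi> x) = x" if "x \<in> carrier ?H" for x
        using g that unfolding homeomorphic_maps_map topspace_T by blast
      ultimately show ?thesis
        by (simp only: inv_into_f_f[OF inj])
    qed
  qed
  moreover have "inv_into (carrier ?H) \<Phi> \<in> iso (comp_group K) ?H"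
    using group.iso_set_sym[OF group_H iso] .
  ultimately show ?thesis
    unfolding top_group_iso_def by blast
qed

end
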